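(* (Holomorphic Picard theorem for $\mathbb CP^1_{\mathbb Q}$) Any holomorphic line bundle $p:L\to\mathbb CP^1_{\mathbb Q}$ determines a number $q\in\mathbb Q$ such that $L$ is holomorphically equivalent to $\mathcal O_{\mathbb CP^1_{\mathbb Q}}(q)$.
   Context: Adelic solenoid: $S^1_{\mathbb Q}=\varprojlim S^1$, the inverse limit of copies of $S^1$ indexed by positive integers ordered by divisibility with bonding maps $z\mapsto z^{m/k}$ for $k\mid m$; $\pi_k$ are the projections. Its continuous characters are $\chi_q$, $q\in\mathbb Q$, with $\chi_{m/k}(\mathbf u)=\pi_k(\mathbf u)^m$. The adelic projective line $\mathbb CP^1_{\mathbb Q}=\varprojlim\mathbb CP^1$ (same bonding maps) consists of points $\boldsymbol0,\boldsymbol\infty$ and the elements $z=t\mathbf u$ (polar coordinates), $t>0$, $\mathbf u\in S^1_{\mathbb Q}$; $|t\mathbf u|=t$. $D^+_{\mathbb Q}(R)=\{|z|<R\}\ni\boldsymbol0$, $D^-_{\mathbb Q}(r)=\{|z|>r\}\ni\boldsymbol\infty$, $A(r,R)=\{r<|z|<R\}$. A continuous function on $D^+_{\mathbb Q}(R)$, $D^-_{\mathbb Q}(r)$, or $A(r,R)$ is holomorphic if on that set it equals an absolutely and locally uniformly convergent series $f(t\mathbf u)=\sum_q a_qt^q\chi_q(\mathbf u)$ over rationals $q\ge0$, $q\le0$, or all $q\in\mathbb Q$ respectively (with value $a_0$ at $\boldsymbol0$, $\boldsymbol\infty$). By definition, a holomorphic line bundle over $\mathbb CP^1_{\mathbb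 Q}$ is given by a holomorphic cocycle $f:A(r,R)\to\mathbb C^*$ for some $0\le r<1<R\le\infty$: it is the quotient of $D^+_{\mathbb Q}(R)\times\mathbb C\sqcup D^-_{\mathbb Q}(r)\times\mathbb C$ identifying $(z,W)$ with $(z,f(z)W)$ for $z\in A(r,R)$. Cocycles $f$ on $A(r,R)$ and $f'$ on $A(r',R')$ are holomorphically equivalent if, with $r''=\max\{r,r'\}$, $R''=\min\{R,R'\}$, there are holomorphic $\mathbb C^*$-valued maps $f_1$ on $D^-_{\mathbb Q}(r'')$ and $f_2$ on $D^+_{\mathbb Q}(R'')$ with $f_1ff_2^{-1}=f'$ on $A(r'',R'')$. $\mathcal O_{\mathbb CP^1_{\mathbb Q}}(m/k)=\pi_k^*\mathcal O_{\mathbb CP^1}(m)$ with $\pi_k:\mathbb CP^1_{\mathbb Q}\to\mathbb CP^1$ the level $k$ projection; as a holomorphic line bundle $\mathcal O_{\mathbb CP^1_{\mathbb Q}}(q)$ is given by the cocycle $t\mathbf u\mapsto t^q\chi_q(\mathbf u)$. *)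

theory Defs
  imports "HOL-Analysis.Analysis"
begin

text \<open>Inverse limits over the positive integers ordered by divisibility: \<^term>\<open>h n\<close> is the \<^term>\<open>n\<close>-th power map,
  so the bonding map from level \<^term>\<open>m\<close> to level
  \<^term>\<open>k\<close> (for \<^term>\<open>k dvd m\<close>) is \<^term>\<open>h (m div k)\<close>. A point is an (extensional) family indexed
  by the positive integers, and its \<^term>\<open>k\<close>-th projection is application to \<^term>\<open>k\<close>.\<close>

definition inverse_limit :: "'a topology \<Rightarrow> (nat \<Rightarrow> 'a \<Rightarrow> 'a) \<Rightarrow> (nat \<Rightarrow> 'a) topology" where
  "inverse_limit X h =
     subtopology (product_topology (\<lambda>_. X) {0<..})
       {x. \<forall>k m. 0 < k \<and> 0 < m \<and> k dvd m \<longrightarrow> h (m div k) (x m) = x k}"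

definition solenoid :: "(nat \<Rightarrow> complex) topology" where
  "solenoid = inverse_limit (top_of_set (sphere 0 1)) (\<lambda>n z. z ^ n)"

definition solenoid_char :: "rat \<Rightarrow> (nat \<Rightarrow> complex) \<Rightarrow> complex" where
  "solenoid_char q u = (case quotient_of q of (m, k) \<Rightarrow> u (nat k) powi m)"

text \<open>The complex projective line is the one-point compactification of the complex plane, with
  \<^term>\<open>None\<close> as the point at infinity.\<close>

type_synonym point = "nat \<Rightarrow> complex option"

definition adelic_line :: "point topology" where
  "adelic_line =
     inverse_limit (Alexandroff_compactification euclidean) (\<lambda>n. map_option (\<lambda>z. z ^ n))"

definition zero_point :: point where
  "zero_point = (\<lambda>k\<in>{0<..}. Some 0)"

definition infinity_point :: point where
  "infinity_point = (\<lambda>k\<in>{0<..}. None)"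

definition polar :: "real \<Rightarrow> (nat \<Rightarrow> complex) \<Rightarrow> point" where
  "polar t u = (\<lambda>k\<in>{0<..}. Some (of_real (t powr (1 / real k)) * u k))"

definition modulus :: "point \<Rightarrow> ereal" where
  "modulus z = (case z 1 of None \<Rightarrow> \<infinity> | Some w \<Rightarrow> ereal (norm w))"

definition direction :: "point \<Rightarrow> nat \<Rightarrow> complex" where
  "direction z = (\<lambda>k\<in>{0<..}. sgn (the (z k)))"

text \<open>The monomial sends \<^term>\<open>polar t u\<close> to \<^term>\<open>t powr of_rat q * solenoid_char q u\<close>. At the two
  distinguished points it takes the value of its continuous extension, which exists at
  \<^term>\<open>zero_point\<close> if \<^term>\<open>q \<ge> 0\<close> and at \<^term>\<open>infinity_point\<close> if \<^term>\<open>q \<le> 0\<close>; the values for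
  other \<^term>\<open>q\<close> are never used.\<close>

definition monomial :: "rat \<Rightarrow> point \<Rightarrow> complex" where
  "monomial q z =
     (if z = zero_point \<or> z = infinity_point then of_bool (q = 0)
      else of_real (real_of_ereal (modulus z) powr of_rat q) * solenoid_char q (direction z))"

definition disc_plus :: "ereal \<Rightarrow> point set" where
  "disc_plus R = {z \<in> topspace adelic_line. modulus z < R}"

definition disc_minus :: "ereal \<Rightarrow> point set" where
  "disc_minus r = {z \<in> topspace adelic_line. r < modulus z}"

definition annulus :: "ereal \<Rightarrow> ereal \<Rightarrow> point set" where
  "annulus r R = {z \<in> topspace adelic_line. r < modulus z \<and> modulus z < R}"

lemma solenoid_iff:
  "u \<in> topspace solenoid \<longleftrightarrow>
     u \<in> extensional {0<..} \<and> (\<forall>k>0. norm (u k) = 1) \<and>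
     (\<forall>k m. 0 < k \<and> 0 < m \<and> k dvd m \<longrightarrow> u m ^ (m div k) = u k)"
  by (auto simp: solenoid_def inverse_limit_def PiE_iff)

lemma adelic_line_iff:
  "z \<in> topspace adelic_line \<longleftrightarrow>
     z \<in> extensional {0<..} \<and>
     (\<forall>k m. 0 < k \<and> 0 < m \<and> k dvd m \<longrightarrow> map_option (\<lambda>w. w ^ (m div k)) (z m) = z k)"
  by (auto simp: adelic_line_def inverse_limit_def PiE_iff notin_range_Some)

lemma solenoid_norm: "u \<in> topspace solenoid \<Longrightarrow> 0 < k \<Longrightarrow> norm (u k) = 1"
  unfolding solenoid_iff by blast

lemma solenoid_extensional: "u \<in> topspace solenoid \<Longrightarrow> u \<in> extensional {0<..}"
  unfolding solenoid_iff by blast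

lemma solenoid_char_Fract:
  assumes u: "u \<in> topspace solenoid" and k: "k > 0"
  shows "solenoid_char (Fract m (int k)) u = u k powi m"
proof -
  obtain a b where ab: "quotient_of (Fract m (int k)) = (a, b)"
    by (cases "quotient_of (Fract m (int k))")
  have b: "b > 0"
    using quotient_of_denom_pos[OF ab] .
  define g where "g = gcd m (int k)"
  have g: "g > 0" "g dvd m" "g dvd int k"
    using k by (auto simp: g_def)
  have "a = m div g" "b = int k div g"
    using ab k by (auto simp: quotient_of_Fract Rat.normalize_def g_def Let_def split: if_splits)
  then have mk: "m = g * a" "int k = g * b"
    using g by auto
  then have k': "k = nat g * nat b"
    using g(1) b by (metis nat_int nat_mult_distrib less_imp_le)
  have "u k ^ (k div nat b) = u (nat b)"
  proof -
    have "nat b dvd k" "0 < nat b"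
      using b k' by auto
    with u k show ?thesis
      unfolding solenoid_iff by blast
  qed
  then have "u (nat b) = u k powi g"
    using k' b g(1) by (simp add: power_int_def)
  moreover have "solenoid_char (Fract m (int k)) u = u (nat b) powi a"
    unfolding solenoid_char_def ab by simp
  ultimately show ?thesis
    unfolding mk(1) power_int_mult by argo
qed

lemma adelic_line_level:
  assumes "z \<in> topspace adelic_line" "z 1 = Some w" "k > 0"
  obtains v where "z k = Some v" "v ^ k = w"
proof -
  have "map_option (\<lambda>v. v ^ (k div 1)) (z k) = z 1"
    using assms(1,3) unfolding adelic_line_iff by (meson less_one one_dvd)
  with assms(2) that show thesis
    by auto
qed

lemma modulus_polar:
  "0 < t \<Longrightarrow> u \<in> topspace solenoid \<Longrightarrow> modulus (polar t u) = ereal t"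
  by (simp add: modulus_def polar_def solenoid_norm norm_mult)

lemma direction_polar:
  assumes t: "0 < t" and u: "u \<in> topspace solenoid"
  shows "direction (polar t u) = u"
proof
  fix k
  show "direction (polar t u) k = u k"
  proof (cases "k > 0")
    case True
    then have "sgn (u k) = u k"
      using solenoid_norm[OF u] by (simp add: sgn_eq)
    moreover have "sgn (complex_of_real (t powr (1 / real k))) = 1"
      using t by (simp add: sgn_of_real)
    ultimately show ?thesis
      using True by (simp add: direction_def polar_def sgn_mult)
  next
    case False
    then show ?thesis
      using solenoid_extensional[OF u] by (auto simp: direction_def extensional_def)
  qed
qed

lemma polar_in_adelic_line:
  assumes t: "0 < t" and u: "u \<in> topspace solenoid"
  shows "polar t u \<in> topspace adelic_line"
proof -
  have *: "(of_real (t powr (1 / real m)) * u m) ^ (m div k) =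
      (of_real (t powr (1 / real k)) * u k :: complex)"
    if "0 < k" "0 < m" "k dvd m" for k m
  proof -
    obtain d where d: "m = k * d"
      using \<open>k dvd m\<close> by auto
    have "d > 0"
      using d that by (cases d) auto
    have "(t powr (1 / real m)) ^ d = t powr (1 / real m * real d)"
      using t by (simp add: powr_powr flip: powr_realpow)
    also have "1 / real m * real d = 1 / real k"
      using \<open>d > 0\<close> by (simp add: d)
    finally have "(t powr (1 / real m)) ^ d = t powr (1 / real k)" .
    moreover have "u m ^ d = u k"
      using u that d unfolding solenoid_iff by (metis nonzero_mult_div_cancel_left less_irrefl)
    moreover have "m div k = d"
      using that d by simp
    ultimately show ?thesis
      by (simp add: power_mult_distrib flip: of_real_power)
  qed
  show ?thesis
    unfolding adelic_line_iff by (auto simp: polar_def *)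
qed

lemma polar_decomposition:
  assumes z: "z \<in> topspace adelic_line" and "z \<noteq> zero_point" "z \<noteq> infinity_point"
  obtains t u where "0 < t" "u \<in> topspace solenoid" "z = polar t u"
proof -
  have ext: "z \<in> extensional {0<..}"
    and comp: "\<And>k m. 0 < k \<Longrightarrow> 0 < m \<Longrightarrow> k dvd m \<Longrightarrow>
      map_option (\<lambda>w. w ^ (m div k)) (z m) = z k"
    using z unfolding adelic_line_iff by auto
  have "z 1 \<noteq> None"
  proof
    assume "z 1 = None"
    then have "z k = None" if "k > 0" for k
      using comp[of 1 k] that by auto
    then have "z = infinity_point"
      using ext by (auto simp: infinity_point_def extensional_def fun_eq_iff)
    with assms show False by simp
  qed
  then obtain w where w: "z 1 = Some w" by auto
  have "w \<noteq> 0"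
  proof
    assume "w = 0"
    have "z k = Some 0" if k: "k > 0" for k
    proof -
      obtain v where "z k = Some v" "v ^ k = w"
        using adelic_line_level[OF z w k] .
      with \<open>w = 0\<close> show ?thesis by simp
    qed
    then have "z = zero_point"
      using ext by (auto simp: zero_point_def extensional_def fun_eq_iff)
    with assms show False by simp
  qed
  have zk: "z k = Some (of_real (norm w powr (1 / real k)) * direction z k) \<and>
      norm (direction z k) = 1" if k: "k > 0" for k
  proof -
    obtain v where v: "z k = Some v" "v ^ k = w"
      using adelic_line_level[OF z w k] .
    then have "v \<noteq> 0" using \<open>w \<noteq> 0\<close> k by auto
    have "norm w = norm v powr real k"
      using v \<open>v \<noteq> 0\<close> by (simp add: powr_realpow flip: norm_power)
    then have "norm w powr (1 / real k) = norm v"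
      using k by (simp add: powr_powr)
    then show ?thesis
      using v k \<open>v \<noteq> 0\<close> by (simp add: direction_def sgn_eq norm_divide)
  qed
  have pow: "direction z m ^ (m div k) = direction z k" if "0 < k" "0 < m" "k dvd m" for k m
  proof -
    obtain v where v: "z m = Some v"
      using zk[OF \<open>0 < m\<close>] by blast
    then have "z k = Some (v ^ (m div k))"
      using comp[OF that] by simp
    with v that show ?thesis
      by (simp add: direction_def sgn_eq norm_power power_divide)
  qed
  have "direction z \<in> extensional {0<..}"
    by (simp add: direction_def)
  then have "direction z \<in> topspace solenoid"
    unfolding solenoid_iff using zk pow by blast
  moreover have "z = polar (norm w) (direction z)"
  proof
    fix k show "z k = polar (norm w) (direction z) k"
      using zk[of k] ext by (cases "k > 0") (auto simp: polar_def extensional_def)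
  qed
  ultimately show ?thesis
    using \<open>w \<noteq> 0\<close> by (intro that[of "norm w" "direction z"]) auto
qed

lemma polar_not_special:
  assumes "0 < t" "u \<in> topspace solenoid"
  shows "polar t u \<noteq> zero_point" "polar t u \<noteq> infinity_point"
proof -
  have "modulus zero_point = 0" "modulus infinity_point = \<infinity>"
    by (simp_all add: modulus_def zero_point_def infinity_point_def)
  then show "polar t u \<noteq> zero_point" "polar t u \<noteq> infinity_point"
    using modulus_polar[OF assms] assms(1) by auto
qed

lemma monomial_polar:
  assumes "0 < t" "u \<in> topspace solenoid"
  shows "monomial q (polar t u) = of_real (t powr of_rat q) * solenoid_char q u"
  using assms by (simp add: monomial_def polar_not_special modulus_polar direction_polar)

text \<open>Hence \<^term>\<open>monomial (Fract m (int k))\<close> is the pullback along the level \<^term>\<open>k\<close>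
  projection of the cocycle \<^term>\<open>\<lambda>w::complex. w powi m\<close>.\<close>

lemma monomial_Fract:
  assumes "z \<in> topspace adelic_line" "z \<noteq> zero_point" "z \<noteq> infinity_point" "k > 0"
  shows "monomial (Fract m (int k)) z = the (z k) powi m"
proof -
  obtain t u where t: "0 < t" and u: "u \<in> topspace solenoid" and z: "z = polar t u"
    using polar_decomposition assms by blast
  have "(t powr (1 / real k)) powi m = (t powr (1 / real k)) powr real_of_int m"
    using t by (intro powr_real_of_int'[symmetric]) auto
  also have "\<dots> = t powr of_rat (Fract m (int k))"
    using \<open>k > 0\<close> by (simp add: of_rat_rat powr_powr)
  finally have "t powr of_rat (Fract m (int k)) = (t powr (1 / real k)) powi m"
    by simp
  moreover have "the (z k) = of_real (t powr (1 / real k)) * u k"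
    using \<open>k > 0\<close> by (simp add: z polar_def)
  ultimately show ?thesis
    unfolding z monomial_polar[OF t u] solenoid_char_Fract[OF u \<open>k > 0\<close>]
    by (simp add: power_int_mult_distrib)
qed

definition holomorphic_series_on ::
    "rat set \<Rightarrow> point set \<Rightarrow> (point \<Rightarrow> complex) \<Rightarrow> bool" where
  "holomorphic_series_on Q D f \<longleftrightarrow>
     continuous_map (subtopology adelic_line D) euclidean f \<and>
     (\<exists>a :: rat \<Rightarrow> complex.
        (\<forall>z\<in>D. (\<lambda>q. norm (a q * monomial q z)) summable_on Q) \<and>
        (\<forall>z\<in>D. \<exists>U. openin (subtopology adelic_line D) U \<and> z \<in> U \<and>
           uniform_limit U (\<lambda>F w. \<Sum>q\<in>F. a q * monomial q w) f (finite_subsets_at_top Q)))"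

definition holomorphic_disc_plus :: "ereal \<Rightarrow> (point \<Rightarrow> complex) \<Rightarrow> bool" where
  "holomorphic_disc_plus R f \<longleftrightarrow> holomorphic_series_on {0..} (disc_plus R) f"

definition holomorphic_disc_minus :: "ereal \<Rightarrow> (point \<Rightarrow> complex) \<Rightarrow> bool" where
  "holomorphic_disc_minus r f \<longleftrightarrow> holomorphic_series_on {..0} (disc_minus r) f"

definition holomorphic_annulus :: "ereal \<Rightarrow> ereal \<Rightarrow> (point \<Rightarrow> complex) \<Rightarrow> bool" where
  "holomorphic_annulus r R f \<longleftrightarrow> holomorphic_series_on UNIV (annulus r R) f"

definition holomorphic_cocycle :: "ereal \<Rightarrow> ereal \<Rightarrow> (point \<Rightarrow> complex) \<Rightarrow> bool" where
  "holomorphic_cocycle r R f \<longleftrightarrow>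
     0 \<le> r \<and> r < 1 \<and> 1 < R \<and> holomorphic_annulus r R f \<and> (\<forall>z\<in>annulus r R. f z \<noteq> 0)"

definition equivalent_cocycles ::
    "ereal \<Rightarrow> ereal \<Rightarrow> (point \<Rightarrow> complex) \<Rightarrow> ereal \<Rightarrow> ereal \<Rightarrow> (point \<Rightarrow> complex) \<Rightarrow> bool" where
  "equivalent_cocycles r R f r' R' f' \<longleftrightarrow>
     (\<exists>f1 f2.
        holomorphic_disc_minus (max r r') f1 \<and> (\<forall>z\<in>disc_minus (max r r'). f1 z \<noteq> 0) \<and>
        holomorphic_disc_plus (min R R') f2 \<and> (\<forall>z\<in>disc_plus (min R R'). f2 z \<noteq> 0) \<and>
        (\<forall>z\<in>annulus (max r r') (min R R'). f1 z * f z * inverse (f2 z) = f' z))"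

definition quotient_topology :: "'a topology \<Rightarrow> ('a \<times> 'a) set \<Rightarrow> 'a set topology" where
  "quotient_topology X E =
     topology (\<lambda>U. U \<subseteq> topspace X // E \<and> openin X {x \<in> topspace X. E `` {x} \<in> U})"

lemma openin_quotient_topology:
  "openin (quotient_topology X E) U \<longleftrightarrow>
     U \<subseteq> topspace X // E \<and> openin X {x \<in> topspace X. E `` {x} \<in> U}"
proof -
  have "istopology (\<lambda>U. U \<subseteq> topspace X // E \<and> openin X {x \<in> topspace X. E `` {x} \<in> U})"
    unfolding istopology_def
  proof (intro conjI allI impI; (elim conjE)?)
    fix S T
    assume "openin X {x \<in> topspace X. E `` {x} \<in> S}" "openin X {x \<in> topspace X. E `` {x} \<in> T}"
    then have "openin X ({x \<in> topspace X. E `` {x} \<in> S} \<inter> {x \<in> topspace X. E `` {x} \<in> T})"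
      by (rule openin_Int)
    also have "{x \<in> topspace X. E `` {x} \<in> S} \<inter> {x \<in> topspace X. E `` {x} \<in> T} =
        {x \<in> topspace X. E `` {x} \<in> S \<inter> T}"
      by auto
    finally show "openin X {x \<in> topspace X. E `` {x} \<in> S \<inter> T}" .
  next
    fix K
    assume K: "\<forall>S\<in>K. S \<subseteq> topspace X // E \<and> openin X {x \<in> topspace X. E `` {x} \<in> S}"
    then have "openin X (\<Union>S\<in>K. {x \<in> topspace X. E `` {x} \<in> S})"
      by blast
    also have "(\<Union>S\<in>K. {x \<in> topspace X. E `` {x} \<in> S}) = {x \<in> topspace X. E `` {x} \<in> \<Union>K}"
      by auto
    finally show "openin X {x \<in> topspace X. E `` {x} \<in> \<Union>K}" .
  qed auto
  then show ?thesis
    by (simp add: quotient_topology_def)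
qed

lemma topspace_quotient_topology: "topspace (quotient_topology X E) = topspace X // E"
proof -
  have "{x \<in> topspace X. E `` {x} \<in> topspace X // E} = topspace X"
    by (auto simp: quotientI)
  then have "openin (quotient_topology X E) (topspace X // E)"
    by (simp add: openin_quotient_topology)
  then show ?thesis
    by (metis openin_quotient_topology openin_subset openin_topspace subset_antisym)
qed

lemma quotient_map_quotient_topology:
  "quotient_map X (quotient_topology X E) (\<lambda>x. E `` {x})"
  by (auto simp: quotient_map_def topspace_quotient_topology openin_quotient_topology
      quotient_def)

datatype chart = Plus | Minus

type_synonym chart_point = "chart \<times> point \<times> complex"

definition chart_space :: "ereal \<Rightarrow> ereal \<Rightarrow> chart_point topology" where
  "chart_space r R =
     sum_topology
       (\<lambda>c. prod_topology
          (subtopology adelic_line (case c of Plus \<Rightarrow> disc_plus R | Minus \<Rightarrow> disc_minus r))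
          euclidean)
       {Plus, Minus}"

definition glue :: "ereal \<Rightarrow> ereal \<Rightarrow> (point \<Rightarrow> complex) \<Rightarrow> (chart_point \<times> chart_point) set" where
  "glue r R f = {((Plus, z, W), (Minus, z, f z * W)) | z W. z \<in> annulus r R}"

definition glue_equiv ::
    "ereal \<Rightarrow> ereal \<Rightarrow> (point \<Rightarrow> complex) \<Rightarrow> (chart_point \<times> chart_point) set" where
  "glue_equiv r R f = Id_on (topspace (chart_space r R)) \<union> glue r R f \<union> (glue r R f)\<inverse>"

text \<open>A bundle is its total space together with its projection to \<^term>\<open>adelic_line\<close>.\<close>

type_synonym adelic_bundle = "chart_point set topology \<times> (chart_point set \<Rightarrow> point)"

definition line_bundle :: "ereal \<Rightarrow> ereal \<Rightarrow> (point \<Rightarrow> complex) \<Rightarrow> adelic_bundle" where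
  "line_bundle r R f =
     (let L = quotient_topology (chart_space r R) (glue_equiv r R f)
      in (L, \<lambda>x\<in>topspace L. THE z. \<exists>c W. (c, z, W) \<in> x))"

definition holomorphic_line_bundle :: "adelic_bundle \<Rightarrow> bool" where
  "holomorphic_line_bundle B \<longleftrightarrow>
     (\<exists>r R f. holomorphic_cocycle r R f \<and> B = line_bundle r R f)"

definition holomorphically_equivalent :: "adelic_bundle \<Rightarrow> adelic_bundle \<Rightarrow> bool" where
  "holomorphically_equivalent B B' \<longleftrightarrow>
     (\<exists>r R f r' R' f'. holomorphic_cocycle r R f \<and> B = line_bundle r R f \<and>
        holomorphic_cocycle r' R' f' \<and> B' = line_bundle r' R' f' \<and>
        equivalent_cocycles r R f r' R' f')"

definition adelic_O :: "rat \<Rightarrow> adelic_bundle" where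
  "adelic_O q = line_bundle 0 \<infinity> (monomial q)"

lemma topspace_chart_space:
  "topspace (chart_space r R) =
     {Plus} \<times> disc_plus R \<times> UNIV \<union> {Minus} \<times> disc_minus r \<times> UNIV"
  by (auto simp: chart_space_def disc_plus_def disc_minus_def)

lemma equiv_glue_equiv:
  assumes "\<forall>z\<in>annulus r R. f z \<noteq> 0"
  shows "equiv (topspace (chart_space r R)) (glue_equiv r R f)"
  using assms
  by (auto simp: equiv_def refl_on_def sym_def trans_def glue_equiv_def glue_def
      topspace_chart_space annulus_def disc_plus_def disc_minus_def)

lemma exists_point_of_modulus:
  assumes "0 < t"
  shows "\<exists>z\<in>topspace adelic_line. modulus z = ereal t"
proof -
  have "(\<lambda>k\<in>{0<..}. 1) \<in> topspace solenoid"
    by (auto simp: solenoid_iff)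
  with assms show ?thesis
    using polar_in_adelic_line modulus_polar by blast
qed

lemma disc_plus_mono_imp:
  assumes "disc_plus R \<subseteq> disc_plus R'" "0 < R'"
  shows "R \<le> R'"
proof (rule ccontr)
  assume "\<not> R \<le> R'"
  then obtain t where t: "R' < ereal t" "ereal t < R"
    using ereal_dense2[of R' R] by (meson not_le)
  with \<open>0 < R'\<close> have "0 < t"
    by (metis ereal_less(2) less_trans)
  with t show False
    using exists_point_of_modulus[of t] assms(1) by (force simp: disc_plus_def)
qed

lemma disc_minus_mono_imp:
  assumes "disc_minus r' \<subseteq> disc_minus r" "0 \<le> r'"
  shows "r \<le> r'"
proof (rule ccontr)
  assume "\<not> r \<le> r'"
  then obtain t where t: "r' < ereal t" "ereal t < r"
    using ereal_dense2[of r' r] by (meson not_le)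
  with \<open>0 \<le> r'\<close> have "0 < t"
    by (metis ereal_less(2) le_less_trans)
  with t show False
    using exists_point_of_modulus[of t] assms(1) by (force simp: disc_minus_def)
qed

text \<open>A bundle determines its cocycle, so the existential quantifiers in the definition of
  \<^term>\<open>holomorphically_equivalent\<close> involve no choice.\<close>

lemma line_bundle_determines_cocycle:
  assumes f: "holomorphic_cocycle r R f" and f': "holomorphic_cocycle r' R' f'"
    and eq: "line_bundle r R f = line_bundle r' R' f'"
  shows "r' = r" "R' = R" "\<forall>z\<in>annulus r R. f' z = f z"
proof -
  let ?X = "topspace (chart_space r R)" and ?E = "glue_equiv r R f"
  let ?X' = "topspace (chart_space r' R')" and ?E' = "glue_equiv r' R' f'"
  have E: "equiv ?X ?E" and E': "equiv ?X' ?E'"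
    using f f' by (auto simp: holomorphic_cocycle_def intro!: equiv_glue_equiv)
  have quot: "?X // ?E = ?X' // ?E'"
    using arg_cong[OF eq, of "\<lambda>B. topspace (fst B)"]
    by (simp add: line_bundle_def Let_def topspace_quotient_topology)
  then have X: "?X = ?X'"
    using Union_quotient[OF E] Union_quotient[OF E'] by simp
  then have plus: "disc_plus R = disc_plus R'" and minus: "disc_minus r = disc_minus r'"
    by (auto simp: topspace_chart_space)
  have bounds: "0 < R" "0 < R'" "0 \<le> r" "0 \<le> r'"
    using f f' by (auto simp: holomorphic_cocycle_def intro: less_trans[OF zero_less_one])
  show R: "R' = R"
    using disc_plus_mono_imp[of R R'] disc_plus_mono_imp[of R' R] plus bounds by auto
  show r: "r' = r"
    using disc_minus_mono_imp[of r r'] disc_minus_mono_imp[of r' r] minus bounds by auto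
  show "\<forall>z\<in>annulus r R. f' z = f z"
  proof
    fix z assume z: "z \<in> annulus r R"
    let ?p = "(Plus, z, 1)" and ?m = "(Minus, z, f z)"
    have pm: "(?p, ?m) \<in> ?E"
      using z by (auto simp: glue_equiv_def glue_def)
    then have "?p \<in> ?X"
      using E by (meson equiv_class_eq_iff)
    then have "?E `` {?p} \<in> ?X' // ?E'"
      using quot by (metis quotientI)
    moreover have "?p \<in> ?E `` {?p}" "?m \<in> ?E `` {?p}"
      using pm equiv_class_self[OF E \<open>?p \<in> ?X\<close>] by auto
    ultimately have "(?p, ?m) \<in> ?E'"
      using E' by (meson quotient_eq_iff)
    then show "f' z = f z"
      by (auto simp: glue_equiv_def glue_def)
  qed
qed

end

theory Submission
  imports Defs "HOL-Computational_Algebra.Fundamental_Theorem_Algebra"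
begin

text \<open>
  Write \<open>z\<^sup>q\<close> for \<^term>\<open>monomial q z\<close>. Existence of \<open>q\<close> amounts to a factorization \<open>f\<^sub>1 f = f\<^sub>2 z\<^sup>q\<close>
  of the cocycle, where \<open>f\<^sub>1\<close> and \<open>f\<^sub>2\<close> are zero-free, with exponents \<open>\<le> 0\<close> and \<open>\<ge> 0\<close>
  respectively; uniqueness says that \<open>q\<close> can be read off from \<open>f\<close>.

  Both rest on a theorem of Wiener-Levy type (\<open>nonvanishing_series_exp\<close>). On a closed annulus the
  series \<open>\<Sum> a\<^sub>q z\<^sup>q\<close> with finite weighted \<open>\<ell>\<^sup>1\<close> norm form a Banach algebra, and every zero-free
  element is of the form \<open>z\<^sup>q exp g\<close> with \<open>g\<close> in the same algebra. To see this, approximate \<open>f\<close> in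
  norm by a finite partial sum \<open>P\<close>. The exponents of \<open>P\<close> have a common denominator \<open>k\<close>, so \<open>P\<close> is
  a Laurent polynomial in \<open>z\<^sup>1\<^sup>/\<^sup>k\<close>, and a product of linear factors with no root in the annulus;
  the logarithm of each factor is an explicit power series, up to a monomial. It remains to take
  the logarithm of \<open>1 + h\<close> with \<open>h = (f - P) / P\<close>. The norm of \<open>h\<close> need not be small, because the
  infimum of \<open>\<bar>P\<bar>\<close> does not control the norm of \<open>1 / P\<close>. Its powers are small, however: Cauchy
  estimates on a slightly larger annulus bound the norm of \<open>P\<^sup>-\<^sup>n\<close> by \<open>C (sup 1 / \<bar>P\<bar>)\<^sup>n\<close> with \<open>C\<close>
  independent of \<open>n\<close> (\<open>level_norm_le_sup\<close>), so the norms of \<open>h\<^sup>n\<close> decay geometrically and the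
  logarithmic series converges.

  For the factorization, apply this on the unit circle, split \<open>g\<close> into its terms with negative and
  nonnegative exponents, and exponentiate both parts (\<open>circle_factorization\<close>). This gives \<open>f\<^sub>1\<close>
  for modulus \<open>\<ge> 1\<close> and \<open>f\<^sub>2\<close> for modulus \<open>\<le> 1\<close>. Outside the unit circle \<open>f\<^sub>1 f z\<^sup>-\<^sup>q\<close> is a series
  that agrees with \<open>f\<^sub>2\<close> on the circle; coefficients are unique, so it has the coefficients of
  \<open>f\<^sub>2\<close>, which therefore extends. In the same way \<open>f\<^sub>2 z\<^sup>q / f\<close> extends \<open>f\<^sub>1\<close> inwards; here
  \<open>1 / f\<close> is again a series by the Wiener-Levy theorem (\<open>cocycle_equivalent_monomial\<close>).

  For uniqueness, follow \<open>f\<close> along the line \<open>s \<mapsto> e\<^sup>i\<^sup>s\<close> in the unit circle: the argument of \<open>f\<close>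
  grows like \<open>q s\<close> up to a bounded error, for at most one \<open>q\<close> (\<open>has_degree\<close>). This degree is
  additive, and the Wiener-Levy theorem shows that it is the same on all circles of an annulus. A
  zero-free function on a disc is almost constant near the centre of the disc, hence has degree
  \<open>0\<close>.
\<close>

section \<open>Monomials\<close>

lemma rat_common_denominator:
  obtains m n :: int and k :: nat where "k > 0" "p = Fract m (int k)" "q = Fract n (int k)"
proof -
  obtain a b where p: "p = Fract a b" "b > 0" by (cases p) auto
  obtain c d where q: "q = Fract c d" "d > 0" by (cases q) auto
  show thesis
  proof (rule that[of "nat (b * d)" "a * d" "c * b"])
    show "0 < nat (b * d)" using p q by auto
    show "p = Fract (a * d) (int (nat (b * d)))" "q = Fract (c * b) (int (nat (b * d)))"
      using p q by (auto simp: eq_rat)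
  qed
qed

lemma solenoid_char_add:
  assumes "u \<in> topspace solenoid"
  shows "solenoid_char (p + q) u = solenoid_char p u * solenoid_char q u"
proof -
  obtain m n k where k: "k > 0" "p = Fract m (int k)" "q = Fract n (int k)"
    by (rule rat_common_denominator)
  have "p + q = Fract (m + n) (int k)"
    using k by (simp add: eq_rat algebra_simps)
  moreover have "u k \<noteq> 0"
    using solenoid_norm[OF assms k(1)] by auto
  ultimately show ?thesis
    using solenoid_char_Fract[OF assms k(1)] k by (simp add: power_int_add)
qed

lemma solenoid_char_zero [simp]: "solenoid_char 0 u = 1"
  by (simp add: solenoid_char_def)

lemma norm_solenoid_char:
  assumes "u \<in> topspace solenoid"
  shows "norm (solenoid_char q u) = 1"
proof -
  obtain m n k where k: "k > 0" "q = Fract m (int k)"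
    by (metis rat_common_denominator)
  then show ?thesis
    using solenoid_char_Fract[OF assms k(1)] solenoid_norm[OF assms k(1)]
    by (simp add: norm_power_int)
qed

lemma modulus_zero_point [simp]: "modulus zero_point = 0"
  by (simp add: modulus_def zero_point_def zero_ereal_def)

lemma modulus_infinity_point [simp]: "modulus infinity_point = \<infinity>"
  by (simp add: modulus_def infinity_point_def)

lemma zero_point_in_line [simp]: "zero_point \<in> topspace adelic_line"
  unfolding adelic_line_iff by (auto simp: zero_point_def dvd_div_eq_0_iff)

lemma infinity_point_in_line [simp]: "infinity_point \<in> topspace adelic_line"
  unfolding adelic_line_iff by (auto simp: infinity_point_def)

lemma adelic_line_cases:
  assumes "z \<in> topspace adelic_line"
  obtains (zero) "z = zero_point" | (infinity) "z = infinity_point"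
  | (polar) t u where "0 < t" "u \<in> topspace solenoid" "z = polar t u" "modulus z = ereal t"
  using polar_decomposition[OF assms] modulus_polar by metis

lemma monomial_zero [simp]:
  assumes "z \<in> topspace adelic_line"
  shows "monomial 0 z = 1"
  using assms by (cases rule: adelic_line_cases) (auto simp: monomial_def[of 0 zero_point]
      monomial_def[of 0 infinity_point] monomial_polar)

lemma monomial_at_special:
  "q \<noteq> 0 \<Longrightarrow> monomial q zero_point = 0" "q \<noteq> 0 \<Longrightarrow> monomial q infinity_point = 0"
  by (auto simp: monomial_def)

lemma norm_monomial_polar:
  "0 < t \<Longrightarrow> u \<in> topspace solenoid \<Longrightarrow> norm (monomial q (polar t u)) = t powr of_rat q"
  by (simp add: monomial_polar norm_mult norm_solenoid_char)

lemma monomial_add_polar: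
  "0 < t \<Longrightarrow> u \<in> topspace solenoid \<Longrightarrow>
     monomial (p + q) (polar t u) = monomial p (polar t u) * monomial q (polar t u)"
  by (simp add: monomial_polar solenoid_char_add of_rat_add powr_add)

lemma monomial_add_nonneg:
  assumes "z \<in> topspace adelic_line" "0 \<le> p" "0 \<le> q"
  shows "monomial (p + q) z = monomial p z * monomial q z"
  using assms(1)
proof (cases rule: adelic_line_cases)
  case (polar t u)
  then show ?thesis by (simp add: monomial_add_polar)
qed (use assms in \<open>auto simp: monomial_def add_nonneg_eq_0_iff\<close>)

lemma monomial_add_nonpos:
  assumes "z \<in> topspace adelic_line" "p \<le> 0" "q \<le> 0"
  shows "monomial (p + q) z = monomial p z * monomial q z"
  using assms(1)
proof (cases rule: adelic_line_cases)
  case (polar t u)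
  then show ?thesis by (simp add: monomial_add_polar)
qed (use assms in \<open>auto simp: monomial_def add_nonpos_eq_0_iff\<close>)

lemma monomial_nonzero:
  "0 < t \<Longrightarrow> u \<in> topspace solenoid \<Longrightarrow> monomial q (polar t u) \<noteq> 0"
  using norm_monomial_polar[of t u q] by (auto simp del: norm_eq_zero)

text \<open>The path component of the circle of modulus \<open>t\<close> through the positive point: the line
  \<open>s \<mapsto> t e\<^sup>i\<^sup>s\<close> lifted to all levels. Series restrict to almost periodic functions of \<open>s\<close>, so that
  mean values and arguments can be studied along this line.\<close>

definition leaf :: "real \<Rightarrow> real \<Rightarrow> point" where
  "leaf t s = polar t (\<lambda>k\<in>{0<..}. cis (s / real k))"

lemma leaf_direction: "(\<lambda>k\<in>{0<..}. cis (s / real k)) \<in> topspace solenoid"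
proof -
  have "cis (s / real m) ^ (m div k) = cis (s / real k)" if "0 < k" "0 < m" "k dvd m" for k m
    using that by (auto simp: Complex.DeMoivre elim!: dvdE)
  then show ?thesis
    unfolding solenoid_iff by auto
qed

lemma modulus_leaf: "0 < t \<Longrightarrow> modulus (leaf t s) = ereal t"
  by (simp add: leaf_def modulus_polar leaf_direction)

lemma leaf_in_line: "0 < t \<Longrightarrow> leaf t s \<in> topspace adelic_line"
  by (simp add: leaf_def polar_in_adelic_line leaf_direction)

lemma monomial_leaf:
  assumes "0 < t"
  shows "monomial q (leaf t s) = of_real (t powr of_rat q) * cis (of_rat q * s)"
proof -
  obtain m k where k: "k > 0" "q = Fract m (int k)"
    by (metis rat_common_denominator)
  have "solenoid_char q (\<lambda>k\<in>{0<..}. cis (s / real k)) = cis (s / real k) powi m"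
    using k solenoid_char_Fract[OF leaf_direction k(1)] by simp
  also have "\<dots> = cis (of_rat q * s)"
    using k by (simp add: cis_power_int of_rat_rat)
  finally show ?thesis
    using assms by (simp add: leaf_def monomial_polar leaf_direction)
qed

section \<open>Weighted absolutely convergent series\<close>

text \<open>Products and infinite sums of series are sums over pairs. Collecting terms by their exponent
  turns them back into series.\<close>

lemma has_sum_fibers:
  fixes g :: "'i \<Rightarrow> 'b::banach"
  assumes "(\<lambda>i. norm (g i)) summable_on I"
  shows "((\<lambda>q. \<Sum>\<^sub>\<infinity>i\<in>{i\<in>I. e i = q}. g i) has_sum (\<Sum>\<^sub>\<infinity>i\<in>I. g i)) UNIV"
proof -
  let ?B = "\<lambda>q. {i\<in>I. e i = q}"
  have "g summable_on I"
    using assms by (rule abs_summable_summable)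
  then have "(g has_sum (\<Sum>\<^sub>\<infinity>i\<in>I. g i)) I"
    by (rule has_sum_infsum)
  moreover have "bij_betw (\<lambda>i. (e i, i)) I (Sigma UNIV ?B)"
    by (auto simp: bij_betw_def inj_on_def)
  ultimately have "((\<lambda>(q, i). g i) has_sum (\<Sum>\<^sub>\<infinity>i\<in>I. g i)) (Sigma UNIV ?B)"
    by (subst has_sum_reindex_bij_betw[symmetric, where g = "\<lambda>i. (e i, i)" and A = I]) auto
  then show ?thesis
  proof (rule has_sum_SigmaD)
    fix q
    show "((\<lambda>i. case (q, i) of (q, i) \<Rightarrow> g i) has_sum (\<Sum>\<^sub>\<infinity>i\<in>?B q. g i)) (?B q)"
      using \<open>g summable_on I\<close> by (auto intro!: has_sum_infsum summable_on_subset_banach[of g I])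
  qed
qed

text \<open>The common setting for annuli, where all exponents are allowed, and for discs, where
  exponents have one sign and monomials extend continuously to the centre. A submultiplicative
  weight that dominates the monomials on \<^term>\<open>K\<close> makes the series with finite weighted \<open>\<ell>\<^sup>1\<close> norm a
  Banach algebra of functions on \<^term>\<open>K\<close>.\<close>

locale weighted_monomials =
  fixes Q :: "rat set" and w :: "rat \<Rightarrow> real" and K :: "point set"
  assumes zero_in: "0 \<in> Q"
    and add_in: "\<And>p q. p \<in> Q \<Longrightarrow> q \<in> Q \<Longrightarrow> p + q \<in> Q"
    and w_zero: "w 0 \<le> 1"
    and w_pos: "\<And>q. q \<in> Q \<Longrightarrow> 0 < w q"
    and w_add: "\<And>p q. p \<in> Q \<Longrightarrow> q \<in> Q \<Longrightarrow> w (p + q) \<le> w p * w q"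
    and in_line: "K \<subseteq> topspace adelic_line"
    and norm_monomial_le: "\<And>q z. q \<in> Q \<Longrightarrow> z \<in> K \<Longrightarrow> norm (monomial q z) \<le> w q"
    and monomial_add: "\<And>p q z. p \<in> Q \<Longrightarrow> q \<in> Q \<Longrightarrow> z \<in> K \<Longrightarrow>
      monomial (p + q) z = monomial p z * monomial q z"
begin

definition summable_coeffs :: "(rat \<Rightarrow> complex) \<Rightarrow> bool" where
  "summable_coeffs a \<longleftrightarrow> (\<forall>q. q \<notin> Q \<longrightarrow> a q = 0) \<and> (\<lambda>q. norm (a q) * w q) summable_on UNIV"

text \<open>A norm bound for functions instead of coefficient families: products, exponentials and
  logarithms can then be formed pointwise, and only some expansion of the result has to be
  found.\<close>

definition norm_at_most :: "(point \<Rightarrow> complex) \<Rightarrow> real \<Rightarrow> bool" where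
  "norm_at_most f M \<longleftrightarrow> (\<exists>a. summable_coeffs a \<and> (\<Sum>\<^sub>\<infinity>q. norm (a q) * w q) \<le> M \<and>
     (\<forall>z\<in>K. f z = (\<Sum>\<^sub>\<infinity>q. a q * monomial q z)))"

lemma w_nonneg: "q \<in> Q \<Longrightarrow> 0 \<le> w q"
  using w_pos by (rule less_imp_le)

lemma coeff_term_le:
  assumes "summable_coeffs a" "z \<in> K"
  shows "norm (a q * monomial q z) \<le> norm (a q) * w q"
  using assms norm_monomial_le[of q z] unfolding summable_coeffs_def
  by (cases "q \<in> Q") (auto simp: norm_mult intro!: mult_left_mono)

lemma series_abs_summable:
  assumes "summable_coeffs a" "z \<in> K"
  shows "(\<lambda>q. norm (a q * monomial q z)) summable_on A"
proof (rule summable_on_subset_banach)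
  show "(\<lambda>q. norm (a q * monomial q z)) summable_on UNIV"
    using assms(1) coeff_term_le[OF assms]
    by (intro Infinite_Sum.abs_summable_on_comparison_test'[of "\<lambda>q. norm (a q) * w q"])
       (auto simp: summable_coeffs_def)
qed auto

lemma series_has_sum:
  assumes "summable_coeffs a" "z \<in> K"
  shows "((\<lambda>q. a q * monomial q z) has_sum (\<Sum>\<^sub>\<infinity>q. a q * monomial q z)) UNIV"
  using abs_summable_summable[OF series_abs_summable[OF assms]] by (rule has_sum_infsum)

lemma norm_series_le:
  assumes "summable_coeffs a" "z \<in> K"
  shows "norm (\<Sum>\<^sub>\<infinity>q. a q * monomial q z) \<le> (\<Sum>\<^sub>\<infinity>q. norm (a q) * w q)"
  using assms(1) coeff_term_le[OF assms] series_has_sum[OF assms]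
  by (intro norm_infsum_le[OF series_has_sum[OF assms] has_sum_infsum])
     (auto simp: summable_coeffs_def)

lemma norm_at_most_bound: "norm_at_most f M \<Longrightarrow> z \<in> K \<Longrightarrow> norm (f z) \<le> M"
  unfolding norm_at_most_def using norm_series_le by fastforce

lemma norm_at_most_cong:
  "norm_at_most f M \<Longrightarrow> (\<And>z. z \<in> K \<Longrightarrow> g z = f z) \<Longrightarrow> M \<le> M' \<Longrightarrow> norm_at_most g M'"
  unfolding norm_at_most_def by fastforce

lemma series_uniform_limit:
  assumes "summable_coeffs a"
  shows "uniform_limit K (\<lambda>F z. \<Sum>q\<in>F. a q * monomial q z)
    (\<lambda>z. \<Sum>\<^sub>\<infinity>q. a q * monomial q z) (finite_subsets_at_top UNIV)"
  using assms coeff_term_le[OF assms]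
  by (intro Weierstrass_m_test_general[where M = "\<lambda>q. norm (a q) * w q"])
     (auto simp: summable_coeffs_def)

text \<open>Finite partial sums are dense in the norm. The set \<^term>\<open>F0\<close> prescribes terms that must not be
  left in the remainder.\<close>

lemma series_tail:
  assumes "summable_coeffs a" "\<epsilon> > 0" "finite F0" "F0 \<subseteq> Q"
  obtains F where "finite F" "F0 \<subseteq> F" "F \<subseteq> Q"
    "norm_at_most (\<lambda>z. (\<Sum>\<^sub>\<infinity>q. a q * monomial q z) - (\<Sum>q\<in>F. a q * monomial q z)) \<epsilon>"
proof -
  let ?g = "\<lambda>q. norm (a q) * w q"
  have g: "?g summable_on UNIV"
    using assms(1) by (simp add: summable_coeffs_def)
  obtain G where G: "finite G" "dist (sum ?g G) (infsum ?g UNIV) \<le> \<epsilon>"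
    using has_sum_finite_approximation[OF has_sum_infsum[OF g] \<open>\<epsilon> > 0\<close>] by auto
  define F where "F = G \<inter> Q \<union> F0"
  have F: "finite F" "F0 \<subseteq> F" "F \<subseteq> Q" using G assms(3,4) by (auto simp: F_def)
  have a0: "q \<notin> Q \<Longrightarrow> a q = 0" for q
    using assms(1) by (simp add: summable_coeffs_def)
  have "sum ?g G = sum ?g (G \<inter> Q)"
    using G(1) a0 by (intro sum.mono_neutral_right) auto
  also have "\<dots> \<le> sum ?g F"
    using F w_nonneg by (intro sum_mono2) (auto simp: F_def)
  finally have "sum ?g G \<le> sum ?g F" .
  define b where "b = (\<lambda>q. if q \<in> F then 0 else a q)"
  have "((\<lambda>q. norm (b q) * w q) has_sum (infsum ?g UNIV - sum ?g F)) UNIV"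
  proof -
    have "(?g has_sum (infsum ?g UNIV - sum ?g F)) (UNIV - F)"
      using has_sum_Diff[OF has_sum_infsum[OF g] has_sum_finite[OF F(1)]] by simp
    then show ?thesis
      by (rule has_sum_cong_neutral[THEN iffD1, rotated -1]) (auto simp: b_def)
  qed
  moreover have "infsum ?g UNIV - sum ?g F \<le> \<epsilon>"
    using G(2) \<open>sum ?g G \<le> sum ?g F\<close> by (simp add: dist_real_def)
  moreover have "(\<Sum>\<^sub>\<infinity>q. a q * monomial q z) - (\<Sum>q\<in>F. a q * monomial q z) =
      (\<Sum>\<^sub>\<infinity>q. b q * monomial q z)" if "z \<in> K" for z
  proof -
    have "((\<lambda>q. a q * monomial q z) has_sum
        (\<Sum>\<^sub>\<infinity>q. a q * monomial q z) - (\<Sum>q\<in>F. a q * monomial q z)) (UNIV - F)"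
      using has_sum_Diff[OF series_has_sum[OF assms(1) that] has_sum_finite[OF F(1)]] by simp
    then have "((\<lambda>q. b q * monomial q z) has_sum
        (\<Sum>\<^sub>\<infinity>q. a q * monomial q z) - (\<Sum>q\<in>F. a q * monomial q z)) UNIV"
      by (rule has_sum_cong_neutral[THEN iffD1, rotated -1]) (auto simp: b_def)
    then show ?thesis
      by (simp add: infsumI)
  qed
  ultimately have "norm_at_most (\<lambda>z. (\<Sum>\<^sub>\<infinity>q. a q * monomial q z) -
      (\<Sum>q\<in>F. a q * monomial q z)) \<epsilon>"
    unfolding norm_at_most_def summable_coeffs_def using a0
    by (intro exI[of _ b]) (auto simp: has_sum_iff b_def)
  with F show thesis by (rule that)
qed

text \<open>Any absolutely convergent expansion into monomials, with arbitrary repetitions of exponents,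
  bounds the norm: adding up coefficients of equal exponents does not increase the sum.\<close>

lemma norm_at_most_grouping:
  fixes c :: "'i \<Rightarrow> complex" and e :: "'i \<Rightarrow> rat"
  assumes e: "\<And>i. i \<in> I \<Longrightarrow> e i \<in> Q"
    and sum: "(\<lambda>i. norm (c i) * w (e i)) summable_on I"
    and M: "(\<Sum>\<^sub>\<infinity>i\<in>I. norm (c i) * w (e i)) \<le> M"
    and f: "\<And>z. z \<in> K \<Longrightarrow> f z = (\<Sum>\<^sub>\<infinity>i\<in>I. c i * monomial (e i) z)"
  shows "norm_at_most f M"
proof -
  let ?B = "\<lambda>q. {i\<in>I. e i = q}"
  define a where "a q = (\<Sum>\<^sub>\<infinity>i\<in>?B q. c i)" for q
  have sumB: "(\<lambda>i. norm (c i)) summable_on ?B q" for q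
  proof (cases "q \<in> Q")
    case True
    have "(\<lambda>i. norm (c i) * w (e i)) summable_on ?B q"
      by (rule summable_on_subset_banach[OF sum]) auto
    then have "(\<lambda>i. norm (c i) * w q) summable_on ?B q"
      by (rule summable_on_cong[THEN iffD1, rotated]) auto
    with w_pos[OF True] show ?thesis
      by (simp add: summable_on_cmult_left')
  next
    case False
    then have "?B q = {}" using e by auto
    then show ?thesis by (simp only: summable_on_empty)
  qed
  have a0: "a q = 0" if "q \<notin> Q" for q
  proof -
    have "?B q = {}" using e that by auto
    then show ?thesis by (simp only: a_def infsum_empty)
  qed
  have norms: "((\<lambda>q. \<Sum>\<^sub>\<infinity>i\<in>?B q. norm (c i) * w (e i)) has_sum
      (\<Sum>\<^sub>\<infinity>i\<in>I. norm (c i) * w (e i))) UNIV"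
  proof (rule has_sum_fibers)
    show "(\<lambda>i. norm (norm (c i) * w (e i))) summable_on I"
      by (rule summable_on_iff_abs_summable_on_real[THEN iffD1, OF sum])
  qed
  have le: "norm (a q) * w q \<le> (\<Sum>\<^sub>\<infinity>i\<in>?B q. norm (c i) * w (e i))" for q
  proof (cases "q \<in> Q")
    case True
    have "norm (a q) * w q \<le> (\<Sum>\<^sub>\<infinity>i\<in>?B q. norm (c i)) * w q"
      unfolding a_def using w_pos[OF True]
      by (intro mult_right_mono norm_infsum_bound sumB) auto
    also have "\<dots> = (\<Sum>\<^sub>\<infinity>i\<in>?B q. norm (c i) * w q)"
      by (rule infsum_cmult_left'[symmetric])
    also have "\<dots> = (\<Sum>\<^sub>\<infinity>i\<in>?B q. norm (c i) * w (e i))"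
      by (rule infsum_cong) auto
    finally show ?thesis .
  next
    case False
    have "?B q = {}" using e False by auto
    with a0[OF False] show ?thesis by (simp only: infsum_empty) simp
  qed
  have nonneg: "0 \<le> norm (a q) * w q" for q
    using w_pos[of q] a0[of q] by (cases "q \<in> Q") auto
  have S: "(\<lambda>q. norm (a q) * w q) summable_on UNIV"
    by (rule summable_on_comparison_test[OF has_sum_imp_summable[OF norms] le nonneg])
  have "(\<Sum>\<^sub>\<infinity>q. norm (a q) * w q) \<le> (\<Sum>\<^sub>\<infinity>i\<in>I. norm (c i) * w (e i))"
    by (rule has_sum_mono[OF has_sum_infsum[OF S] norms le])
  with M have "(\<Sum>\<^sub>\<infinity>q. norm (a q) * w q) \<le> M" by simp
  moreover have "f z = (\<Sum>\<^sub>\<infinity>q. a q * monomial q z)" if z: "z \<in> K" for z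
  proof -
    have "(\<lambda>i. norm (c i * monomial (e i) z)) summable_on I"
      using e norm_monomial_le[OF _ z]
      by (intro Infinite_Sum.abs_summable_on_comparison_test'[OF sum])
          (auto simp: norm_mult intro!: mult_left_mono)
    then have "((\<lambda>q. \<Sum>\<^sub>\<infinity>i\<in>?B q. c i * monomial (e i) z) has_sum f z) UNIV"
      unfolding f[OF z] by (rule has_sum_fibers)
    moreover have "(\<Sum>\<^sub>\<infinity>i\<in>?B q. c i * monomial (e i) z) = a q * monomial q z" for q
    proof -
      have "(\<Sum>\<^sub>\<infinity>i\<in>?B q. c i * monomial (e i) z) = (\<Sum>\<^sub>\<infinity>i\<in>?B q. c i * monomial q z)"
        by (rule infsum_cong) auto
      then show ?thesis by (simp add: a_def infsum_cmult_left')
    qed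
    ultimately show ?thesis by (simp add: infsumI)
  qed
  ultimately show ?thesis
    unfolding norm_at_most_def summable_coeffs_def using S a0 by blast
qed

lemma norm_at_most_nonneg:
  assumes "norm_at_most f M" shows "0 \<le> M"
proof -
  obtain a where a: "summable_coeffs a" "(\<Sum>\<^sub>\<infinity>q. norm (a q) * w q) \<le> M"
    using assms by (auto simp: norm_at_most_def)
  have "0 \<le> norm (a q) * w q" for q
    using w_pos[of q] a(1) by (cases "q \<in> Q") (auto simp: summable_coeffs_def)
  then have "0 \<le> (\<Sum>\<^sub>\<infinity>q. norm (a q) * w q)" by (rule infsum_nonneg)
  with a(2) show ?thesis by simp
qed

lemma norm_at_most_monomial:
  assumes "q \<in> Q"
  shows "norm_at_most (\<lambda>z. c * monomial q z) (norm c * w q)"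
  by (rule norm_at_most_grouping[where I = "{()}" and c = "\<lambda>_. c" and e = "\<lambda>_. q"])
     (use assms in auto)

lemma norm_at_most_const: "norm_at_most (\<lambda>_. c) (norm c)"
proof (rule norm_at_most_cong[OF norm_at_most_monomial[OF zero_in, of c]])
  show "norm c * w 0 \<le> norm c"
    using mult_left_mono[OF w_zero, of "norm c"] by simp
qed (use in_line in auto)

lemma norm_at_most_mult:
  assumes "norm_at_most f M" "norm_at_most g N"
  shows "norm_at_most (\<lambda>z. f z * g z) (M * N)"
proof -
  obtain a where a: "summable_coeffs a" "(\<Sum>\<^sub>\<infinity>q. norm (a q) * w q) \<le> M"
    "\<And>z. z \<in> K \<Longrightarrow> f z = (\<Sum>\<^sub>\<infinity>q. a q * monomial q z)"
    using assms(1) by (auto simp: norm_at_most_def)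
  obtain b where b: "summable_coeffs b" "(\<Sum>\<^sub>\<infinity>q. norm (b q) * w q) \<le> N"
    "\<And>z. z \<in> K \<Longrightarrow> g z = (\<Sum>\<^sub>\<infinity>q. b q * monomial q z)"
    using assms(2) by (auto simp: norm_at_most_def)
  have *: "(\<Sum>\<^sub>\<infinity>q\<in>Q. h q) = (\<Sum>\<^sub>\<infinity>q. h q)" if "\<And>q. q \<notin> Q \<Longrightarrow> h q = 0" for h :: "rat \<Rightarrow> 'x::banach"
    by (rule infsum_cong_neutral) (use that in auto)
  have a0: "a q = 0" and b0: "b q = 0" if "q \<notin> Q" for q
    using a(1) b(1) that by (auto simp: summable_coeffs_def)
  let ?A = "\<lambda>q. norm (a q) * w q" and ?B = "\<lambda>q. norm (b q) * w q"
  have sA: "(?A has_sum infsum ?A UNIV) Q" and sB: "(?B has_sum infsum ?B UNIV) Q"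
    using a(1) b(1) *[of ?A] *[of ?B] a0 b0
    by (auto simp: summable_coeffs_def has_sum_iff intro: summable_on_subset_banach)
  have nA: "0 \<le> infsum ?A UNIV" 
    by (rule has_sum_nonneg[OF sA]) (use w_nonneg in auto)
  have nB: "0 \<le> infsum ?B UNIV" 
    by (rule has_sum_nonneg[OF sB]) (use w_nonneg in auto)
  have rows: "((\<lambda>q. ?A p * ?B q) has_sum ?A p * infsum ?B UNIV) Q" for p
    by (rule has_sum_cmult_right[OF sB])
  have cols: "((\<lambda>p. ?A p * infsum ?B UNIV) has_sum (infsum ?A UNIV * infsum ?B UNIV)) Q"
    by (rule has_sum_cmult_left[OF sA])
  have nonneg: "0 \<le> ?A p * ?B q" if "p \<in> Q" "q \<in> Q" for p q
    using w_pos[OF that(1)] w_pos[OF that(2)] by simp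
  have prodS: "(\<lambda>(p, q). ?A p * ?B q) summable_on (Q \<times> Q)"
    by (rule summable_on_SigmaI[OF _ has_sum_imp_summable[OF cols]]) (use rows nonneg in auto)
  have prod: "((\<lambda>(p, q). ?A p * ?B q) has_sum (infsum ?A UNIV * infsum ?B UNIV)) (Q \<times> Q)"
    by (rule has_sum_SigmaI[OF _ cols prodS]) (use rows in auto)
  have le: "norm (a p * b q) * w (p + q) \<le> ?A p * ?B q" if "p \<in> Q" "q \<in> Q" for p q
    using mult_left_mono[OF w_add[OF that], of "norm (a p * b q)"] by (simp add: norm_mult mult_ac)
  have nonneg': "0 \<le> norm (a p * b q) * w (p + q)" if "p \<in> Q" "q \<in> Q" for p q
    using w_pos[OF add_in[OF that]] by simp
  let ?c = "\<lambda>(p, q). a p * b q" and ?e = "\<lambda>(p, q). p + q"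
  have S: "(\<lambda>i. norm (?c i) * w (?e i)) summable_on (Q \<times> Q)"
    by (rule summable_on_comparison_test[OF prodS]) (use le nonneg' in auto)
  show ?thesis
  proof (rule norm_at_most_grouping[OF _ S])
    show "?e i \<in> Q" if "i \<in> Q \<times> Q" for i
      using that add_in by auto
    have "(\<Sum>\<^sub>\<infinity>i\<in>Q \<times> Q. norm (?c i) * w (?e i)) \<le> infsum ?A UNIV * infsum ?B UNIV"
      by (rule has_sum_mono[OF has_sum_infsum[OF S] prod])
         (use le in auto)
    also have "\<dots> \<le> M * N"
      using a(2) b(2) nA nB by (intro mult_mono) auto
    finally show "(\<Sum>\<^sub>\<infinity>i\<in>Q \<times> Q. norm (?c i) * w (?e i)) \<le> M * N" .
  next
    fix z assume z: "z \<in> K"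
    have fz: "((\<lambda>q. a q * monomial q z) has_sum f z) Q" and gz:
        "((\<lambda>q. b q * monomial q z) has_sum g z) Q"
      using a(3)[OF z] b(3)[OF z] abs_summable_summable[OF series_abs_summable[OF a(1) z]]
         abs_summable_summable[OF series_abs_summable[OF b(1) z]] *[of
             "\<lambda>q. a q * monomial q z"] *[of "\<lambda>q. b q * monomial q z"] a0 b0
      by (auto simp: has_sum_iff)
    have "(\<lambda>i. norm (?c i * monomial (?e i) z)) summable_on Q \<times> Q"
      using norm_monomial_le[OF _ z] add_in
      by (intro Infinite_Sum.abs_summable_on_comparison_test'[OF S])
          (auto simp: norm_mult intro!: mult_left_mono)
    then have "((\<lambda>i. ?c i * monomial (?e i) z) has_sum (\<Sum>\<^sub>\<infinity>i\<in>Q \<times> Q. ?c i * monomial (?e i) z)) (Q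
        \<times> Q)"
      by (rule has_sum_infsum[OF abs_summable_summable])
    then have "((\<lambda>p. (a p * monomial p z) * g z) has_sum (\<Sum>\<^sub>\<infinity>i\<in>Q \<times> Q. ?c i * monomial (?e i) z)) Q"
    proof (rule has_sum_SigmaD)
      fix p assume "p \<in> Q"
      have "((\<lambda>q. (a p * monomial p z) * (b q * monomial q z)) has_sum (a p * monomial p z) * g z)
          Q"
        by (rule has_sum_cmult_right[OF gz])
      then show "((\<lambda>q. ?c (p, q) * monomial (?e (p, q)) z) has_sum a p * monomial p z * g z) Q"
        by (rule has_sum_cong[THEN iffD1, rotated]) (use \<open>p \<in> Q\<close> z in \<open>auto simp: monomial_add\<close>)
    qed
    moreover have "((\<lambda>p. (a p * monomial p z) * g z) has_sum f z * g z) Q"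
      by (rule has_sum_cmult_left[OF fz])
    ultimately show "f z * g z = (\<Sum>\<^sub>\<infinity>i\<in>Q \<times> Q. ?c i * monomial (?e i) z)"
      using has_sum_unique by blast
  qed
qed

text \<open>Completeness of the algebra: the double series of all coefficients converges absolutely and
  may be collected by exponents.\<close>

lemma norm_at_most_suminf:
  assumes f: "\<And>n. norm_at_most (f n) (M n)" and M: "summable M"
  shows "norm_at_most (\<lambda>z. \<Sum>n. f n z) (\<Sum>n. M n)"
proof -
  have "\<exists>a. \<forall>n. summable_coeffs (a n) \<and> (\<Sum>\<^sub>\<infinity>q. norm (a n q) * w q) \<le> M n \<and>
     (\<forall>z\<in>K. f n z = (\<Sum>\<^sub>\<infinity>q. a n q * monomial q z))"
    using f unfolding norm_at_most_def by metis
  then obtain a where a: "\<And>n. summable_coeffs (a n)" "\<And>n. (\<Sum>\<^sub>\<infinity>q. norm (a n q) * w q) \<le> M n"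
     "\<And>n z. z \<in> K \<Longrightarrow> f n z = (\<Sum>\<^sub>\<infinity>q. a n q * monomial q z)"
    by blast
  have a0: "a n q = 0" if "q \<notin> Q" for n q
    using a(1)[of n] that by (auto simp: summable_coeffs_def)
  have *: "(\<Sum>\<^sub>\<infinity>q\<in>Q. h q) = (\<Sum>\<^sub>\<infinity>q. h q)" if "\<And>q. q \<notin> Q \<Longrightarrow> h q = 0" for h :: "rat \<Rightarrow> 'x::banach"
    by (rule infsum_cong_neutral) (use that in auto)
  let ?A = "\<lambda>n q. norm (a n q) * w q"
  have sA: "(?A n has_sum infsum (?A n) UNIV) Q" for n
    using a(1)[of n] *[of "?A n"] a0
    by (auto simp: summable_coeffs_def has_sum_iff intro: summable_on_subset_banach)
  have nA: "0 \<le> infsum (?A n) UNIV" for n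
    by (rule has_sum_nonneg[OF sA]) (use w_nonneg in auto)
  have sM: "M summable_on UNIV"
    using M order_trans[OF nA a(2)] by (intro summable_nonneg_imp_summable_on) auto
  then have s1: "(\<lambda>n. infsum (?A n) UNIV) summable_on UNIV"
    using a(2) nA by (intro summable_on_comparison_test[OF sM]) auto
  have S: "(\<lambda>(n, q). ?A n q) summable_on (UNIV \<times> Q)"
    by (rule summable_on_SigmaI[OF _ s1]) (use sA w_nonneg in auto)
  let ?c = "\<lambda>(n, q). a n q" and ?e = "\<lambda>(n::nat, q). q"
  have S': "(\<lambda>i. norm (?c i) * w (?e i)) summable_on (UNIV \<times> Q)"
    using S by (simp add: case_prod_unfold)
  show ?thesis
  proof (rule norm_at_most_grouping[OF _ S'])
    show "?e i \<in> Q" if "i \<in> UNIV \<times> Q" for i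
      using that by auto
    have "((\<lambda>i. norm (?c i) * w (?e i)) has_sum (\<Sum>\<^sub>\<infinity>i\<in>UNIV \<times> Q. norm (?c i) * w (?e i))) (UNIV \<times> Q)"
      by (rule has_sum_infsum[OF S'])
    then have "((\<lambda>n. infsum (?A n) UNIV) has_sum (\<Sum>\<^sub>\<infinity>i\<in>UNIV \<times> Q. norm (?c i) * w (?e i))) UNIV"
      by (rule has_sum_SigmaD) (use sA in auto)
    moreover have "(M has_sum suminf M) UNIV"
      using has_sum_infsum[OF sM] sums_unique[OF has_sum_imp_sums[OF has_sum_infsum[OF sM]]] by simp
    ultimately show "(\<Sum>\<^sub>\<infinity>i\<in>UNIV \<times> Q. norm (?c i) * w (?e i)) \<le> suminf M"
      by (rule has_sum_mono) (use a(2) in auto)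
  next
    fix z assume z: "z \<in> K"
    have fz: "((\<lambda>q. a n q * monomial q z) has_sum f n z) Q" for n
      using a(3)[OF z, of n] abs_summable_summable[OF series_abs_summable[OF a(1) z]]
        *[of "\<lambda>q. a n q * monomial q z"] a0
      by (auto simp: has_sum_iff)
    have "(\<lambda>i. norm (?c i * monomial (?e i) z)) summable_on UNIV \<times> Q"
      using norm_monomial_le[OF _ z]
      by (intro Infinite_Sum.abs_summable_on_comparison_test'[OF S'])
          (auto simp: norm_mult intro!: mult_left_mono)
    then have "((\<lambda>i. ?c i * monomial (?e i) z) has_sum (\<Sum>\<^sub>\<infinity>i\<in>UNIV \<times> Q. ?c i * monomial (?e i) z))
        (UNIV \<times> Q)"
      by (rule has_sum_infsum[OF abs_summable_summable])
    then have "((\<lambda>n. f n z) has_sum (\<Sum>\<^sub>\<infinity>i\<in>UNIV \<times> Q. ?c i * monomial (?e i) z)) UNIV"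
      by (rule has_sum_SigmaD) (use fz in auto)
    then show "(\<Sum>n. f n z) = (\<Sum>\<^sub>\<infinity>i\<in>UNIV \<times> Q. ?c i * monomial (?e i) z)"
      by (rule sums_unique[OF has_sum_imp_sums, symmetric])
  qed
qed

lemma norm_at_most_power:
  assumes "norm_at_most f M"
  shows "norm_at_most (\<lambda>z. f z ^ n) (M ^ n)"
proof (induction n)
  case 0
  show ?case using norm_at_most_const[of 1] by simp
next
  case (Suc n)
  show ?case using norm_at_most_mult[OF assms Suc] by simp
qed

lemma norm_at_most_cmult:
  assumes "norm_at_most f M"
  shows "norm_at_most (\<lambda>z. c * f z) (norm c * M)"
  by (rule norm_at_most_mult[OF norm_at_most_const assms])

lemma norm_at_most_add:
  assumes "norm_at_most f M" "norm_at_most g N"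
  shows "norm_at_most (\<lambda>z. f z + g z) (M + N)"
proof -
  define h where "h n = (if n = 0 then f else if n = 1 then g else (\<lambda>_. 0))" for n :: nat
  define L where "L n = (if n = 0 then M else if n = 1 then N else 0)" for n :: nat
  have "(\<lambda>n. h n z) sums (\<Sum>n\<in>{0, 1}. h n z)" for z
    by (rule sums_finite) (auto simp: h_def)
  then have "(\<Sum>n. h n z) = f z + g z" for z
    by (simp add: sums_iff) (simp add: h_def)
  moreover have "L sums (\<Sum>n\<in>{0, 1}. L n)"
    by (rule sums_finite) (auto simp: L_def)
  then have "summable L" "(\<Sum>n. L n) = M + N"
    by (simp_all add: sums_iff) (simp add: L_def)
  moreover have "norm_at_most (h n) (L n)" for n
    using assms norm_at_most_const[of 0] by (auto simp: h_def L_def)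
  ultimately show ?thesis
    using norm_at_most_suminf[of h L] by simp
qed

lemma norm_at_most_exp:
  assumes "norm_at_most f M"
  shows "norm_at_most (\<lambda>z. exp (f z)) (exp M)"
proof -
  have "norm_at_most (\<lambda>z. f z ^ n /\<^sub>R fact n) (M ^ n /\<^sub>R fact n)" for n
    using norm_at_most_cmult[OF norm_at_most_power[OF assms, of n], of "of_real (inverse (fact n))"]
    by (simp add: scaleR_conv_of_real norm_inverse)
  then show ?thesis
    unfolding exp_def by (rule norm_at_most_suminf[OF _ summable_exp_generic])
qed

text \<open>The logarithmic series needs only geometric decay of the norms of the powers of \<^term>\<open>h\<close>, that
  is, a spectral radius below \<open>1\<close>; the norm of \<^term>\<open>h\<close> itself may be large.\<close>

lemma norm_at_most_Ln:
  assumes pow: "\<And>n. norm_at_most (\<lambda>z. h z ^ n) (C * \<theta> ^ n)" and \<theta>: "0 \<le> \<theta>" "\<theta> < 1"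
    and small: "\<And>z. z \<in> K \<Longrightarrow> norm (h z) < 1"
  obtains M where "norm_at_most (\<lambda>z. Ln (1 + h z)) M"
proof -
  define L where "L n = inverse (real n) * (C * \<theta> ^ n)" for n
  have C: "0 \<le> C"
    using norm_at_most_nonneg[OF pow[of 0]] by simp
  have "norm_at_most (\<lambda>z. (- ((-1) ^ n) / of_nat n) * h z ^ n) (L n)" for n
    using norm_at_most_cmult[OF pow[of n], of "- ((-1) ^ n) / of_nat n"]
    by (simp add: L_def norm_divide norm_power divide_inverse norm_mult norm_inverse)
  moreover have "summable L"
  proof (rule summable_comparison_test')
    show "summable (\<lambda>n. C * \<theta> ^ n)"
      using \<theta> by (intro summable_mult summable_geometric) auto
    show "norm (L n) \<le> C * \<theta> ^ n" for n
      using C \<theta> mult_right_mono[of "inverse (real n)" 1 "C * \<theta> ^ n"]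
      by (cases n) (auto simp: L_def abs_mult field_simps)
  qed
  ultimately have "norm_at_most (\<lambda>z. \<Sum>n. (- ((-1) ^ n) / of_nat n) * h z ^ n) (suminf L)"
    by (rule norm_at_most_suminf)
  moreover have "Ln (1 + h z) = (\<Sum>n. (- ((-1) ^ n) / of_nat n) * h z ^ n)" if "z \<in> K" for z
    using Ln_series'[OF small[OF that]] by (simp add: sums_iff power_minus[of "h z"])
  ultimately have "norm_at_most (\<lambda>z. Ln (1 + h z)) (suminf L)"
    by (rule norm_at_most_cong) auto
  then show thesis by (rule that)
qed

end

section \<open>Annuli and discs\<close>

definition closed_annulus :: "real \<Rightarrow> real \<Rightarrow> point set" where
  "closed_annulus s t = {z \<in> topspace adelic_line. ereal s \<le> modulus z \<and> modulus z \<le> ereal t}"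

lemma closed_annulus_iff:
  assumes "0 < s"
  shows "z \<in> closed_annulus s t \<longleftrightarrow>
    (\<exists>r u. s \<le> r \<and> r \<le> t \<and> u \<in> topspace solenoid \<and> z = polar r u)" (is "_ \<longleftrightarrow> ?rhs")
proof
  assume z: "z \<in> closed_annulus s t"
  then have "z \<in> topspace adelic_line" by (simp add: closed_annulus_def)
  then show ?rhs
  proof (cases rule: adelic_line_cases)
    case zero
    with z assms show ?thesis by (auto simp: closed_annulus_def)
  next
    case infinity
    with z show ?thesis by (auto simp: closed_annulus_def)
  next
    case (polar r u)
    with z show ?thesis by (auto simp: closed_annulus_def)
  qed
next
  assume ?rhs
  with assms show "z \<in> closed_annulus s t"
    by (auto simp: closed_annulus_def polar_in_adelic_line modulus_polar)
qed

lemma powr_le_max: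
  fixes r :: real
  assumes "0 < s" "s \<le> r" "r \<le> t"
  shows "r powr x \<le> max (s powr x) (t powr x)"
proof (cases "0 \<le> x")
  case True
  then have "r powr x \<le> t powr x" using assms by (intro powr_mono2) auto
  then show ?thesis by simp
next
  case False
  then have "r powr x \<le> s powr x" using assms by (intro powr_mono2') auto
  then show ?thesis by simp
qed

text \<open>By \<open>norm_monomial_polar\<close> the weight is the supremum of the monomial over the annulus, since
  \<open>r \<mapsto> r\<^sup>q\<close> is monotone.\<close>

lemma weighted_monomials_annulus:
  assumes "0 \<in> Q" "\<And>p q. p \<in> Q \<Longrightarrow> q \<in> Q \<Longrightarrow> p + q \<in> Q" "0 < s" "s \<le> t"
  shows "weighted_monomials Q (\<lambda>q. max (s powr of_rat q) (t powr of_rat q)) (closed_annulus s t)"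
proof
  fix p q :: rat
  have "s powr of_rat p * s powr of_rat q \<le>
      max (s powr of_rat p) (t powr of_rat p) * max (s powr of_rat q) (t powr of_rat q)"
    by (rule mult_mono) (auto simp: le_max_iff_disj)
  moreover have "t powr of_rat p * t powr of_rat q \<le>
      max (s powr of_rat p) (t powr of_rat p) * max (s powr of_rat q) (t powr of_rat q)"
    by (rule mult_mono) (auto simp: le_max_iff_disj)
  ultimately show "max (s powr of_rat (p + q)) (t powr of_rat (p + q))
      \<le> max (s powr of_rat p) (t powr of_rat p) * max (s powr of_rat q) (t powr of_rat q)"
    by (simp add: of_rat_add powr_add)
next
  fix q z assume "z \<in> closed_annulus s t"
  then show "norm (monomial q z) \<le> max (s powr of_rat q) (t powr of_rat q)"
    using assms by (auto simp: closed_annulus_iff norm_monomial_polar powr_le_max)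
next
  fix p q z assume "z \<in> closed_annulus s t"
  then show "monomial (p + q) z = monomial p z * monomial q z"
    using assms by (auto simp: closed_annulus_iff monomial_add_polar)
qed (use assms in \<open>auto simp: closed_annulus_def less_max_iff_disj\<close>)

lemma weighted_monomials_circle:
  assumes "0 < t"
  shows "weighted_monomials UNIV (\<lambda>q. t powr of_rat q) (closed_annulus t t)"
  using weighted_monomials_annulus[of UNIV t t] assms by simp

lemma weighted_monomials_disc_plus:
  assumes "0 < t"
  shows "weighted_monomials {0..} (\<lambda>q. t powr of_rat q)
    {z \<in> topspace adelic_line. modulus z \<le> ereal t}"
proof
  fix q :: rat and z assume q: "q \<in> {0..}" and z: "z \<in> {z \<in> topspace adelic_line. modulus z \<le>
      ereal t}"
  then have "z \<in> topspace adelic_line" by simp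
  then show "norm (monomial q z) \<le> t powr of_rat q"
  proof (cases rule: adelic_line_cases)
    case zero
    then show ?thesis using assms by (cases "q = 0") (auto simp: monomial_at_special)
  next
    case (polar r u)
    then show ?thesis using z q by (auto simp: norm_monomial_polar intro!: powr_mono2)
  qed (use z in auto)
qed (use assms in \<open>auto simp: of_rat_add powr_add monomial_add_nonneg\<close>)

lemma weighted_monomials_disc_minus:
  assumes "0 < s"
  shows "weighted_monomials {..0} (\<lambda>q. s powr of_rat q)
    {z \<in> topspace adelic_line. ereal s \<le> modulus z}"
proof
  fix q :: rat and z assume q: "q \<in> {..0}" and z: "z \<in> {z \<in> topspace adelic_line. ereal s \<le>
      modulus z}"
  then have "z \<in> topspace adelic_line" by simp
  then show "norm (monomial q z) \<le> s powr of_rat q"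
  proof (cases rule: adelic_line_cases)
    case zero
    then show ?thesis using assms z by auto
  next
    case (polar r u)
    then show ?thesis using z q assms by (auto simp: norm_monomial_polar intro!: powr_mono2')
  next
    case infinity
    then show ?thesis using assms by (cases "q = 0") (auto simp: monomial_at_special)
  qed
qed (use assms in \<open>auto simp: of_rat_add powr_add monomial_add_nonpos\<close>)

lemma weighted_monomials_unit_disc_plus:
  "weighted_monomials {0..} (\<lambda>_. 1) {z \<in> topspace adelic_line. modulus z \<le> 1}"
  using weighted_monomials_disc_plus[of 1] by (simp add: one_ereal_def)

lemma weighted_monomials_unit_disc_minus:
  "weighted_monomials {..0} (\<lambda>_. 1) {z \<in> topspace adelic_line. 1 \<le> modulus z}"
  using weighted_monomials_disc_minus[of 1] by (simp add: one_ereal_def)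

section \<open>Coefficients\<close>

lemma cis_eq_1_imp:
  assumes "cis x = 1" "\<bar>x\<bar> < 2 * pi"
  shows "x = 0"
proof -
  have "cos x = 1" using assms(1) by (simp add: complex_eq_iff)
  then obtain n :: int where n: "x = n * 2 * pi" by (auto simp: cos_one_2pi_int)
  then have "\<bar>real_of_int n\<bar> * (2 * pi) < 1 * (2 * pi)" using assms(2) by (simp add: abs_mult)
  then have "\<bar>real_of_int n\<bar> < 1" by (rule mult_right_less_imp_less) simp
  then show ?thesis using n by simp
qed

text \<open>The geometric sum stays bounded, so its average vanishes in the limit.\<close>

lemma unit_power_mean_tendsto_0:
  fixes \<zeta> :: complex
  assumes "\<zeta> \<noteq> 1" "norm \<zeta> = 1"
  shows "(\<lambda>N. (\<Sum>n<N. \<zeta> ^ n) / of_nat N) \<longlonglongrightarrow> 0"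
proof (rule Lim_null_comparison)
  have "norm (\<Sum>n<N. \<zeta> ^ n) \<le> 2 / norm (\<zeta> - 1)" for N
  proof -
    have "norm (\<zeta> ^ N - 1) \<le> 2"
      using norm_triangle_ineq4[of "\<zeta> ^ N" 1] assms(2) by (simp add: norm_power)
    then show ?thesis
      using assms by (simp add: geometric_sum norm_divide divide_right_mono)
  qed
  then show "\<forall>\<^sub>F N in sequentially. norm ((\<Sum>n<N. \<zeta> ^ n) / of_nat N) \<le> 2 / norm (\<zeta> - 1) / real N"
    by (intro always_eventually allI)
       (simp only: norm_divide norm_of_nat divide_right_mono of_nat_0_le_iff)
  show "(\<lambda>N. 2 / norm (\<zeta> - 1) / real N) \<longlonglongrightarrow> 0"
    by (rule lim_const_over_n)
qed

text \<open>The coefficient \<open>a\<^sub>q t\<^sup>q\<close> is the mean value of \<open>f e\<^sup>-\<^sup>i\<^sup>q\<^sup>s\<close> along the line \<^term>\<open>leaf t\<close>, and a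
  mean value is bounded by the supremum. Up to a small error only finitely many exponents matter,
  and then the mean can be taken over equidistant sample points.\<close>

lemma cauchy_estimate:
  assumes t: "0 < t" and a: "(\<lambda>q. norm (a q) * t powr of_rat q) summable_on UNIV"
    and B: "\<And>s. norm (\<Sum>\<^sub>\<infinity>q. a q * monomial q (leaf t s)) \<le> B"
  shows "norm (a q) * t powr of_rat q \<le> B"
proof (rule field_le_epsilon)
  fix \<epsilon> :: real assume "\<epsilon> > 0"
  interpret C: weighted_monomials UNIV "\<lambda>q. t powr of_rat q" "closed_annulus t t"
    by (rule weighted_monomials_circle[OF t])
  have ac: "C.summable_coeffs a"
    using a by (simp add: C.summable_coeffs_def)
  obtain F where F: "finite F" "{q} \<subseteq> F" "C.norm_at_most (\<lambda>z. (\<Sum>\<^sub>\<infinity>q. a q * monomial q z) - (\<Sum>q\<in>F.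
      a q * monomial q z)) \<epsilon>"
    using C.series_tail[OF ac \<open>\<epsilon> > 0\<close>, of "{q}"] by auto
  \<comment> \<open>With sampling step \<open>2\<pi> / D\<close> no exponent difference other than \<open>0\<close> is a multiple of the
    sampling frequency, so the other monomials average out.\<close>
  obtain D :: nat where D: "\<And>p. p \<in> F \<Longrightarrow> \<bar>of_rat (p - q)\<bar> < real D"
  proof -
    obtain D :: nat where D: "Max ((\<lambda>p. \<bar>of_rat (p - q)\<bar>) ` F) < real D"
      using reals_Archimedean2 by blast
    have "\<bar>of_rat (p - q)\<bar> < real D" if "p \<in> F" for p
      using D by (rule le_less_trans[rotated]) (use that F(1) in auto)
    then show thesis by (rule that)
  qed
  then have "D > 0" using F(2) by fastforce
  define \<theta> where "\<theta> = 2 * pi / real D"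
  define \<zeta> where "\<zeta> p = cis (of_rat (p - q) * \<theta>)" for p
  have \<zeta>: "\<zeta> p \<noteq> 1" if "p \<in> F" "p \<noteq> q" for p
  proof
    assume "\<zeta> p = 1"
    moreover have "\<bar>of_rat (p - q) * \<theta>\<bar> < 2 * pi"
      using D[OF that(1)] \<open>D > 0\<close> by (simp add: \<theta>_def abs_mult field_simps)
    ultimately have "of_rat (p - q) * \<theta> = 0"
      unfolding \<zeta>_def by (rule cis_eq_1_imp)
    with that(2) \<open>D > 0\<close> show False by (simp add: \<theta>_def)
  qed
  define f where "f = (\<lambda>z. \<Sum>\<^sub>\<infinity>q. a q * monomial q z)"
  have leaf_mem: "leaf t s \<in> closed_annulus t t" for s
    using t by (simp add: closed_annulus_def leaf_in_line modulus_leaf)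
  define S where "S n = (\<Sum>p\<in>F. a p * of_real (t powr of_rat p) * \<zeta> p ^ n)" for n
  have summand: "a p * of_real (t powr of_rat p) * \<zeta> p ^ n =
      a p * monomial p (leaf t (real n * \<theta>)) * cis (- of_rat q * (real n * \<theta>))" for p n
  proof -
    have "\<zeta> p ^ n = cis (of_rat p * (real n * \<theta>)) * cis (- of_rat q * (real n * \<theta>))"
      by (simp add: \<zeta>_def Complex.DeMoivre cis_mult of_rat_diff algebra_simps)
    then show ?thesis using t by (simp add: monomial_leaf)
  qed
  have S_bound: "norm (S n) \<le> B + \<epsilon>" for n
  proof -
    let ?z = "leaf t (real n * \<theta>)"
    have "norm (f ?z - (\<Sum>q\<in>F. a q * monomial q ?z)) \<le> \<epsilon>"
      unfolding f_def using C.norm_at_most_bound[OF F(3) leaf_mem] .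
    moreover have "norm (f ?z) \<le> B" using B by (simp add: f_def)
    ultimately have "norm (\<Sum>q\<in>F. a q * monomial q ?z) \<le> B + \<epsilon>"
      using norm_triangle_ineq2[of "\<Sum>q\<in>F. a q * monomial q ?z"
          "f ?z"] by (simp add: norm_minus_commute)
    then show ?thesis
      by (simp add: S_def summand sum_distrib_right[symmetric] norm_mult)
  qed
  have "(\<lambda>N. (\<Sum>n<N. S n) / of_nat N) \<longlonglongrightarrow> (\<Sum>p\<in>F. a p * of_real (t powr of_rat p) * (if p =
      q then 1 else 0))"
  proof -
    have "(\<lambda>N. a p * of_real (t powr of_rat p) * ((\<Sum>n<N. \<zeta> p ^ n) / of_nat N)) \<longlonglongrightarrow>
        a p * of_real (t powr of_rat p) * (if p = q then 1 else 0)" if "p \<in> F" for p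
    proof (rule tendsto_mult_left)
      show "(\<lambda>N. (\<Sum>n<N. \<zeta> p ^ n) / of_nat N) \<longlonglongrightarrow> (if p = q then 1 else 0)"
      proof (cases "p = q")
        case True
        have "\<forall>\<^sub>F N in sequentially. 1 = (\<Sum>n<N. \<zeta> p ^ n) / of_nat N"
          using eventually_gt_at_top[of 0] by eventually_elim (simp add: True \<zeta>_def)
        then show ?thesis using True by (simp add: tendsto_eventually eq_commute)
      next
        case False
        with \<zeta>[OF that] show ?thesis
          using unit_power_mean_tendsto_0[of "\<zeta> p"] by (simp add: \<zeta>_def)
      qed
    qed
    then have "(\<lambda>N. \<Sum>p\<in>F. a p * of_real (t powr of_rat p) * ((\<Sum>n<N. \<zeta> p ^ n) / of_nat N)) \<longlonglongrightarrow>
        (\<Sum>p\<in>F. a p * of_real (t powr of_rat p) * (if p = q then 1 else 0))"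
      by (rule tendsto_sum)
    moreover have "(\<Sum>p\<in>F. a p * of_real (t powr of_rat p) * ((\<Sum>n<N. \<zeta> p ^ n) / of_nat N)) =
        (\<Sum>n<N. S n) / of_nat N" for N
    proof -
      have "(\<Sum>n<N. S n) = (\<Sum>p\<in>F. \<Sum>n<N. a p * of_real (t powr of_rat p) * \<zeta> p ^ n)"
        unfolding S_def by (rule sum.swap)
      then show ?thesis
        by (simp add: sum_divide_distrib sum_distrib_left)
    qed
    ultimately show ?thesis by simp
  qed
  also have "(\<Sum>p\<in>F. a p * of_real (t powr of_rat p) * (if p = q then 1 else 0)) =
      a q * of_real (t powr of_rat q)"
    using F(1,2) by (simp add: if_distrib[of "\<lambda>x. _ * x"] sum.delta cong: if_cong)
  finally have "norm (a q * of_real (t powr of_rat q)) \<le> B + \<epsilon>"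
  proof (rule Lim_norm_ubound[rotated])
    have "norm ((\<Sum>n<N. S n) / of_nat N) \<le> B + \<epsilon>" if "N > 0" for N
    proof -
      have "norm (\<Sum>n<N. S n) \<le> real N * (B + \<epsilon>)"
        using sum_norm_le[of "{..<N}" S "\<lambda>_. B + \<epsilon>"] S_bound by simp
      then show ?thesis using that by (simp add: norm_divide field_simps)
    qed
    then show "\<forall>\<^sub>F N in sequentially. norm ((\<Sum>n<N. S n) / of_nat N) \<le> B + \<epsilon>"
      using eventually_gt_at_top[of 0] by (rule eventually_mono[rotated])
  qed simp
  then show "norm (a q) * t powr of_rat q \<le> B + \<epsilon>" by (simp add: norm_mult)
qed

lemma coefficients_unique:
  assumes t: "0 < t" and a: "(\<lambda>q. norm (a q) * t powr of_rat q) summable_on UNIV"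
    and b: "(\<lambda>q. norm (b q) * t powr of_rat q) summable_on UNIV"
    and eq: "\<And>s. (\<Sum>\<^sub>\<infinity>q. a q * monomial q (leaf t s)) = (\<Sum>\<^sub>\<infinity>q. b q * monomial q (leaf t s))"
  shows "a = b"
proof
  fix q
  interpret C: weighted_monomials UNIV "\<lambda>q. t powr of_rat q" "closed_annulus t t"
    by (rule weighted_monomials_circle[OF t])
  have leaf_mem: "leaf t s \<in> closed_annulus t t" for s
    using t by (simp add: closed_annulus_def leaf_in_line modulus_leaf)
  have C: "C.summable_coeffs a" "C.summable_coeffs b"
    using a b by (simp_all add: C.summable_coeffs_def)
  have "(\<lambda>q. norm (a q - b q) * t powr of_rat q) summable_on UNIV"
  proof (rule summable_on_comparison_test[OF summable_on_add[OF a b]])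
    show "norm (a q - b q) * t powr of_rat q \<le> norm (a q) * t powr of_rat q + norm (b q) * t powr
        of_rat q" for q
      using mult_right_mono[OF norm_triangle_ineq4[of "a q" "b q"], of
          "t powr of_rat q"] by (simp add: distrib_right)
  qed auto
  moreover have "norm (\<Sum>\<^sub>\<infinity>q. (a q - b q) * monomial q (leaf t s)) \<le> 0" for s
  proof -
    have "((\<lambda>q. a q * monomial q (leaf t s) + - (b q * monomial q (leaf t s))) has_sum
        (\<Sum>\<^sub>\<infinity>q. a q * monomial q (leaf t s)) + - (\<Sum>\<^sub>\<infinity>q. b q * monomial q (leaf t s))) UNIV"
      by (intro has_sum_add has_sum_uminusI C.series_has_sum C leaf_mem)
    then show ?thesis
      by (simp add: eq left_diff_distrib infsumI)
  qed
  ultimately have "norm (a q - b q) * t powr of_rat q \<le> 0"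
    by (rule cauchy_estimate[OF t])
  then show "a q = b q" using t by (simp add: mult_le_0_iff)
qed

section \<open>Lower bounds on closed annuli\<close>

lemma compact_solenoid: "compact (topspace solenoid)"
proof -
  let ?P = "PiE UNIV (\<lambda>k::nat. if k = 0 then {undefined} else sphere (0::complex) 1)"
  have "compactin (product_topology (\<lambda>i. euclidean) UNIV) ?P"
    unfolding compactin_PiE by auto
  then have P: "compact ?P"
    by (simp add: euclidean_product_topology)
  let ?C = "\<Inter>k\<in>{0<..}. \<Inter>m\<in>{m. 0 < m \<and> k dvd m}. {u :: nat \<Rightarrow> complex. u m ^ (m div k) = u k}"
  have "closed ?C"
    by (intro closed_INT ballI closed_Collect_eq continuous_intros) auto
  with P have "compact (?P \<inter> ?C)" by (rule compact_Int_closed)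
  also have "?P \<inter> ?C = topspace solenoid"
  proof -
    have "u \<in> ?P \<longleftrightarrow> u \<in> extensional {0<..} \<and> (\<forall>k>0. norm (u k) = 1)" for u
      by (auto simp: PiE_iff extensional_def split: if_splits)
    then show ?thesis
      unfolding solenoid_iff set_eq_iff Int_iff by auto
  qed
  finally show ?thesis .
qed

lemma continuous_on_monomial_polar:
  assumes "0 < s"
  shows "continuous_on ({s..t} \<times> topspace solenoid) (\<lambda>(r, u). monomial q (polar r u))"
proof -
  obtain m k where mk: "quotient_of q = (m, k)" by (cases "quotient_of q")
  then have k: "nat k > 0" using quotient_of_denom_pos[OF mk] by simp
  have ev: "continuous_on A (\<lambda>x. snd x (nat k))" for A :: "(real \<times> (nat \<Rightarrow> complex)) set"
    using continuous_on_compose2[OF continuous_on_product_coordinates continuous_on_snd[OF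
        continuous_on_id]] by auto
  have "continuous_on ({s..t} \<times> topspace solenoid)
      (\<lambda>x. of_real (fst x powr of_rat q) * (snd x (nat k) powi m))"
    using assms solenoid_norm[OF _ k] by (intro continuous_intros ev) force+
  then show ?thesis
    by (rule continuous_on_cong[THEN iffD1, rotated -1])
       (use assms in \<open>auto simp: monomial_polar solenoid_char_def mk\<close>)
qed

text \<open>The closed annulus is the image of the compact space \<open>[s, t] \<times> solenoid\<close> under polar
  coordinates, and the series is continuous in these coordinates as a uniform limit.\<close>

lemma lower_bound_on_annulus:
  assumes s: "0 < s" "s \<le> t"
    and a: "(\<lambda>q. norm (a q) * max (s powr of_rat q) (t powr of_rat q)) summable_on UNIV"
    and f: "\<And>z. z \<in> closed_annulus s t \<Longrightarrow> f z = (\<Sum>\<^sub>\<infinity>q. a q * monomial q z)"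
    and nz: "\<And>z. z \<in> closed_annulus s t \<Longrightarrow> f z \<noteq> 0"
  obtains \<delta> where "\<delta> > 0" "\<And>z. z \<in> closed_annulus s t \<Longrightarrow> \<delta> \<le> norm (f z)"
proof -
  interpret C: weighted_monomials UNIV "\<lambda>q. max (s powr of_rat q) (t powr of_rat q)"
      "closed_annulus s t"
    by (rule weighted_monomials_annulus) (use s in auto)
  let ?S = "{s..t} \<times> topspace solenoid" and ?h = "\<lambda>(r, u). f (polar r u)"
  have mem: "(\<lambda>(r, u). polar r u) \<in> ?S \<rightarrow> closed_annulus s t"
  proof -
    have "polar r u \<in> closed_annulus s t" if "r \<in> {s..t}" "u \<in> topspace solenoid" for r u
      using closed_annulus_iff[OF s(1)] that by fastforce
    then show ?thesis by auto
  qed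
  have "uniform_limit (closed_annulus s t) (\<lambda>F z. \<Sum>q\<in>F. a q * monomial q z) f
      (finite_subsets_at_top UNIV)"
    using C.series_uniform_limit[of a] a f
    by (subst uniform_limit_cong') (auto simp: C.summable_coeffs_def)
  then have "uniform_limit ?S (\<lambda>F x. \<Sum>q\<in>F. a q * (\<lambda>(r, u). monomial q (polar r u)) x) ?h
      (finite_subsets_at_top UNIV)"
    using uniform_limit_compose'[OF _ mem] by (simp add: case_prod_unfold)
  then have "continuous_on ?S ?h"
    by (rule uniform_limit_theorem[rotated])
       (auto intro!: always_eventually continuous_intros continuous_on_monomial_polar s simp del:
           case_prod_conv)
  then have "compact ((\<lambda>x. norm (?h x)) ` ?S)"
    by (intro compact_continuous_image continuous_intros compact_Times compact_solenoid) auto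
  moreover have "(s, \<lambda>k\<in>{0<..}. cis (0 / real k)) \<in> ?S"
    unfolding mem_Times_iff fst_conv snd_conv using s leaf_direction[of 0] by auto
  then have "?S \<noteq> {}" by blast
  ultimately obtain x where x: "x \<in> ?S" "\<And>y. y \<in> ?S \<Longrightarrow> norm (?h x) \<le> norm (?h y)"
    using compact_attains_inf[of "(\<lambda>x. norm (?h x)) ` ?S"] by auto
  show thesis
  proof (rule that)
    show "0 < norm (?h x)" using x(1) mem nz by force
    show "norm (?h x) \<le> norm (f z)" if "z \<in> closed_annulus s t" for z
      using that x(2) s by (auto simp: closed_annulus_iff)
  qed
qed

section \<open>The degree on a circle\<close>

text \<open>The argument of \<open>f\<close> grows like \<open>q s\<close> along the line \<^term>\<open>leaf t\<close>, up to the bounded function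
  \<^term>\<open>G\<close>. For functions that come from level \<open>k\<close>, the number \<open>k q\<close> is a winding number.\<close>

definition has_degree :: "real \<Rightarrow> (point \<Rightarrow> complex) \<Rightarrow> rat \<Rightarrow> bool" where
  "has_degree t f q \<longleftrightarrow> (\<exists>G. continuous_on UNIV G \<and> bounded (range G) \<and>
     (\<forall>s. f (leaf t s) = exp (\<i> * of_real (of_rat q * s) + G s)))"

text \<open>Two logarithms of the same function differ by a continuous function with values in \<open>2\<pi>i \<int>\<close>,
  hence by a constant. So a linear function of slope \<open>p - q\<close> is bounded.\<close>

lemma has_degree_unique:
  assumes "has_degree t f p" "has_degree t f q"
  shows "p = q"
proof -
  obtain G where G: "continuous_on UNIV G" "bounded (range G)"
     "\<And>s. f (leaf t s) = exp (\<i> * of_real (of_rat p * s) + G s)"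
    using assms(1) by (auto simp: has_degree_def)
  obtain H where H: "continuous_on UNIV H" "bounded (range H)"
     "\<And>s. f (leaf t s) = exp (\<i> * of_real (of_rat q * s) + H s)"
    using assms(2) by (auto simp: has_degree_def)
  define \<phi> where "\<phi> s = (of_rat p - of_rat q) * s + Im (G s) - Im (H s)" for s
  have int: "\<exists>n::int. \<phi> s = 2 * pi * n" for s
  proof -
    have "exp (\<i> * of_real (of_rat p * s) + G s) = exp (\<i> * of_real (of_rat q * s) + H s)"
      using G(3) H(3) by metis
    then obtain n :: int where "\<i> * of_real (of_rat p * s) + G s =
        \<i> * of_real (of_rat q * s) + H s + of_real (of_int (2 * n) * pi) * \<i>"
      using exp_eq by metis
    from arg_cong[OF this, of Im] have "\<phi> s = 2 * pi * n"
      by (simp add: \<phi>_def algebra_simps)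
    then show ?thesis ..
  qed
  have "\<phi> constant_on UNIV"
  proof (rule continuous_discrete_range_constant)
    show "continuous_on UNIV \<phi>"
      unfolding \<phi>_def using G(1) H(1) by (intro continuous_intros) auto
    show "\<exists>e>0. \<forall>y. y \<in> UNIV \<and> \<phi> y \<noteq> \<phi> x \<longrightarrow> e \<le> norm (\<phi> y - \<phi> x)" for x
    proof (intro exI[of _ "2 * pi"] conjI allI impI)
      fix y assume y: "y \<in> UNIV \<and> \<phi> y \<noteq> \<phi> x"
      obtain m n :: int where mn: "\<phi> y = 2 * pi * m" "\<phi> x = 2 * pi * n" using int by blast
      with y have "m \<noteq> n" by auto
      then have "1 \<le> \<bar>real_of_int m - real_of_int n\<bar>" by linarith
      then have "2 * pi * 1 \<le> 2 * pi * \<bar>real_of_int m - real_of_int n\<bar>"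
          by (intro mult_left_mono) auto
      also have "\<dots> = norm (\<phi> y - \<phi> x)" by (simp add: mn abs_mult flip: right_diff_distrib)
      finally show "2 * pi \<le> norm (\<phi> y - \<phi> x)" by simp
    qed simp
  qed simp
  then obtain c where c: "\<And>s. \<phi> s = c" by (auto simp: constant_on_def)
  obtain A B where AB: "\<And>s. norm (G s) \<le> A" "\<And>s. norm (H s) \<le> B"
    using G(2) H(2) by (auto simp: bounded_iff)
  have "\<bar>(of_rat p - of_rat q) * s\<bar> \<le> \<bar>c\<bar> + A + B" for s
    using c[of s] AB[of s] abs_Im_le_cmod[of "G s"] abs_Im_le_cmod[of "H s"] by (simp add: \<phi>_def)
  from this[of "(\<bar>c\<bar> + A + B + 1) / (of_rat p - of_rat q)"] show "p = q"
    by (cases "p = q") auto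
qed

lemma has_degree_mult:
  assumes "has_degree t f p" "has_degree t g q"
  shows "has_degree t (\<lambda>z. f z * g z) (p + q)"
proof -
  obtain G where G: "continuous_on UNIV G" "bounded (range G)"
     "\<And>s. f (leaf t s) = exp (\<i> * of_real (of_rat p * s) + G s)"
    using assms(1) by (auto simp: has_degree_def)
  obtain H where H: "continuous_on UNIV H" "bounded (range H)"
     "\<And>s. g (leaf t s) = exp (\<i> * of_real (of_rat q * s) + H s)"
    using assms(2) by (auto simp: has_degree_def)
  have "bounded (range (\<lambda>s. G s + H s))"
    using bounded_plus_comp[OF G(2) H(2)] by simp
  moreover have "continuous_on UNIV (\<lambda>s. G s + H s)"
    using G(1) H(1) by (intro continuous_intros)
  ultimately show ?thesis
    unfolding has_degree_def
    by (intro exI[of _ "\<lambda>s. G s + H s"]) (auto simp: G(3) H(3) of_rat_add algebra_simps simp flip: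
        exp_add)
qed

lemma has_degree_monomial:
  assumes "0 < t"
  shows "has_degree t (monomial q) q"
  unfolding has_degree_def
proof (intro exI[of _ "\<lambda>_. of_real (of_rat q * ln t)"] conjI allI)
  show "monomial q (leaf t s) = exp (\<i> * of_real (of_rat q * s) + of_real (of_rat q * ln t))" for s
    using assms by (simp add: monomial_leaf powr_def exp_add exp_of_real cis_conv_exp flip:
        exp_of_real)
qed auto

text \<open>The values of \<open>f / c\<close> stay in a closed disc about \<open>1\<close> that avoids the negative axis, so the
  principal logarithm is continuous and bounded on them.\<close>

lemma has_degree_near_const:
  assumes "continuous_on UNIV (\<lambda>s. f (leaf t s))" "c \<noteq> 0" "\<kappa> < 1"
    and close: "\<And>s. norm (f (leaf t s) - c) \<le> \<kappa> * norm c"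
  shows "has_degree t f 0"
proof -
  define h where "h s = (f (leaf t s) - c) / c" for s
  have h: "norm (h s) \<le> \<kappa>" for s
    using close[of s] assms(2) by (simp add: h_def norm_divide field_simps)
  have "1 + h s \<notin> \<real>\<^sub>\<le>\<^sub>0" for s
    using h[of s] assms(3) abs_Re_le_cmod[of "h s"] by (auto simp: complex_nonpos_Reals_iff)
  moreover have "continuous_on UNIV h"
    unfolding h_def using assms(1,2) by (intro continuous_intros) auto
  ultimately have cont: "continuous_on UNIV (\<lambda>s. Ln c + Ln (1 + h s))"
    by (intro continuous_intros) auto
  have "f (leaf t s) = exp (Ln c + Ln (1 + h s))" for s
  proof -
    have "1 + h s \<noteq> 0" using \<open>1 + h s \<notin> \<real>\<^sub>\<le>\<^sub>0\<close> by auto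
    then show ?thesis using assms(2) by (simp add: exp_add h_def field_simps)
  qed
  moreover have "bounded (range (\<lambda>s. Ln c + Ln (1 + h s)))"
  proof -
    have "1 + h s \<in> cball 1 \<kappa>" for s
      using h[of s] by (simp add: dist_norm)
    moreover have "cball (1::complex) \<kappa> \<inter> \<real>\<^sub>\<le>\<^sub>0 = {}"
    proof -
      have "x \<notin> \<real>\<^sub>\<le>\<^sub>0" if "x \<in> cball 1 \<kappa>" for x :: complex
        using that assms(3) abs_Re_le_cmod[of "1 - x"] by
            (auto simp: complex_nonpos_Reals_iff dist_norm)
      then show ?thesis by (simp only: disjoint_iff) blast
    qed
    then have "compact ((\<lambda>x. Ln c + Ln x) ` cball 1 \<kappa>)"
      by (intro compact_continuous_image continuous_intros) auto
    ultimately show ?thesis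
      by (elim bounded_subset[OF compact_imp_bounded]) auto
  qed
  ultimately show ?thesis
    unfolding has_degree_def using cont by (intro exI[of _ "\<lambda>s. Ln c + Ln (1 + h s)"]) auto
qed

lemma series_continuous_on_leaf:
  assumes "weighted_monomials Q w K" "weighted_monomials.summable_coeffs Q w a"
    and t: "0 < t" and leaf: "\<And>s. leaf t s \<in> K"
  shows "continuous_on UNIV (\<lambda>s. \<Sum>\<^sub>\<infinity>q. a q * monomial q (leaf t s))"
proof -
  interpret weighted_monomials Q w K by fact
  have "uniform_limit UNIV (\<lambda>F s. \<Sum>q\<in>F. a q * monomial q (leaf t s))
      (\<lambda>s. \<Sum>\<^sub>\<infinity>q. a q * monomial q (leaf t s)) (finite_subsets_at_top UNIV)"
    using uniform_limit_compose'[OF series_uniform_limit[OF assms(2)]] leaf by blast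
  then show ?thesis
    by (rule uniform_limit_theorem[rotated])
       (auto intro!: always_eventually continuous_intros simp: monomial_leaf[OF t])
qed

lemma has_degree_exp:
  assumes "weighted_monomials Q w K" "weighted_monomials.norm_at_most Q w K g M"
    and t: "0 < t" and leaf: "\<And>s. leaf t s \<in> K"
  shows "has_degree t (\<lambda>z. exp (g z)) 0"
proof -
  interpret weighted_monomials Q w K by fact
  obtain a where a: "summable_coeffs a" "\<And>z. z \<in> K \<Longrightarrow> g z = (\<Sum>\<^sub>\<infinity>q. a q * monomial q z)"
    using assms(2) by (auto simp: norm_at_most_def)
  have "continuous_on UNIV (\<lambda>s. g (leaf t s))"
    using series_continuous_on_leaf[OF assms(1) a(1) t leaf] a(2)[OF leaf] by simp
  moreover have "bounded (range (\<lambda>s. g (leaf t s)))"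
    using norm_at_most_bound[OF assms(2) leaf] by (auto simp: bounded_iff)
  ultimately show ?thesis
    unfolding has_degree_def by (intro exI[of _ "\<lambda>s. g (leaf t s)"]) auto
qed

section \<open>Finite sums of monomials\<close>

abbreviation annulus_weight :: "real \<Rightarrow> real \<Rightarrow> rat \<Rightarrow> real" where
  "annulus_weight s t \<equiv> \<lambda>q. max (s powr of_rat q) (t powr of_rat q)"

abbreviation annulus_norm_at_most :: "rat set \<Rightarrow> real \<Rightarrow> real \<Rightarrow> (point \<Rightarrow> complex) \<Rightarrow> real \<Rightarrow> bool" where
  "annulus_norm_at_most Q s t \<equiv>
     weighted_monomials.norm_at_most Q (annulus_weight s t) (closed_annulus s t)"

lemma closed_annulus_mono:
  assumes "s' \<le> s" "t \<le> t'"
  shows "closed_annulus s t \<subseteq> closed_annulus s' t'"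
proof
  fix z assume "z \<in> closed_annulus s t"
  moreover have "ereal s' \<le> ereal s" "ereal t \<le> ereal t'" using assms by auto
  ultimately show "z \<in> closed_annulus s' t'"
    unfolding closed_annulus_def using order_trans by blast
qed

lemma summable_coeffs_mono:
  assumes "weighted_monomials Q w K" "weighted_monomials Q' w' K'"
    and "Q \<subseteq> Q'" "\<And>q. q \<in> Q \<Longrightarrow> w' q \<le> w q"
    and a: "weighted_monomials.summable_coeffs Q w a"
  shows "weighted_monomials.summable_coeffs Q' w' a"
    and "(\<Sum>\<^sub>\<infinity>q. norm (a q) * w' q) \<le> (\<Sum>\<^sub>\<infinity>q. norm (a q) * w q)"
proof -
  interpret A: weighted_monomials Q w K by fact
  interpret B: weighted_monomials Q' w' K' by fact
  have le: "norm (a q) * w' q \<le> norm (a q) * w q" "0 \<le> norm (a q) * w' q" for q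
    using a assms(3,4) B.w_nonneg[of q]
    by (cases "q \<in> Q"; auto simp: A.summable_coeffs_def intro!: mult_left_mono)+
  have S: "(\<lambda>q. norm (a q) * w q) summable_on UNIV"
    using a by (simp add: A.summable_coeffs_def)
  then have S': "(\<lambda>q. norm (a q) * w' q) summable_on UNIV"
    by (rule summable_on_comparison_test[OF _ le])
  then show "B.summable_coeffs a"
    using a assms(3) by (auto simp: A.summable_coeffs_def B.summable_coeffs_def)
  show "(\<Sum>\<^sub>\<infinity>q. norm (a q) * w' q) \<le> (\<Sum>\<^sub>\<infinity>q. norm (a q) * w q)"
    by (rule infsum_mono[OF S' S le(1)])
qed

lemma norm_at_most_mono:
  assumes "weighted_monomials Q w K" "weighted_monomials Q' w' K'"
    and "Q \<subseteq> Q'" "\<And>q. q \<in> Q \<Longrightarrow> w' q \<le> w q" "K' \<subseteq> K"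
    and f: "weighted_monomials.norm_at_most Q w K f M"
  shows "weighted_monomials.norm_at_most Q' w' K' f M"
proof -
  interpret A: weighted_monomials Q w K by fact
  interpret B: weighted_monomials Q' w' K' by fact
  show ?thesis
    using f summable_coeffs_mono[OF assms(1-4)] assms(5)
    unfolding A.norm_at_most_def B.norm_at_most_def by (meson order_trans subsetD)
qed

context weighted_monomials
begin

lemma norm_at_most_Ln_small:
  assumes "norm_at_most h \<theta>" "\<theta> < 1"
  obtains g M where "norm_at_most g M" "\<And>z. z \<in> K \<Longrightarrow> 1 + h z = exp (g z)"
proof -
  have "0 \<le> \<theta>" using norm_at_most_nonneg[OF assms(1)] .
  have small: "norm (h z) < 1" if "z \<in> K" for z
    using norm_at_most_bound[OF assms(1) that] assms(2) by simp
  have "norm_at_most (\<lambda>z. h z ^ n) (1 * \<theta> ^ n)" for n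
    using norm_at_most_power[OF assms(1)] by simp
  then obtain M where "norm_at_most (\<lambda>z. Ln (1 + h z)) M"
    using norm_at_most_Ln[of h 1 \<theta>] \<open>0 \<le> \<theta>\<close> assms(2) small by blast
  moreover have "1 + h z = exp (Ln (1 + h z))" if "z \<in> K" for z
  proof -
    have "1 + h z \<noteq> 0" using small[OF that] by (metis add_eq_0_iff norm_minus_cancel norm_one
        less_irrefl)
    then show ?thesis by simp
  qed
  ultimately show thesis by (rule that)
qed

lemma monomial_power:
  assumes "q \<in> Q" "z \<in> K"
  shows "monomial q z ^ n = monomial (of_nat n * q) z" "of_nat n * q \<in> Q"
proof (induction n)
  case 0
  { case 1 show ?case using assms in_line by auto }
  { case 2 show ?case using zero_in by simp }
next
  case (Suc n)
  { case 1
    have "monomial (q + of_nat n * q) z = monomial q z * monomial (of_nat n * q) z"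
      using assms Suc(2) by (intro monomial_add)
    with Suc(1) show ?case by (simp add: algebra_simps) }
  { case 2 show ?case using add_in[OF assms(1) Suc(2)] by (simp add: algebra_simps) }
qed

end

text \<open>The exponents of the functions that are pulled back from the level \<^term>\<open>k\<close> projection.\<close>

definition level_exponents :: "nat \<Rightarrow> rat set" where
  "level_exponents k = range (\<lambda>j. Fract j (int k))"

lemma weighted_monomials_level:
  assumes "0 < k" "0 < s" "s \<le> t"
  shows "weighted_monomials (level_exponents k) (annulus_weight s t) (closed_annulus s t)"
proof (rule weighted_monomials_annulus)
  show "0 \<in> level_exponents k"
    using assms by (auto simp: level_exponents_def rat_number_collapse intro!: range_eqI[of _ _ 0])
  show "p + q \<in> level_exponents k" if pq: "p \<in> level_exponents k" "q \<in> level_exponents k" for p q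
  proof -
    obtain i j where "p = Fract i (int k)" "q = Fract j (int k)"
      using pq by (auto simp: level_exponents_def)
    then have "p + q = Fract (i + j) (int k)"
      using assms(1) by (simp add: eq_rat algebra_simps)
    then show ?thesis by (auto simp: level_exponents_def)
  qed
qed (use assms in auto)

lemma finite_in_level:
  assumes "finite F"
  obtains k where "0 < k" "F \<subseteq> level_exponents k"
proof -
  have "\<exists>k>0. F \<subseteq> level_exponents k"
    using assms
  proof (induction F)
    case empty
    show ?case by (intro exI[of _ 1]) auto
  next
    case (insert q F)
    then obtain k where k: "k > 0" "F \<subseteq> level_exponents k" by auto
    obtain m n where q: "q = Fract m (int n)" "n > 0"
      by (metis rat_common_denominator)
    have "level_exponents k \<subseteq> level_exponents (n * k)"
    proof
      fix p assume "p \<in> level_exponents k"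
      then obtain j where "p = Fract j (int k)" by (auto simp: level_exponents_def)
      then have "p = Fract (j * int n) (int (n * k))"
        using k q by (simp add: eq_rat)
      then show "p \<in> level_exponents (n * k)" unfolding level_exponents_def by (rule range_eqI)
    qed
    moreover have "q = Fract (m * int k) (int (n * k))"
      using k q by (simp add: eq_rat)
    then have "q \<in> level_exponents (n * k)" unfolding level_exponents_def by (rule range_eqI)
    ultimately show ?case
      using k q by (intro exI[of _ "n * k"]) auto
  qed
  then show thesis using that by blast
qed

lemma of_rat_Fract: "0 < k \<Longrightarrow> of_rat (Fract j (int k)) = real_of_int j / real k"
  by (simp add: of_rat_rat)

text \<open>The monomial of exponent \<open>1 / k\<close> is the coordinate at level \<open>k\<close>; it takes all nonzero
  values.\<close>

lemma level_coordinate_onto: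
  assumes "0 < k" "\<alpha> \<noteq> 0"
  obtains z where "z \<in> topspace adelic_line" "modulus z = ereal (norm \<alpha> ^ k)"
      "monomial (Fract 1 (int k)) z = \<alpha>"
proof (rule that)
  let ?z = "leaf (norm \<alpha> ^ k) (real k * Arg \<alpha>)"
  have pos: "0 < norm \<alpha> ^ k" using assms by simp
  show "?z \<in> topspace adelic_line" "modulus ?z = ereal (norm \<alpha> ^ k)"
    by (rule leaf_in_line[OF pos], rule modulus_leaf[OF pos])
  have "(norm \<alpha> ^ k) powr (1 / real k) = norm \<alpha>"
    using assms by (simp add: powr_powr flip: powr_realpow)
  then show "monomial (Fract 1 (int k)) ?z = \<alpha>"
    using assms pos by (simp add: monomial_leaf of_rat_Fract cis_Arg sgn_eq del: powr_power)
qed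

text \<open>Let \<open>\<omega>\<close> be the coordinate at level \<open>k\<close>. If \<open>\<bar>\<alpha>\<bar>\<close> lies below the annulus, then
  \<open>\<omega> - \<alpha> = \<omega> (1 - \<alpha> / \<omega>)\<close>; if it lies above, then \<open>\<omega> - \<alpha> = - \<alpha> (1 - \<omega> / \<alpha>)\<close>. In both cases the
  subtracted quotient has norm below \<open>1\<close>, and the logarithmic series applies.\<close>

lemma linear_factor_exp:
  assumes k: "0 < k" and st: "0 < s" "s \<le> t"
    and \<alpha>: "\<And>z. z \<in> closed_annulus s t \<Longrightarrow> monomial (Fract 1 (int k)) z \<noteq> \<alpha>"
  obtains q g M where "q \<in> level_exponents k" "annulus_norm_at_most (level_exponents k) s t g M"
    "\<And>z. z \<in> closed_annulus s t \<Longrightarrow> monomial (Fract 1 (int k)) z - \<alpha> = monomial q z * exp (g z)"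
proof -
  interpret K: weighted_monomials "level_exponents k" "annulus_weight s t" "closed_annulus s t"
    by (rule weighted_monomials_level) fact+
  let ?\<omega> = "monomial (Fract 1 (int k))"
  have lev: "Fract j (int k) \<in> level_exponents k" for j by (simp add: level_exponents_def)
  have "norm \<alpha> ^ k < s \<or> t < norm \<alpha> ^ k"
  proof (cases "\<alpha> = 0")
    case True
    then show ?thesis using st k by (simp add: power_0_left)
  next
    case False
    from level_coordinate_onto[OF k False] obtain z where
      z: "z \<in> topspace adelic_line" "modulus z = ereal (norm \<alpha> ^ k)" "?\<omega> z = \<alpha>" .
    then have "z \<notin> closed_annulus s t" using \<alpha> by blast
    with z(1,2) show ?thesis by (auto simp: closed_annulus_def)
  qed
  then show thesis
  proof
    assume small: "norm \<alpha> ^ k < s"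
    define \<theta> where "\<theta> = norm (- \<alpha>) * annulus_weight s t (Fract (-1) (int k))"
    have "norm \<alpha> < s powr (1 / real k)"
    proof -
      have "norm \<alpha> = (norm \<alpha> ^ k) powr (1 / real k)" if "\<alpha> \<noteq> 0"
        using that k by (simp add: powr_powr flip: powr_realpow)
      also have "\<dots> < s powr (1 / real k)"
        using small k by (intro powr_less_mono2) auto
      finally show ?thesis using st by (cases "\<alpha> = 0") auto
    qed
    moreover have "annulus_weight s t (Fract (-1) (int k)) = s powr (- (1 / real k))"
      using st k by (simp add: of_rat_Fract powr_mono2' max_absorb1)
    ultimately have "\<theta> < 1"
      using st by (simp add: \<theta>_def powr_minus_divide)
    moreover have "K.norm_at_most (\<lambda>z. - \<alpha> * monomial (Fract (-1) (int k)) z) \<theta>"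
      unfolding \<theta>_def by (rule K.norm_at_most_monomial[OF lev])
    ultimately obtain g M where g: "K.norm_at_most g M"
      "\<And>z. z \<in> closed_annulus s t \<Longrightarrow> 1 + - \<alpha> * monomial (Fract (-1) (int k)) z = exp (g z)"
      using K.norm_at_most_Ln_small by blast
    show thesis
    proof (rule that[OF lev g(1), of 1])
      fix z assume z: "z \<in> closed_annulus s t"
      have "?\<omega> z * monomial (Fract (-1) (int k)) z = 1"
        using K.monomial_add[OF lev lev z, of 1 "-1"] k z K.in_line
        by (auto simp: rat_number_collapse)
      then show "?\<omega> z - \<alpha> = ?\<omega> z * exp (g z)"
        unfolding g(2)[OF z, symmetric] by (simp add: algebra_simps)
    qed
  next
    assume large: "t < norm \<alpha> ^ k"
    then have "\<alpha> \<noteq> 0" using st k by (auto simp: power_0_left)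
    define \<theta> where "\<theta> = norm (- (1 / \<alpha>)) * annulus_weight s t (Fract 1 (int k))"
    have "t powr (1 / real k) < norm \<alpha>"
    proof -
      have "t powr (1 / real k) < (norm \<alpha> ^ k) powr (1 / real k)"
        using large k st by (intro powr_less_mono2) auto
      also have "\<dots> = norm \<alpha>"
        using \<open>\<alpha> \<noteq> 0\<close> k by (simp add: powr_powr flip: powr_realpow)
      finally show ?thesis .
    qed
    moreover have "annulus_weight s t (Fract 1 (int k)) = t powr (1 / real k)"
      using st k by (simp add: of_rat_Fract powr_mono2 max_absorb2)
    ultimately have "\<theta> < 1"
      using \<open>\<alpha> \<noteq> 0\<close> by (simp add: \<theta>_def norm_divide)
    moreover have "K.norm_at_most (\<lambda>z. - (1 / \<alpha>) * ?\<omega> z) \<theta>"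
      unfolding \<theta>_def by (rule K.norm_at_most_monomial[OF lev])
    ultimately obtain g M where g: "K.norm_at_most g M"
      "\<And>z. z \<in> closed_annulus s t \<Longrightarrow> 1 + - (1 / \<alpha>) * ?\<omega> z = exp (g z)"
      using K.norm_at_most_Ln_small by blast
    show thesis
    proof (rule that[OF K.zero_in K.norm_at_most_add[OF K.norm_at_most_const[of "Ln (- \<alpha>)"] g(1)]])
      fix z assume z: "z \<in> closed_annulus s t"
      then have "z \<in> topspace adelic_line" using K.in_line by auto
      then show "?\<omega> z - \<alpha> = monomial 0 z * exp (Ln (- \<alpha>) + g z)"
        using \<open>\<alpha> \<noteq> 0\<close> by (simp add: exp_add g(2)[OF z, symmetric] algebra_simps)
    qed
  qed
qed

text \<open>Split off one linear factor at a time.\<close>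

lemma polynomial_exp:
  fixes p :: "complex poly"
  assumes k: "0 < k" and st: "0 < s" "s \<le> t"
    and nz: "\<And>z. z \<in> closed_annulus s t \<Longrightarrow> poly p (monomial (Fract 1 (int k)) z) \<noteq> 0"
  shows "\<exists>q\<in>level_exponents k. \<exists>g M. annulus_norm_at_most (level_exponents k) s t g M \<and>
    (\<forall>z\<in>closed_annulus s t. poly p (monomial (Fract 1 (int k)) z) = monomial q z * exp (g z))"
  using nz
proof (induction "degree p" arbitrary: p)
  case 0
  interpret K: weighted_monomials "level_exponents k" "annulus_weight s t" "closed_annulus s t"
    by (rule weighted_monomials_level) fact+
  from 0 obtain c where c: "p = [:c:]" by (metis degree_eq_zeroE)
  have "leaf s 0 \<in> closed_annulus s t"
    using st by (simp add: closed_annulus_def leaf_in_line modulus_leaf)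
  then have "c \<noteq> 0" using 0(2) c by fastforce
  then show ?case
    using K.zero_in K.norm_at_most_const[of "Ln c"] K.in_line c
    by (intro bexI[of _ 0] exI[of _ "\<lambda>_. Ln c"] exI) auto
next
  case (Suc d)
  interpret K: weighted_monomials "level_exponents k" "annulus_weight s t" "closed_annulus s t"
    by (rule weighted_monomials_level) fact+
  let ?\<omega> = "monomial (Fract 1 (int k))"
  have "\<not> (\<exists>a l. a \<noteq> 0 \<and> l = 0 \<and> p = pCons a l)"
    using Suc(2) by auto
  then obtain \<alpha> where "poly p \<alpha> = 0"
    using fundamental_theorem_of_algebra_alt by blast
  then obtain r where r: "p = [:- \<alpha>, 1:] * r"
    by (metis dvdE poly_eq_0_iff_dvd)
  have "r \<noteq> 0" using Suc(2) r by auto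
  then have "degree p = Suc (degree r)"
    unfolding r by (subst degree_mult_eq) auto
  then have deg: "d = degree r" using Suc(2) by simp
  have pr: "poly p (?\<omega> z) = (?\<omega> z - \<alpha>) * poly r (?\<omega> z)" for z
    by (simp add: r algebra_simps)
  have "poly r (?\<omega> z) \<noteq> 0" if "z \<in> closed_annulus s t" for z
    using Suc(3)[OF that] unfolding pr by auto
  from Suc(1)[OF deg this] obtain q' g' M' where r': "q' \<in> level_exponents k" "K.norm_at_most g' M'"
     "\<forall>z\<in>closed_annulus s t. poly r (?\<omega> z) = monomial q' z * exp (g' z)"
    by blast
  have "?\<omega> z \<noteq> \<alpha>" if "z \<in> closed_annulus s t" for z
    using Suc(3)[OF that] unfolding pr by auto
  then obtain q g M where q: "q \<in> level_exponents k" "K.norm_at_most g M"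
    "\<And>z. z \<in> closed_annulus s t \<Longrightarrow> ?\<omega> z - \<alpha> = monomial q z * exp (g z)"
    using linear_factor_exp[OF k st] by blast
  show ?case
  proof (intro bexI exI conjI ballI)
    show "q + q' \<in> level_exponents k" using q(1) r'(1) by (rule K.add_in)
    show "K.norm_at_most (\<lambda>z. g z + g' z) (M + M')"
      by (rule K.norm_at_most_add) fact+
    show "poly p (?\<omega> z) = monomial (q + q') z * exp (g z + g' z)" if "z \<in> closed_annulus s t" for z
      unfolding pr using that q r' by (simp add: K.monomial_add exp_add)
  qed
qed

text \<open>With \<open>k\<close> a common denominator of the exponents and \<open>N\<close> large, the sum times \<open>\<omega>\<^sup>N\<close> is a
  polynomial in the coordinate \<open>\<omega>\<close> at level \<open>k\<close>.\<close>

lemma finite_sum_exp: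
  assumes F: "F \<subseteq> level_exponents k" "finite F" and k: "0 < k" and st: "0 < s" "s \<le> t"
    and nz: "\<And>z. z \<in> closed_annulus s t \<Longrightarrow> (\<Sum>q\<in>F. a q * monomial q z) \<noteq> 0"
  obtains q g M where "q \<in> level_exponents k" "annulus_norm_at_most (level_exponents k) s t g M"
    "\<And>z. z \<in> closed_annulus s t \<Longrightarrow> (\<Sum>q\<in>F. a q * monomial q z) = monomial q z * exp (g z)"
proof -
  interpret K: weighted_monomials "level_exponents k" "annulus_weight s t" "closed_annulus s t"
    by (rule weighted_monomials_level) fact+
  let ?\<omega> = "monomial (Fract 1 (int k))"
  have lev: "Fract j (int k) \<in> level_exponents k" for j by (simp add: level_exponents_def)
  have "\<forall>q\<in>F. \<exists>j. q = Fract j (int k)" using F by (auto simp: level_exponents_def)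
  then obtain j where j: "\<And>q. q \<in> F \<Longrightarrow> q = Fract (j q) (int k)" by metis
  define N where "N = (\<Sum>q\<in>F. \<bar>j q\<bar>)"
  have N: "0 \<le> j q + N" if "q \<in> F" for q
    using member_le_sum[OF that, of "\<lambda>q. \<bar>j q\<bar>"] F(2) by (simp add: N_def)
  define p where "p = (\<Sum>q\<in>F. Polynomial.monom (a q) (nat (j q + N)))"
  have pz: "poly p (?\<omega> z) = monomial (Fract N (int k)) z * (\<Sum>q\<in>F. a q * monomial q z)"
    if z: "z \<in> closed_annulus s t" for z
  proof -
    have "?\<omega> z ^ nat (j q + N) = monomial (Fract N (int k)) z * monomial q z" if q: "q \<in> F" for q
    proof -
      have "?\<omega> z ^ nat (j q + N) = monomial (of_nat (nat (j q + N)) * Fract 1 (int k)) z"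
        by (rule K.monomial_power[OF lev z])
      also have "of_nat (nat (j q + N)) * Fract 1 (int k) = Fract (j q + N) (int k)"
        using N[OF q] k by (simp add: Fract_of_int_quotient)
      also have "\<dots> = Fract N (int k) + q"
        using k by (subst j[OF q]) (simp add: Fract_of_int_quotient add_divide_distrib)
      also have "monomial \<dots> z = monomial (Fract N (int k)) z * monomial q z"
        by (rule K.monomial_add[OF lev _ z]) (use q F in auto)
      finally show ?thesis .
    qed
    then show ?thesis
      by (simp add: p_def poly_sum poly_monom sum_distrib_left mult_ac)
  qed
  have inv: "monomial (Fract (- N) (int k)) z * monomial (Fract N (int k)) z = 1" if
      "z \<in> closed_annulus s t" for z
    using K.monomial_add[OF lev lev that, of "- N" N] k K.in_line that
    by (auto simp: rat_number_collapse)
  have "poly p (?\<omega> z) \<noteq> 0" if "z \<in> closed_annulus s t" for z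
    using pz[OF that] nz[OF that] inv[OF that] by auto
  then obtain q g M where q: "q \<in> level_exponents k" "K.norm_at_most g M"
    "\<forall>z\<in>closed_annulus s t. poly p (?\<omega> z) = monomial q z * exp (g z)"
    using polynomial_exp[OF k st, of p] by blast
  show thesis
  proof (rule that[OF K.add_in[OF lev q(1)] q(2)])
    fix z assume z: "z \<in> closed_annulus s t"
    have "(\<Sum>q\<in>F. a q * monomial q z) = monomial (Fract (- N) (int k)) z * poly p (?\<omega> z)"
      unfolding pz[OF z] using inv[OF z] by (simp flip: mult.assoc)
    then show "(\<Sum>q\<in>F. a q * monomial q z) = monomial (Fract (- N) (int k) + q) z * exp (g z)"
      using q z K.monomial_add[OF lev q(1) z] by simp
  qed
qed

text \<open>The radii of the circles on which the sum somewhere has absolute value at most \<^term>\<open>c\<close> form a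
  compact set, the projection of a compact set in polar coordinates. It is disjoint from
  \<^term>\<open>{s..t}\<close>, hence at positive distance from it.\<close>

lemma finite_sum_lower_bound_enlarge:
  assumes F: "finite F" and st: "0 < s" "s \<le> t" and c: "c < c'"
    and lb: "\<And>z. z \<in> closed_annulus s t \<Longrightarrow> c' \<le> norm (\<Sum>q\<in>F. a q * monomial q z)"
  obtains s' t' where "0 < s'" "s' < s" "t < t'"
    "\<And>z. z \<in> closed_annulus s' t' \<Longrightarrow> c \<le> norm (\<Sum>q\<in>F. a q * monomial q z)"
proof -
  let ?P = "\<lambda>z. \<Sum>q\<in>F. a q * monomial q z"
  let ?S = "{s/2..2*t} \<times> topspace solenoid"
  have cont: "continuous_on ?S (\<lambda>x. norm (\<Sum>q\<in>F. a q * (\<lambda>(r, u). monomial q (polar r u)) x))"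
    by (intro continuous_intros continuous_on_monomial_polar) (use st in auto)
  define B where "B = fst ` {x \<in> ?S. norm (\<Sum>q\<in>F. a q * (\<lambda>(r, u). monomial q (polar r u)) x) \<le> c}"
  have "compact ?S" by (intro compact_Times compact_solenoid compact_Icc)
  then have "compact {x \<in> ?S. norm (\<Sum>q\<in>F. a q * (\<lambda>(r, u). monomial q (polar r u)) x) \<in> {..c}}"
    by (intro closedin_compact[OF _ continuous_closedin_preimage[OF cont, of
        "{..c}", unfolded vimage_def Int_def mem_Collect_eq]]) auto
  then have "compact B"
    unfolding B_def by (intro compact_continuous_image continuous_intros) auto
  then have op: "open (- B)" by (simp add: compact_imp_closed open_Compl)
  have notB: "r \<notin> B" if "s \<le> r" "r \<le> t" for r
  proof
    assume "r \<in> B"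
    then obtain u where u: "u \<in> topspace solenoid" "norm (?P (polar r u)) \<le> c" by (auto simp: B_def)
    then have "polar r u \<in> closed_annulus s t" using that st by (auto simp: closed_annulus_iff)
    with lb u c show False by fastforce
  qed
  obtain d where d: "d > 0" "ball s d \<subseteq> - B" using op notB[of s] st by (meson ComplI
      open_contains_ball order_refl)
  obtain e where e: "e > 0" "ball t e \<subseteq> - B" using op notB[of t] st by (meson ComplI
      open_contains_ball order_refl)
  define s' where "s' = max (s / 2) (s - d / 2)"
  define t' where "t' = min (2 * t) (t + e / 2)"
  show thesis
  proof (rule that)
    show "0 < s'" "s' < s" "t < t'" using st d(1) e(1) by (auto simp: s'_def t'_def)
    fix z assume "z \<in> closed_annulus s' t'"
    then obtain r u where z: "s' \<le> r" "r \<le> t'" "u \<in> topspace solenoid" "z = polar r u"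
      using \<open>0 < s'\<close> by (auto simp: closed_annulus_iff)
    have "r \<notin> B"
    proof (cases "r < s")
      case True
      then have "r \<in> ball s d" using z(1) d(1) by (auto simp: s'_def dist_real_def)
      with d show ?thesis by auto
    next
      case False
      show ?thesis
      proof (cases "t < r")
        case True
        then have "r \<in> ball t e" using z(2) e(1) by (auto simp: t'_def dist_real_def)
        with e show ?thesis by auto
      qed (use False notB in auto)
    qed
    moreover have "(r, u) \<in> ?S" using z by (auto simp: s'_def t'_def)
    ultimately show "c \<le> norm (?P z)"
      unfolding B_def z(4) by (force simp: image_iff)
  qed
qed

section \<open>Logarithms of nonvanishing series\<close>

lemma summable_on_int_power:
  fixes \<theta> :: real
  assumes "0 \<le> \<theta>" "\<theta> < 1"
  shows "(\<lambda>j::int. \<theta> ^ nat \<bar>j\<bar>) summable_on UNIV"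
proof -
  have g: "(\<lambda>n::nat. \<theta> ^ n) summable_on UNIV"
    using assms by (intro summable_nonneg_imp_summable_on summable_geometric) auto
  have "(\<lambda>j::int. \<theta> ^ nat \<bar>j\<bar>) summable_on range int"
    using g by (subst summable_on_reindex) (auto simp: o_def)
  moreover have "(\<lambda>j::int. \<theta> ^ nat \<bar>j\<bar>) summable_on range (\<lambda>n. - int n)"
    using g by (subst summable_on_reindex) (auto simp: o_def inj_on_def)
  moreover have "(UNIV :: int set) = range int \<union> range (\<lambda>n. - int n)"
    by (auto simp: image_iff) (metis int_cases2)
  ultimately show ?thesis by (metis summable_on_union)
qed

text \<open>By the Cauchy estimates on the two bounding circles of the larger annulus, the coefficients
  contribute to the norm on the smaller one at most \<open>B\<close> times the ratio of the two weights. On the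
  lattice of exponents of a single level these ratios decay geometrically, so their sum \<^term>\<open>C\<close> is
  finite; over all rational exponents they are not summable. That \<^term>\<open>C\<close> is the same for all
  functions makes the estimate useful for high powers.\<close>

lemma level_norm_le_sup:
  assumes k: "0 < k" and st: "0 < s'" "s' < s" "s \<le> t" "t < t'"
  shows "\<exists>C. \<forall>g B M. annulus_norm_at_most (level_exponents k) s' t' g M \<longrightarrow>
      (\<forall>z\<in>closed_annulus s' t'. norm (g z) \<le> B) \<longrightarrow> annulus_norm_at_most UNIV s t g (C * B)"
proof -
  interpret K': weighted_monomials "level_exponents k" "annulus_weight s' t'" "closed_annulus s' t'"
    by (rule weighted_monomials_level) (use assms in auto)
  interpret K: weighted_monomials UNIV "annulus_weight s t" "closed_annulus s t"
    by (rule weighted_monomials_annulus) (use assms in auto)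
  define v where "v q = (if q \<in> level_exponents k then annulus_weight s t q / annulus_weight s' t'
      q else 0)" for q
  define \<theta> where "\<theta> = max ((t / t') powr (1 / real k)) ((s' / s) powr (1 / real k))"
  have \<theta>: "0 \<le> \<theta>" "\<theta> < 1"
    using st k powr_less_mono2[of "1 / real k" "t / t'" 1] powr_less_mono2[of "1 / real k"
        "s' / s" 1]
    by (auto simp: \<theta>_def le_max_iff_disj)
  have v0: "0 \<le> v q" for q
    by (auto simp: v_def le_max_iff_disj intro!: divide_nonneg_nonneg)
  have vle: "v (Fract j (int k)) \<le> \<theta> ^ nat \<bar>j\<bar>" for j
  proof -
    define x where "x = real_of_int j / real k"
    have w: "annulus_weight s t (Fract j (int k)) / annulus_weight s' t' (Fract j (int k)) =
       max (s powr x) (t powr x) / max (s' powr x) (t' powr x)"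
      using k by (simp add: of_rat_Fract x_def)
    have "max (s powr x) (t powr x) / max (s' powr x) (t' powr x) \<le> \<theta> ^ nat \<bar>j\<bar>"
    proof (cases "0 \<le> j")
      case True
      then have x: "0 \<le> x" by (simp add: x_def)
      have "max (s powr x) (t powr x) = t powr x"
        using st x by (intro max_absorb2 powr_mono2) auto
      moreover have "max (s' powr x) (t' powr x) = t' powr x"
        using st x by (intro max_absorb2 powr_mono2) auto
      ultimately have "max (s powr x) (t powr x) / max (s' powr x) (t' powr x) = (t / t') powr x"
        using st by (simp add: powr_divide)
      also have "\<dots> = ((t / t') powr (1 / real k)) ^ nat \<bar>j\<bar>"
        using st True by (simp add: x_def powr_powr flip: powr_realpow)
      also have "\<dots> \<le> \<theta> ^ nat \<bar>j\<bar>"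
        by (intro power_mono) (auto simp: \<theta>_def)
      finally show ?thesis .
    next
      case False
      then have x: "x \<le> 0" using k by (simp add: x_def divide_le_0_iff)
      have "max (s powr x) (t powr x) = s powr x"
        using st x by (intro max_absorb1 powr_mono2') auto
      moreover have "max (s' powr x) (t' powr x) = s' powr x"
        using st x by (intro max_absorb1 powr_mono2') auto
      ultimately have "max (s powr x) (t powr x) / max (s' powr x) (t' powr x) =
          (s' / s) powr (- x)"
        using st by (simp add: powr_divide powr_minus field_simps)
      also have "\<dots> = ((s' / s) powr (1 / real k)) ^ nat \<bar>j\<bar>"
        using st False by (simp add: x_def powr_powr flip: powr_realpow)
      also have "\<dots> \<le> \<theta> ^ nat \<bar>j\<bar>"
        by (intro power_mono) (auto simp: \<theta>_def)
      finally show ?thesis .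
    qed
    then show ?thesis by (simp add: v_def w level_exponents_def)
  qed
  have "(\<lambda>j. v (Fract j (int k))) summable_on UNIV"
    by (rule summable_on_comparison_test[OF summable_on_int_power[OF \<theta>] vle v0])
  then have "v summable_on level_exponents k"
    unfolding level_exponents_def using k by (subst summable_on_reindex)
        (auto simp: o_def inj_on_def eq_rat)
  then have v: "v summable_on UNIV"
    by (rule summable_on_cong_neutral[THEN iffD1, rotated -1]) (auto simp: v_def)
  show ?thesis
  proof (intro exI allI impI)
    fix g B M
    assume g: "K'.norm_at_most g M" and B: "\<forall>z\<in>closed_annulus s' t'. norm (g z) \<le> B"
    obtain a where a: "K'.summable_coeffs a" "\<forall>z\<in>closed_annulus s' t'. g z =
        (\<Sum>\<^sub>\<infinity>q. a q * monomial q z)"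
      using g by (auto simp: K'.norm_at_most_def)
    have "norm (a q) * r powr of_rat q \<le> B" if r: "r = s' \<or> r = t'" for r q
    proof (rule cauchy_estimate)
      show "0 < r" using r st by auto
      show "(\<lambda>q. norm (a q) * r powr of_rat q) summable_on UNIV"
      proof (rule summable_on_comparison_test)
        show "(\<lambda>q. norm (a q) * annulus_weight s' t' q) summable_on UNIV"
          using a(1) by (simp add: K'.summable_coeffs_def)
        show "norm (a q) * r powr of_rat q \<le> norm (a q) * annulus_weight s' t' q" for q
          by (rule mult_left_mono) (use r in auto)
      qed simp
      have "leaf r x \<in> closed_annulus s' t'" for x
        using r st by (auto simp: closed_annulus_def leaf_in_line modulus_leaf)
      then show "norm (\<Sum>\<^sub>\<infinity>q. a q * monomial q (leaf r x)) \<le> B" for x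
        using a(2) B by metis
    qed
    then have est: "norm (a q) * annulus_weight s' t' q \<le> B" for q
      by (auto simp: max_def)
    have le: "norm (a q) * annulus_weight s t q \<le> B * v q" for q
    proof (cases "q \<in> level_exponents k")
      case True
      have pos: "0 < annulus_weight s' t' q" using st by (simp add: less_max_iff_disj)
      have "norm (a q) * annulus_weight s t q = (norm (a q) * annulus_weight s' t' q) * v q"
        using True pos by (simp add: v_def)
      also have "\<dots> \<le> B * v q" using est v0 by (rule mult_right_mono)
      finally show ?thesis .
    next
      case False
      then show ?thesis using a(1) by (simp add: v_def K'.summable_coeffs_def)
    qed
    have S: "(\<lambda>q. norm (a q) * annulus_weight s t q) summable_on UNIV"
      by (rule summable_on_comparison_test[OF summable_on_cmult_right[OF v] le])
         (simp add: le_max_iff_disj)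
    then have "(\<Sum>\<^sub>\<infinity>q. norm (a q) * annulus_weight s t q) \<le> (\<Sum>\<^sub>\<infinity>q. B * v q)"
      by (rule infsum_mono[OF _ summable_on_cmult_right[OF v] le])
    also have "\<dots> = infsum v UNIV * B"
      by (simp add: infsum_cmult_right' mult.commute)
    finally show "K.norm_at_most g (infsum v UNIV * B)"
      unfolding K.norm_at_most_def K.summable_coeffs_def using S a(2) closed_annulus_mono[of s' s
          t t'] st
      by (intro exI[of _ a]) auto
  qed
qed

text \<open>The theorem of Wiener-Levy type. The exponent \<open>q\<close> is that of the finite sum \<open>P\<close>, and \<open>g\<close> is
  the sum of a logarithm of \<open>P / z\<^sup>q\<close> and of the principal logarithm of \<open>1 + h = f / P\<close>.\<close>

lemma nonvanishing_series_exp: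
  assumes st: "0 < s" "s \<le> t" and f: "annulus_norm_at_most UNIV s t f M"
    and nz: "\<And>z. z \<in> closed_annulus s t \<Longrightarrow> f z \<noteq> 0"
  shows "\<exists>q g N. annulus_norm_at_most UNIV s t g N \<and>
    (\<forall>z\<in>closed_annulus s t. f z = monomial q z * exp (g z))"
proof -
  interpret K: weighted_monomials UNIV "annulus_weight s t" "closed_annulus s t"
    by (rule weighted_monomials_annulus) (use st in auto)
  obtain a where a: "K.summable_coeffs a" "\<And>z. z \<in> closed_annulus s t \<Longrightarrow> f z =
      (\<Sum>\<^sub>\<infinity>q. a q * monomial q z)"
    using f by (auto simp: K.norm_at_most_def)
  obtain \<delta> where \<delta>: "\<delta> > 0" "\<And>z. z \<in> closed_annulus s t \<Longrightarrow> \<delta> \<le> norm (f z)"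
    using lower_bound_on_annulus[OF st _ a(2) nz] a(1) by (auto simp: K.summable_coeffs_def)
  \<comment> \<open>The error \<open>\<delta> / 4\<close> is half of the lower bound of \<open>\<bar>P\<bar>\<close> on a larger annulus.\<close>
  obtain F where F: "finite F"
    "K.norm_at_most (\<lambda>z. (\<Sum>\<^sub>\<infinity>q. a q * monomial q z) - (\<Sum>q\<in>F. a q * monomial q z)) (\<delta> / 4)"
    using K.series_tail[OF a(1), of "\<delta> / 4" "{}"] \<delta>(1) by auto
  define P where "P z = (\<Sum>q\<in>F. a q * monomial q z)" for z
  have fP: "K.norm_at_most (\<lambda>z. f z - P z) (\<delta> / 4)"
    using F(2) by (rule K.norm_at_most_cong) (auto simp: a(2) P_def)
  have Plb: "3 * \<delta> / 4 \<le> norm (P z)" if "z \<in> closed_annulus s t" for z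
    using K.norm_at_most_bound[OF fP that] \<delta>(2)[OF that] norm_triangle_ineq2[of "f z" "P z"]
      norm_triangle_ineq3[of "f z" "P z"] by linarith
  obtain s' t' where st': "0 < s'" "s' < s" "t < t'"
    and Plb': "\<And>z. z \<in> closed_annulus s' t' \<Longrightarrow> \<delta> / 2 \<le> norm (P z)"
    using finite_sum_lower_bound_enlarge[OF F(1) st, of "\<delta> / 2" "3 * \<delta> / 4" a] \<delta>(1) Plb
    by (auto simp: P_def)
  obtain k where k: "0 < k" "F \<subseteq> level_exponents k" using finite_in_level[OF F(1)] .
  interpret K': weighted_monomials "level_exponents k" "annulus_weight s' t'" "closed_annulus s' t'"
    by (rule weighted_monomials_level) (use k st st' in auto)
  have sub: "closed_annulus s t \<subseteq> closed_annulus s' t'"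
    using st' by (intro closed_annulus_mono) auto
  have Pnz: "P z \<noteq> 0" if "z \<in> closed_annulus s' t'" for z
    using Plb'[OF that] \<delta>(1) by auto
  have s't': "s' \<le> t'" using st st' by simp
  obtain q g N where q: "q \<in> level_exponents k" and g: "K'.norm_at_most g N"
    and Pexp: "\<And>z. z \<in> closed_annulus s' t' \<Longrightarrow> P z = monomial q z * exp (g z)"
    using finite_sum_exp[OF k(2) F(1) k(1) st'(1) s't' Pnz[unfolded P_def], folded P_def] by blast
  have q': "- q \<in> level_exponents k"
    using q k(1) by (auto simp: level_exponents_def)
  \<comment> \<open>This bound on the norm of \<open>P\<^sup>-\<^sup>n\<close> may grow too fast with \<open>n\<close>. It shows that \<open>P\<^sup>-\<^sup>n\<close> is
    a series at level \<open>k\<close>, so that the supremum bound applies.\<close>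
  have Pinv: "K'.norm_at_most (\<lambda>z. inverse (P z) ^ n) ((annulus_weight s' t' (- q) * exp N) ^ n)"
      for n
  proof (rule K'.norm_at_most_power)
    have "K'.norm_at_most (\<lambda>z. 1 * monomial (- q) z * exp (- 1 * g z)) (norm (1::complex) *
        annulus_weight s' t' (- q) * exp (norm (- 1 :: complex) * N))"
      by (intro K'.norm_at_most_mult K'.norm_at_most_exp K'.norm_at_most_cmult
          K'.norm_at_most_monomial q' g)
    then show "K'.norm_at_most (\<lambda>z. inverse (P z)) (annulus_weight s' t' (- q) * exp N)"
    proof (rule K'.norm_at_most_cong)
      fix z assume z: "z \<in> closed_annulus s' t'"
      then have "monomial q z * monomial (- q) z = 1"
        using K'.monomial_add[OF q q' z] K'.in_line by auto
      then have "inverse (monomial q z) = monomial (- q) z"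
        by (metis inverse_unique)
      then show "inverse (P z) = 1 * monomial (- q) z * exp (- 1 * g z)"
        using z by (simp add: Pexp exp_minus)
    qed simp
  qed
  have Pinv_le: "norm (inverse (P z) ^ n) \<le> (2 / \<delta>) ^ n" if "z \<in> closed_annulus s' t'" for z n
  proof -
    have "norm (inverse (P z)) \<le> inverse (\<delta> / 2)"
      unfolding norm_inverse by (rule le_imp_inverse_le[OF Plb'[OF that]]) (use \<delta>(1) in simp)
    then show ?thesis
      unfolding norm_power by (intro power_mono) simp_all
  qed
  obtain C where C: "\<And>g B M. K'.norm_at_most g M \<Longrightarrow>
      \<forall>z\<in>closed_annulus s' t'. norm (g z) \<le> B \<Longrightarrow> K.norm_at_most g (C * B)"
    using level_norm_le_sup[OF k(1) st'(1,2) st(2) st'(3)] by blast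
  have inv: "K.norm_at_most (\<lambda>z. inverse (P z) ^ n) (C * (2 / \<delta>) ^ n)" for n
    by (rule C[OF Pinv]) (use Pinv_le in blast)
  define h where "h z = (f z - P z) * inverse (P z)" for z
  have hpow: "K.norm_at_most (\<lambda>z. h z ^ n) (C * (1 / 2) ^ n)" for n
  proof -
    have "K.norm_at_most (\<lambda>z. (f z - P z) ^ n * inverse (P z) ^ n) ((\<delta> / 4) ^ n * (C * (2 / \<delta>) ^
        n))"
      by (intro K.norm_at_most_mult K.norm_at_most_power fP inv)
    moreover have "(\<delta> / 4) ^ n * (C * (2 / \<delta>) ^ n) = C * (1 / 2) ^ n"
    proof -
      have "(\<delta> / 4) ^ n * (2 / \<delta>) ^ n = (1 / 2) ^ n"
        unfolding power_mult_distrib[symmetric] using \<delta>(1) by simp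
      then show ?thesis by simp
    qed
    ultimately show ?thesis
      unfolding h_def power_mult_distrib by (simp only:)
  qed
  have hsmall: "norm (h z) < 1" if z: "z \<in> closed_annulus s t" for z
  proof -
    have "norm (f z - P z) < norm (P z)"
      using K.norm_at_most_bound[OF fP z] Plb[OF z] \<delta>(1) by linarith
    moreover from this have "0 < norm (P z)" by (rule le_less_trans[OF norm_ge_zero])
    ultimately show ?thesis
      by (simp add: h_def norm_divide flip: divide_inverse)
  qed
  obtain L where L: "K.norm_at_most (\<lambda>z. Ln (1 + h z)) L"
    using K.norm_at_most_Ln[OF hpow _ _ hsmall] by auto
  have "K.norm_at_most g N"
    by (rule norm_at_most_mono[OF K'.weighted_monomials_axioms K.weighted_monomials_axioms _ _ sub
        g])
       (use st st' powr_le_max[of s' _ t'] in auto)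
  from K.norm_at_most_add[OF this L] have gL: "K.norm_at_most (\<lambda>z. g z + Ln (1 + h z)) (N + L)" .
  have "f z = monomial q z * exp (g z + Ln (1 + h z))" if z: "z \<in> closed_annulus s t" for z
  proof -
    have "P z \<noteq> 0" using Pnz z sub by auto
    then have "f z = P z * (1 + h z)" by (simp add: h_def field_simps)
    moreover have "1 + h z \<noteq> 0"
      using hsmall[OF z] by (metis add_eq_0_iff norm_minus_cancel norm_one less_irrefl)
    ultimately show ?thesis
      using Pexp[of z] z sub by (auto simp: exp_add)
  qed
  with gL show ?thesis by blast
qed

section \<open>Topology of the adelic line\<close>

lemma continuous_projection:
  assumes "0 < k"
  shows "continuous_map adelic_line (Alexandroff_compactification euclidean) (\<lambda>z. z k)"
  unfolding adelic_line_def inverse_limit_def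
  by (intro continuous_map_from_subtopology continuous_map_product_projection) (use assms in auto)

lemma openin_modulus_less: "openin adelic_line {z \<in> topspace adelic_line. modulus z < R}"
proof -
  let ?U = "{w::complex. ereal (norm w) < R}"
  have "open ?U"
    by (intro open_Collect_less continuous_intros)
  then have "openin (Alexandroff_compactification euclidean) (Some ` ?U)"
    by simp
  then have "openin adelic_line {z \<in> topspace adelic_line. z 1 \<in> Some ` ?U}"
    by (intro openin_continuous_map_preimage[OF continuous_projection]) auto
  also have "{z \<in> topspace adelic_line. z 1 \<in> Some ` ?U} =
      {z \<in> topspace adelic_line. modulus z < R}"
    by (auto simp: modulus_def split: option.splits)
  finally show ?thesis .
qed

lemma openin_modulus_greater: "openin adelic_line {z \<in> topspace adelic_line. ereal s < modulus z}"
proof -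
  have "compact (cball (0::complex) s)" by simp
  moreover have eq: "UNIV - cball (0::complex) s = {w. s < norm w}" by auto
  ultimately have "openin (Alexandroff_compactification euclidean) (insert None (Some `
      {w::complex. s < norm w}))"
    unfolding openin_Alexandroff_compactification eq[symmetric] by (metis closed_cball
        closed_closedin compactin_euclidean_iff topspace_euclidean)
  then have "openin adelic_line {z \<in> topspace adelic_line. z 1 \<in> insert None (Some ` {w. s < norm
      w})}"
    by (intro openin_continuous_map_preimage[OF continuous_projection]) auto
  also have "{z \<in> topspace adelic_line. z 1 \<in> insert None (Some ` {w. s < norm w})} =
     {z \<in> topspace adelic_line. ereal s < modulus z}"
  proof -
    have "z 1 \<in> insert None (Some ` {w. s < norm w}) \<longleftrightarrow> ereal s < modulus z" for z :: point
      by (cases "z 1") (auto simp: modulus_def)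
    then show ?thesis by simp
  qed
  finally show ?thesis .
qed

lemma modulus_finite_iff:
  assumes "z \<in> topspace adelic_line" "0 < k"
  shows "modulus z \<noteq> \<infinity> \<longleftrightarrow> (\<exists>w. z k = Some w)"
    and "modulus z = 0 \<longleftrightarrow> z k = Some 0"
  using assms(1) by (cases rule: adelic_line_cases; use assms(2) in \<open>force simp: zero_point_def
      infinity_point_def polar_def modulus_def solenoid_norm norm_mult dest: solenoid_norm\<close>)+

text \<open>The coordinate \<open>1 / w\<close> near the point at infinity of the projective line.\<close>

definition reciprocal :: "complex option \<Rightarrow> complex" where
  "reciprocal x = (case x of None \<Rightarrow> 0 | Some w \<Rightarrow> inverse w)"

lemma continuous_map_the:
  "continuous_map (subtopology (Alexandroff_compactification euclidean) (range Some)) (euclidean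
      :: complex topology) the"
  unfolding continuous_map_def
proof (intro conjI allI impI)
  fix V :: "complex set" assume "openin euclidean V"
  then have "openin (Alexandroff_compactification euclidean) (Some ` V)" by simp
  moreover have "{x \<in> topspace (subtopology (Alexandroff_compactification euclidean) (range
      Some)). the x \<in> V} = Some ` V \<inter> range Some"
    by auto
  ultimately show "openin (subtopology (Alexandroff_compactification euclidean) (range Some))
     {x \<in> topspace (subtopology (Alexandroff_compactification euclidean) (range Some)). the x \<in> V}"
    unfolding openin_subtopology by metis
qed auto

text \<open>At infinity, a neighbourhood of \<open>0\<close> pulls back to the complement of a bounded closed set,
  which is an open set of the one-point compactification.\<close>

lemma continuous_map_reciprocal:
  "continuous_map (subtopology (Alexandroff_compactification euclidean) (- {Some 0})) euclidean
      reciprocal"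
  unfolding continuous_map_def
proof (intro conjI allI impI)
  let ?X = "Alexandroff_compactification (euclidean :: complex topology)"
  fix V :: "complex set" assume "openin euclidean V"
  then have V: "open V" by simp
  let ?W = "{w. w \<noteq> 0 \<and> inverse w \<in> V}"
  have "open ((- {0}) \<inter> inverse -` V)"
    by (rule continuous_open_preimage[OF _ _ V]) (auto intro!: continuous_intros)
  also have "(- {0}) \<inter> inverse -` V = ?W" by auto
  finally have W: "open ?W" .
  have "openin ?X ({x. x \<noteq> Some 0 \<and> reciprocal x \<in> V})"
  proof (cases "0 \<in> V")
    case False
    then have "{x. x \<noteq> Some 0 \<and> reciprocal x \<in> V} = Some ` ?W"
      by (auto simp: reciprocal_def split: option.splits)
    then show ?thesis using W by simp
  next
    case True
    then obtain e where e: "e > 0" "ball 0 e \<subseteq> V" using V by (meson open_contains_ball)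
    have "- ?W \<subseteq> cball 0 (1 / e)"
    proof
      fix w assume w: "w \<in> - ?W"
      show "w \<in> cball 0 (1 / e)"
      proof (rule ccontr)
        assume "w \<notin> cball 0 (1 / e)"
        then have "1 / e < norm w" by simp
        then have "w \<noteq> 0" "norm (inverse w) < e" using e(1)
          by (auto simp: norm_inverse norm_divide divide_simps mult.commute split: if_splits)
        then have "inverse w \<in> V" using e(2) by auto
        with w \<open>w \<noteq> 0\<close> show False by simp
      qed
    qed
    then have "bounded (- ?W)" by (rule bounded_subset[OF bounded_cball])
    then have "compact (- ?W)" using W by (simp add: compact_eq_bounded_closed closed_Compl)
    moreover have "{x. x \<noteq> Some 0 \<and> reciprocal x \<in> V} = insert None (Some ` (UNIV - (- ?W)))"
    proof (rule set_eqI)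
      show "x \<in> {x. x \<noteq> Some 0 \<and> reciprocal x \<in> V} \<longleftrightarrow> x \<in> insert None (Some ` (UNIV - (- ?W)))" for x
        using True by (cases x) (auto simp: reciprocal_def)
    qed
    ultimately show ?thesis
      using W unfolding openin_Alexandroff_compactification
      by (intro disjI2 exI[of _ "- ?W"]) (auto simp: closed_Compl simp flip: closed_closedin)
  qed
  moreover have "{x \<in> topspace (subtopology ?X (- {Some 0})). reciprocal x \<in> V} =
      {x. x \<noteq> Some 0 \<and> reciprocal x \<in> V} \<inter> - {Some 0}"
    by (auto simp: notin_range_Some)
  ultimately show "openin (subtopology ?X (- {Some 0})) {x \<in> topspace (subtopology ?X (- {Some
      0})). reciprocal x \<in> V}"
    by (auto simp: openin_subtopology)
qed auto

lemma continuous_monomial_nonneg: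
  assumes q: "0 \<le> q" and D: "\<And>z. z \<in> D \<Longrightarrow> modulus z \<noteq> \<infinity>"
  shows "continuous_map (subtopology adelic_line D) euclidean (monomial q)"
proof -
  obtain m k where mk: "k > 0" "q = Fract m (int k)" by (metis rat_common_denominator)
  then have m: "0 \<le> m" using q by (simp add: zero_le_Fract_iff)
  have "continuous_map (subtopology adelic_line D) (subtopology (Alexandroff_compactification
      euclidean) (range Some)) (\<lambda>z. z k)"
    using continuous_projection[OF mk(1)] modulus_finite_iff(1)[OF _ mk(1)] D
    by (auto simp: continuous_map_in_subtopology intro!: continuous_map_from_subtopology) blast
  then have "continuous_map (subtopology adelic_line D) euclidean (\<lambda>z. the (z k))"
    using continuous_map_compose[OF _ continuous_map_the] by (simp add: o_def)
  then have "continuous_map (subtopology adelic_line D) euclidean (\<lambda>z. the (z k) ^ nat m)"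
    using continuous_map_compose[of _ euclidean _ euclidean
        "\<lambda>x::complex. x ^ nat m"] continuous_on_power[OF continuous_on_id, of UNIV "nat m"]
    by (simp add: o_def)
  then show ?thesis
  proof (rule continuous_map_eq)
    fix z assume "z \<in> topspace (subtopology adelic_line D)"
    then have "z \<in> topspace adelic_line" "modulus z \<noteq> \<infinity>" using D by auto
    then have z: "z \<in> topspace adelic_line" "z \<noteq> infinity_point" by auto
    show "the (z k) ^ nat m = monomial q z"
    proof (cases "z = zero_point")
      case True
      have "q = 0 \<longleftrightarrow> m = 0" using mk by (simp add: Zero_rat_def eq_rat)
      then show ?thesis using True mk(1) m by (auto simp: monomial_def zero_point_def power_0_left)
    next
      case False
      then show ?thesis using monomial_Fract[OF z(1) False z(2) mk(1)] m by (simp add: mk(2)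
          power_int_def)
    qed
  qed
qed

lemma continuous_monomial_nonpos:
  assumes q: "q \<le> 0" and D: "\<And>z. z \<in> D \<Longrightarrow> modulus z \<noteq> 0"
  shows "continuous_map (subtopology adelic_line D) euclidean (monomial q)"
proof -
  obtain m k where mk: "k > 0" "q = Fract m (int k)" by (metis rat_common_denominator)
  then have m: "m \<le> 0" using q by (simp add: Fract_le_zero_iff)
  have "continuous_map (subtopology adelic_line D) (subtopology (Alexandroff_compactification
      euclidean) (- {Some 0})) (\<lambda>z. z k)"
    using continuous_projection[OF mk(1)] modulus_finite_iff(2)[OF _ mk(1)] D
    by (auto simp: continuous_map_in_subtopology intro!: continuous_map_from_subtopology)
  then have "continuous_map (subtopology adelic_line D) euclidean (\<lambda>z. reciprocal (z k))"
    using continuous_map_compose[OF _ continuous_map_reciprocal] by (simp add: o_def)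
  then have "continuous_map (subtopology adelic_line D) euclidean (\<lambda>z. reciprocal (z k) ^ nat (-
      m))"
    using continuous_map_compose[of _ euclidean _ euclidean
        "\<lambda>x::complex. x ^ nat (- m)"] continuous_on_power[OF continuous_on_id, of UNIV "nat (- m)"]
    by (simp add: o_def)
  then show ?thesis
  proof (rule continuous_map_eq)
    fix z assume "z \<in> topspace (subtopology adelic_line D)"
    then have "z \<in> topspace adelic_line" "modulus z \<noteq> 0" using D by auto
    then have z: "z \<in> topspace adelic_line" "z \<noteq> zero_point" by auto
    show "reciprocal (z k) ^ nat (- m) = monomial q z"
    proof (cases "z = infinity_point")
      case True
      have "q = 0 \<longleftrightarrow> m = 0" using mk by (simp add: Zero_rat_def eq_rat)
      then show ?thesis using True mk(1) m by (auto simp: monomial_def infinity_point_def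
          power_0_left reciprocal_def)
    next
      case False
      have "modulus z \<noteq> \<infinity>"
        by (rule adelic_line_cases[OF z(1)]) (use False in auto)
      then obtain w where "z k = Some w"
        using modulus_finite_iff(1)[OF z(1) mk(1)] by blast
      then show ?thesis using monomial_Fract[OF z(1) z(2) False mk(1)] m
        by (auto simp: mk(2) power_int_def reciprocal_def)
    qed
  qed
qed

text \<open>The usual \<open>\<epsilon> / 3\<close> argument.\<close>

lemma continuous_map_local_uniform_limit:
  fixes f :: "'a \<Rightarrow> complex"
  assumes cont: "\<And>q. q \<in> Q \<Longrightarrow> continuous_map X euclidean (g q)"
    and lim: "\<And>z. z \<in> topspace X \<Longrightarrow> \<exists>U. openin X U \<and> z \<in> U \<and>
      uniform_limit U (\<lambda>F w. \<Sum>q\<in>F. g q w) f (finite_subsets_at_top Q)"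
  shows "continuous_map X euclidean f"
  unfolding continuous_map_def
proof (intro conjI allI impI)
  fix V :: "complex set" assume "openin euclidean V"
  then have V: "open V" by simp
  show "openin X {x \<in> topspace X. f x \<in> V}"
  proof (subst openin_subopen, intro ballI)
    fix x assume x: "x \<in> {x \<in> topspace X. f x \<in> V}"
    then obtain e where e: "e > 0" "ball (f x) e \<subseteq> V" using V by (auto elim: openE)
    obtain U where U: "openin X U" "x \<in> U" "uniform_limit U (\<lambda>F w. \<Sum>q\<in>F. g q w) f
        (finite_subsets_at_top Q)"
      using lim x by blast
    have "\<forall>\<^sub>F F in finite_subsets_at_top Q. \<forall>w\<in>U. dist (\<Sum>q\<in>F. g q w) (f w) < e / 3"
      using uniform_limitD[OF U(3), of "e / 3"] e(1) by simp
    then obtain F where "finite F \<and> F \<subseteq> Q \<and> (\<forall>Y. finite Y \<and> F \<subseteq> Y \<and> Y \<subseteq> Q \<longrightarrow>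
        (\<forall>w\<in>U. dist (\<Sum>q\<in>Y. g q w) (f w) < e / 3))"
      unfolding eventually_finite_subsets_at_top ..
    then have F: "finite F" "F \<subseteq> Q" "\<forall>w\<in>U. dist (\<Sum>q\<in>F. g q w) (f w) < e / 3"
      by simp_all
    let ?h = "\<lambda>w. \<Sum>q\<in>F. g q w"
    have "continuous_map X euclidean ?h"
      using cont F by (intro continuous_map_sum) auto
    then have "openin X {y \<in> topspace X. ?h y \<in> ball (?h x) (e / 3)}"
      by (rule openin_continuous_map_preimage) simp
    with U(1) have "openin X (U \<inter> {y \<in> topspace X. ?h y \<in> ball (?h x) (e / 3)})"
      by (rule openin_Int)
    moreover have "f y \<in> V" if "y \<in> U" "?h y \<in> ball (?h x) (e / 3)" for y
    proof -
      have "dist (f x) (f y) \<le> dist (?h x) (f x) + dist (?h x) (?h y) + dist (?h y) (f y)"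
        using dist_triangle[of "f x" "f y" "?h x"] dist_triangle[of "?h x" "f y"
            "?h y"] by (simp add: dist_commute)
      also have "\<dots> < e" using F(3)[rule_format, OF U(2)] F(3)[rule_format, OF that(1)] that(2) by
          simp
      finally show ?thesis using e(2) by auto
    qed
    ultimately show "\<exists>T. openin X T \<and> x \<in> T \<and> T \<subseteq> {x \<in> topspace X. f x \<in> V}"
      using U(2) x e(1) by (intro exI[of _ "U \<inter> {y \<in> topspace X. ?h y \<in> ball (?h x) (e / 3)}"]) auto
  qed
qed auto

section \<open>Holomorphic functions and their coefficients\<close>

text \<open>Locally uniform convergence by the Weierstrass test: near each point the monomials are
  dominated by a weight against which the coefficients are summable. Continuity of the sum then
  follows from that of the monomials.\<close>

lemma holomorphic_series_onI:
  assumes D: "D \<subseteq> topspace adelic_line"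
    and cont: "\<And>q. q \<in> Q \<Longrightarrow> continuous_map (subtopology adelic_line D) euclidean (monomial q)"
    and a0: "\<And>q. q \<notin> Q \<Longrightarrow> a q = 0"
    and f: "\<And>z. z \<in> D \<Longrightarrow> f z = (\<Sum>\<^sub>\<infinity>q. a q * monomial q z)"
    and loc: "\<And>z. z \<in> D \<Longrightarrow> \<exists>U w. openin adelic_line U \<and> z \<in> U \<and>
      (\<lambda>q. norm (a q) * w q) summable_on UNIV \<and> (\<forall>q\<in>Q. \<forall>y\<in>U. norm (monomial q y) \<le> w q)"
  shows "holomorphic_series_on Q D f"
proof -
  have fQ: "f z = (\<Sum>\<^sub>\<infinity>q\<in>Q. a q * monomial q z)" if "z \<in> D" for z
    unfolding f[OF that] by (rule infsum_cong_neutral) (use a0 in auto)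
  have *: "\<exists>U. openin (subtopology adelic_line D) U \<and> z \<in> U \<and>
      uniform_limit U (\<lambda>F w. \<Sum>q\<in>F. a q * monomial q w) f (finite_subsets_at_top Q) \<and>
      (\<lambda>q. norm (a q * monomial q z)) summable_on Q" if z: "z \<in> D" for z
  proof -
    obtain U w where U: "openin adelic_line U" "z \<in> U" "(\<lambda>q. norm (a q) * w q) summable_on UNIV"
      "\<And>q y. q \<in> Q \<Longrightarrow> y \<in> U \<Longrightarrow> norm (monomial q y) \<le> w q"
      using loc[OF z] by blast
    have S: "(\<lambda>q. norm (a q) * w q) summable_on Q"
      by (rule summable_on_subset_banach[OF U(3)]) auto
    have le: "norm (a q * monomial q y) \<le> norm (a q) * w q" if "q \<in> Q" "y \<in> U" for q y
      using U(4)[OF that] by (simp add: norm_mult mult_left_mono)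
    have "uniform_limit (U \<inter> D) (\<lambda>F w. \<Sum>q\<in>F. a q * monomial q w) (\<lambda>z. \<Sum>\<^sub>\<infinity>q\<in>Q. a q * monomial q z)
        (finite_subsets_at_top Q)"
      by (rule Weierstrass_m_test_general[OF le S]) auto
    then have "uniform_limit (U \<inter> D) (\<lambda>F w. \<Sum>q\<in>F. a q * monomial q w) f (finite_subsets_at_top Q)"
      by (subst uniform_limit_cong') (auto simp: fQ)
    moreover have "(\<lambda>q. norm (a q * monomial q z)) summable_on Q"
      by (rule summable_on_comparison_test[OF S le]) (use U(2) in auto)
    moreover have "openin (subtopology adelic_line D) (U \<inter> D)"
      using U(1) by (auto simp: openin_subtopology)
    ultimately show ?thesis using U(2) z by blast
  qed
  have "continuous_map (subtopology adelic_line D) euclidean f"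
  proof (rule continuous_map_local_uniform_limit)
    show "continuous_map (subtopology adelic_line D) euclidean (\<lambda>z. a q * monomial q z)" if
        "q \<in> Q" for q
      using continuous_map_compose[OF cont[OF that], of euclidean "\<lambda>x. a q * x"]
        continuous_on_mult_left[OF continuous_on_id, of UNIV "a q"]
      by (simp add: o_def)
  qed (use * in auto)
  then show ?thesis
    unfolding holomorphic_series_on_def using * by (intro conjI exI[of _ a]) blast+
qed

text \<open>Coefficients extended by \<open>0\<close> to all rational exponents, so that expansions on annuli and
  discs can be compared.\<close>

lemma holomorphic_series_onE:
  assumes "holomorphic_series_on Q D f"
  obtains a where "\<And>q. q \<notin> Q \<Longrightarrow> a q = 0"
    "\<And>z. z \<in> D \<Longrightarrow> (\<lambda>q. norm (a q * monomial q z)) summable_on UNIV"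
    "\<And>z. z \<in> D \<Longrightarrow> f z = (\<Sum>\<^sub>\<infinity>q. a q * monomial q z)"
proof -
  obtain b where b: "\<And>z. z \<in> D \<Longrightarrow> (\<lambda>q. norm (b q * monomial q z)) summable_on Q"
    "\<And>z. z \<in> D \<Longrightarrow> \<exists>U. z \<in> U \<and> uniform_limit U (\<lambda>F w. \<Sum>q\<in>F. b q * monomial q w) f
        (finite_subsets_at_top Q)"
    using assms unfolding holomorphic_series_on_def by blast
  define a where "a q = (if q \<in> Q then b q else 0)" for q
  show thesis
  proof (rule that[of a])
    fix z assume z: "z \<in> D"
    show "(\<lambda>q. norm (a q * monomial q z)) summable_on UNIV"
      using b(1)[OF z] by (rule summable_on_cong_neutral[THEN iffD1, rotated -1]) (auto simp: a_def)
    obtain U where U: "z \<in> U" "uniform_limit U (\<lambda>F w. \<Sum>q\<in>F. b q * monomial q w) f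
        (finite_subsets_at_top Q)"
      using b(2)[OF z] by blast
    have "((\<lambda>q. b q * monomial q z) has_sum f z) Q"
      unfolding has_sum_def using tendsto_uniform_limitI[OF U(2,1)] .
    then have "((\<lambda>q. a q * monomial q z) has_sum f z) UNIV"
      by (rule has_sum_cong_neutral[THEN iffD1, rotated -1]) (auto simp: a_def)
    then show "f z = (\<Sum>\<^sub>\<infinity>q. a q * monomial q z)" by (simp add: infsumI)
  qed (simp add: a_def)
qed

lemma summable_at_modulus:
  assumes "\<And>z. z \<in> D \<Longrightarrow> (\<lambda>q. norm (a q * monomial q z)) summable_on UNIV"
    and "0 < t" "leaf t 0 \<in> D"
  shows "(\<lambda>q. norm (a q) * t powr of_rat q) summable_on UNIV"
  using assms(1)[OF assms(3)] assms(2) by (simp add: monomial_leaf norm_mult)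

lemma summable_annulus_weight:
  assumes "(\<lambda>q. norm (a q) * s powr of_rat q) summable_on UNIV"
    and "(\<lambda>q. norm (a q) * t powr of_rat q) summable_on UNIV"
  shows "(\<lambda>q. norm (a q) * annulus_weight s t q) summable_on UNIV"
proof (rule summable_on_comparison_test[OF summable_on_add[OF assms]])
  show "norm (a q) * annulus_weight s t q \<le> norm (a q) * s powr of_rat q + norm (a q) * t powr
      of_rat q" for q :: rat
    using mult_left_mono[of "annulus_weight s t q" "s powr of_rat q + t powr of_rat q" "norm (a q)"]
    by (simp add: distrib_left)
  show "0 \<le> norm (a q) * annulus_weight s t q" for q :: rat
    by (simp add: le_max_iff_disj)
qed

lemma annulus_norm_at_most_series:
  assumes st: "0 < s" "s \<le> t"
    and "(\<lambda>q. norm (a q) * s powr of_rat q) summable_on UNIV"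
    and "(\<lambda>q. norm (a q) * t powr of_rat q) summable_on UNIV"
    and "\<And>z. z \<in> closed_annulus s t \<Longrightarrow> f z = (\<Sum>\<^sub>\<infinity>q. a q * monomial q z)"
  shows "\<exists>M. annulus_norm_at_most UNIV s t f M"
proof -
  interpret K: weighted_monomials UNIV "annulus_weight s t" "closed_annulus s t"
    by (rule weighted_monomials_annulus) (use st in auto)
  show ?thesis
    unfolding K.norm_at_most_def K.summable_coeffs_def
    using summable_annulus_weight[OF assms(3,4)] assms(5) by blast
qed

lemma holomorphic_disc_plusI:
  assumes "0 < R" and a0: "\<And>q. q < 0 \<Longrightarrow> a q = 0"
    and a: "\<And>t. 0 < t \<Longrightarrow> ereal t < R \<Longrightarrow> (\<lambda>q. norm (a q) * t powr of_rat q) summable_on UNIV"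
  shows "holomorphic_disc_plus R (\<lambda>z. \<Sum>\<^sub>\<infinity>q. a q * monomial q z)"
  unfolding holomorphic_disc_plus_def
proof (rule holomorphic_series_onI[where a = a])
  show "continuous_map (subtopology adelic_line (disc_plus R)) euclidean (monomial q)" if
      "q \<in> {0..}" for q
    by (rule continuous_monomial_nonneg) (use that in \<open>auto simp: disc_plus_def\<close>)
  fix z assume z: "z \<in> disc_plus R"
  obtain t where t: "max 0 (modulus z) < ereal t" "ereal t < R"
    using ereal_dense2[of "max 0 (modulus z)" R] z assms(1) by (auto simp: disc_plus_def)
  then have t0: "0 < t" by simp
  interpret P: weighted_monomials "{0..}" "\<lambda>q. t powr of_rat q"
      "{z \<in> topspace adelic_line. modulus z \<le> ereal t}"
    by (rule weighted_monomials_disc_plus[OF t0])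
  show "\<exists>U w. openin adelic_line U \<and> z \<in> U \<and>
      (\<lambda>q. norm (a q) * w q) summable_on UNIV \<and> (\<forall>q\<in>{0..}. \<forall>y\<in>U. norm (monomial q y) \<le> w q)"
    using openin_modulus_less[of "ereal t"] z t a[OF t0 t(2)] P.norm_monomial_le
    by (intro exI[of _ "{z \<in> topspace adelic_line. modulus z < ereal t}"] exI[of _
        "\<lambda>q. t powr of_rat q"])
       (auto simp: disc_plus_def)
qed (use a0 in \<open>auto simp: disc_plus_def\<close>)

lemma holomorphic_disc_minusI:
  assumes "0 \<le> r" and a0: "\<And>q. 0 < q \<Longrightarrow> a q = 0"
    and a: "\<And>t. 0 < t \<Longrightarrow> r < ereal t \<Longrightarrow> (\<lambda>q. norm (a q) * t powr of_rat q) summable_on UNIV"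
  shows "holomorphic_disc_minus r (\<lambda>z. \<Sum>\<^sub>\<infinity>q. a q * monomial q z)"
  unfolding holomorphic_disc_minus_def
proof (rule holomorphic_series_onI[where a = a])
  show "continuous_map (subtopology adelic_line (disc_minus r)) euclidean (monomial q)" if
      "q \<in> {..0}" for q
    by (rule continuous_monomial_nonpos) (use that assms(1) in \<open>auto simp: disc_minus_def\<close>)
  fix z assume z: "z \<in> disc_minus r"
  obtain t where t: "r < ereal t" "ereal t < modulus z"
    using ereal_dense2[of r "modulus z"] z by (auto simp: disc_minus_def)
  then have t0: "0 < t" using assms(1) by (metis ereal_less(2) le_less_trans)
  interpret P: weighted_monomials "{..0}" "\<lambda>q. t powr of_rat q"
      "{z \<in> topspace adelic_line. ereal t \<le> modulus z}"
    by (rule weighted_monomials_disc_minus[OF t0])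
  show "\<exists>U w. openin adelic_line U \<and> z \<in> U \<and>
      (\<lambda>q. norm (a q) * w q) summable_on UNIV \<and> (\<forall>q\<in>{..0}. \<forall>y\<in>U. norm (monomial q y) \<le> w q)"
    using openin_modulus_greater[of t] z t a[OF t0 t(1)] P.norm_monomial_le
    by (intro exI[of _ "{z \<in> topspace adelic_line. ereal t < modulus z}"] exI[of _
        "\<lambda>q. t powr of_rat q"])
       (auto simp: disc_minus_def)
qed (use a0 in \<open>auto simp: disc_minus_def\<close>)

lemma holomorphic_cocycle_monomial: "holomorphic_cocycle 0 \<infinity> (monomial q)"
proof -
  define a where "a p = (of_bool (p = q) :: complex)" for p
  have fin: "finite {p. a p \<noteq> 0}" by (rule finite_subset[of _ "{q}"]) (auto simp: a_def)
  have "holomorphic_series_on UNIV (annulus 0 \<infinity>) (monomial q)"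
  proof (rule holomorphic_series_onI[where a = a])
    show "continuous_map (subtopology adelic_line (annulus 0 \<infinity>)) euclidean (monomial p)" for p
    proof (cases "0 \<le> p")
      case True
      then show ?thesis by (rule continuous_monomial_nonneg) (auto simp: annulus_def)
    next
      case False
      then show ?thesis by (intro continuous_monomial_nonpos) (auto simp: annulus_def)
    qed
    show "monomial q z = (\<Sum>\<^sub>\<infinity>p. a p * monomial p z)" for z
    proof -
      have "(\<Sum>\<^sub>\<infinity>p. a p * monomial p z) = (\<Sum>\<^sub>\<infinity>p\<in>{q}. a p * monomial p z)"
        by (rule infsum_cong_neutral) (auto simp: a_def)
      then show ?thesis by (simp add: a_def)
    qed
    fix z assume z: "z \<in> annulus 0 \<infinity>"
    obtain s where s: "0 < ereal s" "ereal s < modulus z"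
      using ereal_dense2[of 0 "modulus z"] z by (auto simp: annulus_def)
    obtain t where t: "modulus z < ereal t"
      using ereal_dense2[of "modulus z" \<infinity>] z by (auto simp: annulus_def)
    have st: "0 < s" "s \<le> t" using s less_trans[OF s(2) t] by auto
    interpret K: weighted_monomials UNIV "annulus_weight s t" "closed_annulus s t"
      by (rule weighted_monomials_annulus) (use st in auto)
    let ?U = "{z \<in> topspace adelic_line. ereal s < modulus z} \<inter> {z \<in> topspace adelic_line. modulus
        z < ereal t}"
    have "openin adelic_line ?U"
      by (intro openin_Int openin_modulus_greater openin_modulus_less)
    moreover have "(\<lambda>p. norm (a p) * annulus_weight s t p) summable_on UNIV"
      by (rule finite_nonzero_values_imp_summable_on) (rule finite_subset[OF _ fin], auto)
    moreover have "norm (monomial p y) \<le> annulus_weight s t p" if "y \<in> ?U" for p y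
      by (rule K.norm_monomial_le) (use that in \<open>auto simp: closed_annulus_def less_imp_le\<close>)
    ultimately show "\<exists>U w. openin adelic_line U \<and> z \<in> U \<and>
        (\<lambda>q. norm (a q) * w q) summable_on UNIV \<and> (\<forall>q\<in>UNIV. \<forall>y\<in>U. norm (monomial q y) \<le> w q)"
      using z s t by (intro exI[of _ ?U] exI[of _ "annulus_weight s t"]) (auto simp: annulus_def)
  qed (auto simp: annulus_def)
  moreover have "monomial q z \<noteq> 0" if "z \<in> annulus 0 \<infinity>" for z
  proof -
    have "z \<in> topspace adelic_line" using that by (simp add: annulus_def)
    then show ?thesis
      using that monomial_nonzero by (cases z rule: adelic_line_cases) (auto simp: annulus_def)
  qed
  ultimately show ?thesis
    by (simp add: holomorphic_cocycle_def holomorphic_annulus_def)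
qed

section \<open>The degree of a function without zeros on a disc\<close>

lemma has_degree_cong:
  "has_degree t f q \<Longrightarrow> (\<And>s. g (leaf t s) = f (leaf t s)) \<Longrightarrow> has_degree t g q"
  by (simp add: has_degree_def)

lemma leaf_in_closed_annulus: "0 < r \<Longrightarrow> s \<le> r \<Longrightarrow> r \<le> t \<Longrightarrow> leaf r x \<in> closed_annulus s t"
  by (simp add: closed_annulus_def leaf_in_line modulus_leaf)

text \<open>By \<open>nonvanishing_series_exp\<close>, the function is \<open>z\<^sup>q exp g\<close> with the same \<open>q\<close> on all circles
  of the annulus, and \<open>g\<close> is bounded.\<close>

lemma degree_constant_on_annulus:
  assumes st: "0 < s" "s \<le> t" and f: "annulus_norm_at_most UNIV s t f M"
    and nz: "\<And>z. z \<in> closed_annulus s t \<Longrightarrow> f z \<noteq> 0"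
  obtains q where "\<And>r. s \<le> r \<Longrightarrow> r \<le> t \<Longrightarrow> has_degree r f q"
proof -
  have W: "weighted_monomials UNIV (annulus_weight s t) (closed_annulus s t)"
    by (rule weighted_monomials_annulus) (use st in auto)
  obtain q g N where g: "annulus_norm_at_most UNIV s t g N"
    "\<forall>z\<in>closed_annulus s t. f z = monomial q z * exp (g z)"
    using nonvanishing_series_exp[OF st f nz] by blast
  show thesis
  proof (rule that)
    fix r assume r: "s \<le> r" "r \<le> t"
    then have "0 < r" using st by simp
    then have leaf: "leaf r x \<in> closed_annulus s t" for x using r by (rule leaf_in_closed_annulus)
    have "has_degree r (\<lambda>z. monomial q z * exp (g z)) (q + 0)"
      by (rule has_degree_mult[OF has_degree_monomial has_degree_exp[OF W g(1)]]) (use \<open>0 < r\<close>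
          leaf in auto)
    then have "has_degree r f (q + 0)"
      by (rule has_degree_cong) (simp add: g(2) leaf)
    then show "has_degree r f q" by simp
  qed
qed

text \<open>Degree \<open>0\<close> on one bounding circle, where \<open>f\<close> is close to a constant, spreads over the
  annulus.\<close>

lemma degree_zero_criterion:
  assumes R: "0 < s" "s \<le> t" and r: "r \<in> {s, t}"
    and a: "\<And>x. x \<in> {s..t} \<Longrightarrow> (\<lambda>q. norm (a q) * x powr of_rat q) summable_on UNIV"
    and f: "\<And>z. z \<in> closed_annulus s t \<Longrightarrow> f z = (\<Sum>\<^sub>\<infinity>q. a q * monomial q z)"
    and nz: "\<And>z. z \<in> closed_annulus s t \<Longrightarrow> f z \<noteq> 0"
    and c: "c \<noteq> 0" and close: "\<And>x. norm (f (leaf r x) - c) \<le> norm c / 2"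
    and r': "r' \<in> {s..t}"
  shows "has_degree r' f 0"
proof -
  have r0: "0 < r" "s \<le> r" "r \<le> t" using R r by auto
  obtain M where M: "annulus_norm_at_most UNIV s t f M"
    using annulus_norm_at_most_series[OF R a a f] R by auto
  obtain q where q: "\<And>r. s \<le> r \<Longrightarrow> r \<le> t \<Longrightarrow> has_degree r f q"
    using degree_constant_on_annulus[OF R M nz] by blast
  interpret C: weighted_monomials UNIV "annulus_weight s t" "closed_annulus s t"
    by (rule weighted_monomials_annulus) (use R in auto)
  have "C.summable_coeffs a"
    using summable_annulus_weight[OF a a, of s t] R by (simp add: C.summable_coeffs_def)
  then have "continuous_on UNIV (\<lambda>x. \<Sum>\<^sub>\<infinity>q. a q * monomial q (leaf r x))"
    by (rule series_continuous_on_leaf[OF C.weighted_monomials_axioms]) (use r0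
        leaf_in_closed_annulus in auto)
  then have "continuous_on UNIV (\<lambda>x. f (leaf r x))"
    by (simp add: f leaf_in_closed_annulus r0)
  then have "has_degree r f 0"
    by (rule has_degree_near_const[where \<kappa> = "1 / 2"]) (use c close in auto)
  then have "q = 0"
    using q[OF r0(2,3)] has_degree_unique by blast
  then show ?thesis using q[of r'] r' by simp
qed

text \<open>Near \<^term>\<open>zero_point\<close> the function is close to its value \<open>a\<^sub>0\<close> there, which is not \<open>0\<close>.\<close>

lemma disc_plus_degree:
  assumes R: "1 < R" and hol: "holomorphic_disc_plus R f" and nz: "\<And>z. z \<in> disc_plus R \<Longrightarrow> f z \<noteq> 0"
  shows "has_degree 1 f 0"
proof -
  obtain a where a0: "\<And>q. q \<notin> {0..} \<Longrightarrow> a q = 0"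
    and aS: "\<And>z. z \<in> disc_plus R \<Longrightarrow> (\<lambda>q. norm (a q * monomial q z)) summable_on UNIV"
    and f: "\<And>z. z \<in> disc_plus R \<Longrightarrow> f z = (\<Sum>\<^sub>\<infinity>q. a q * monomial q z)"
    using holomorphic_series_onE[OF hol[unfolded holomorphic_disc_plus_def]] by blast
  have a: "(\<lambda>q. norm (a q) * x powr of_rat q) summable_on UNIV" if "0 < x" "x \<le> 1" for x
  proof (rule summable_at_modulus[OF aS that(1)])
    have "ereal x \<le> 1" using that by simp
    then have "ereal x < R" using R by (rule le_less_trans)
    then show "leaf x 0 \<in> disc_plus R"
      using that by (simp add: disc_plus_def leaf_in_line modulus_leaf)
  qed
  interpret P: weighted_monomials "{0..}" "\<lambda>_. 1" "{z \<in> topspace adelic_line. modulus z \<le> 1}"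
    by (rule weighted_monomials_unit_disc_plus)
  have aP: "P.summable_coeffs a"
    using a[of 1] a0 by (simp add: P.summable_coeffs_def)
  have zero: "zero_point \<in> disc_plus R"
    using less_trans[of 0 1 R] R by (simp add: disc_plus_def)
  have "f zero_point = (\<Sum>\<^sub>\<infinity>q\<in>{0}. a q * monomial q zero_point)"
    unfolding f[OF zero] by (rule infsum_cong_neutral) (auto simp: monomial_at_special)
  then have "f zero_point = a 0" by simp
  then have c: "a 0 \<noteq> 0" using nz[OF zero] by simp
  then have "norm (a 0) / 4 > 0" by simp
  from P.series_tail[OF aP this, of "{0}"] obtain F where F: "finite F" "0 \<in> F" "F \<subseteq> {0..}"
    "P.norm_at_most (\<lambda>z. (\<Sum>\<^sub>\<infinity>q. a q * monomial q z) - (\<Sum>q\<in>F. a q * monomial q z)) (norm (a 0) / 4)"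
    by auto
  \<comment> \<open>The remainder of the partial sum over \<open>F\<close> is small on the whole unit disc; the finitely
    many terms with positive exponent become small on a small circle.\<close>
  have "((\<lambda>s. \<Sum>q\<in>F - {0}. norm (a q) * s powr of_rat q) \<longlongrightarrow> (\<Sum>q\<in>F - {0}. norm (a q) * 0)) (at_right
      0)"
  proof (intro tendsto_sum tendsto_mult_left)
    fix q assume "q \<in> F - {0}"
    then have "0 < q" using F(3) by force
    then show "((\<lambda>s::real. s powr of_rat q) \<longlongrightarrow> 0) (at_right 0)"
      by (intro tendsto_zero_powrI[where b = "of_rat q"] tendsto_intros)
         (auto intro: eventually_at_rightI[of 0 1])
  qed
  then have "\<forall>\<^sub>F s in at_right 0. (\<Sum>q\<in>F - {0}. norm (a q) * s powr of_rat q) < norm (a 0) / 4"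
    using c by (intro order_tendstoD(2)[of _ 0]) auto
  moreover have "\<forall>\<^sub>F s::real in at_right 0. s \<in> {0<..<1}"
    by (rule eventually_at_rightI[of 0 1]) auto
  ultimately have "\<forall>\<^sub>F s in at_right 0. (\<Sum>q\<in>F - {0}. norm (a q) * s powr of_rat q) < norm (a 0) /
      4 \<and> s \<in> {0<..<1}"
    by (rule eventually_conj)
  then obtain s where s: "(\<Sum>q\<in>F - {0}. norm (a q) * s powr of_rat q) < norm (a 0) / 4" "0 < s"
      "s < 1"
    using eventually_happens[of _ "at_right (0::real)"] by auto
  have sub: "z \<in> disc_plus R" if "z \<in> closed_annulus s 1" for z
    using that R by (auto simp: closed_annulus_def disc_plus_def one_ereal_def intro: le_less_trans)
  show ?thesis
  proof (rule degree_zero_criterion[where r = s and a = a and c = "a 0"])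
    show "(\<lambda>q. norm (a q) * x powr of_rat q) summable_on UNIV" if "x \<in> {s..1}" for x
      using a that s(2) by auto
    fix x
    have L: "leaf s x \<in> closed_annulus s 1" using s by (intro leaf_in_closed_annulus) auto
    have "norm ((\<Sum>\<^sub>\<infinity>q. a q * monomial q (leaf s x)) - (\<Sum>q\<in>F. a q * monomial q (leaf s x))) \<le> norm
        (a 0) / 4"
      by (rule P.norm_at_most_bound[OF F(4)]) (use s in \<open>simp add: leaf_in_line modulus_leaf\<close>)
    moreover have "(\<Sum>q\<in>F. a q * monomial q (leaf s x)) =
        a 0 + (\<Sum>q\<in>F - {0}. a q * monomial q (leaf s x))"
      using F(1,2) s by (subst sum.remove[of F 0]) (auto simp: leaf_in_line)
    moreover have "norm (\<Sum>q\<in>F - {0}. a q * monomial q (leaf s x)) \<le> (\<Sum>q\<in>F - {0}. norm (a q) * s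
        powr of_rat q)"
      using s by (intro sum_norm_le) (simp add: monomial_leaf norm_mult)
    ultimately have "norm ((\<Sum>\<^sub>\<infinity>q. a q * monomial q (leaf s x)) - (a 0 + (\<Sum>q\<in>F - {0}. a q *
        monomial q (leaf s x)))) \<le> norm (a 0) / 4"
      "norm (\<Sum>q\<in>F - {0}. a q * monomial q (leaf s x)) \<le> norm (a 0) / 4"
      using s(1) by auto
    then show "norm (f (leaf s x) - a 0) \<le> norm (a 0) / 2"
      unfolding f[OF sub[OF L]] by norm
  qed (use s f sub nz c in auto)
qed

text \<open>The mirror image at \<^term>\<open>infinity_point\<close>, on circles of large radius.\<close>

lemma disc_minus_degree:
  assumes R: "0 \<le> R" "R < 1" and hol: "holomorphic_disc_minus R f" and nz: "\<And>z. z \<in> disc_minus R \<Longrightarrow>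
      f z \<noteq> 0"
  shows "has_degree 1 f 0"
proof -
  obtain a where a0: "\<And>q. q \<notin> {..0} \<Longrightarrow> a q = 0"
    and aS: "\<And>z. z \<in> disc_minus R \<Longrightarrow> (\<lambda>q. norm (a q * monomial q z)) summable_on UNIV"
    and f: "\<And>z. z \<in> disc_minus R \<Longrightarrow> f z = (\<Sum>\<^sub>\<infinity>q. a q * monomial q z)"
    using holomorphic_series_onE[OF hol[unfolded holomorphic_disc_minus_def]] by blast
  have a: "(\<lambda>q. norm (a q) * x powr of_rat q) summable_on UNIV" if "1 \<le> x" for x
  proof (rule summable_at_modulus[OF aS])
    have "1 \<le> ereal x" using that by simp
    with R(2) have "R < ereal x" by (rule less_le_trans)
    then show "leaf x 0 \<in> disc_minus R"
      using that by (simp add: disc_minus_def leaf_in_line modulus_leaf)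
  qed (use that in auto)
  interpret P: weighted_monomials "{..0}" "\<lambda>_. 1" "{z \<in> topspace adelic_line. 1 \<le> modulus z}"
    by (rule weighted_monomials_unit_disc_minus)
  have aP: "P.summable_coeffs a"
    using a[of 1] a0 by (simp add: P.summable_coeffs_def)
  have inf: "infinity_point \<in> disc_minus R"
    using R by (auto simp: disc_minus_def)
  have "f infinity_point = (\<Sum>\<^sub>\<infinity>q\<in>{0}. a q * monomial q infinity_point)"
    unfolding f[OF inf] by (rule infsum_cong_neutral) (auto simp: monomial_at_special)
  then have "f infinity_point = a 0" by simp
  then have c: "a 0 \<noteq> 0" using nz[OF inf] by simp
  then have "norm (a 0) / 4 > 0" by simp
  from P.series_tail[OF aP this, of "{0}"] obtain F where F: "finite F" "0 \<in> F" "F \<subseteq> {..0}"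
    "P.norm_at_most (\<lambda>z. (\<Sum>\<^sub>\<infinity>q. a q * monomial q z) - (\<Sum>q\<in>F. a q * monomial q z)) (norm (a 0) / 4)"
    by auto
  have "((\<lambda>s. \<Sum>q\<in>F - {0}. norm (a q) * s powr of_rat q) \<longlongrightarrow> (\<Sum>q\<in>F - {0}. norm (a q) * 0)) at_top"
  proof (intro tendsto_sum tendsto_mult_left)
    fix q assume "q \<in> F - {0}"
    then have "q < 0" using F(3) by force
    then show "((\<lambda>s::real. s powr of_rat q) \<longlongrightarrow> 0) at_top"
      by (intro tendsto_neg_powr filterlim_ident) simp
  qed
  then have "\<forall>\<^sub>F s in at_top. (\<Sum>q\<in>F - {0}. norm (a q) * s powr of_rat q) < norm (a 0) / 4"
    using c by (intro order_tendstoD(2)[of _ 0]) auto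
  from eventually_happens[OF eventually_conj[OF this eventually_gt_at_top[of 1]]]
  obtain s where s: "(\<Sum>q\<in>F - {0}. norm (a q) * s powr of_rat q) < norm (a 0) / 4" "1 < s"
    by auto
  have sub: "z \<in> disc_minus R" if "z \<in> closed_annulus 1 s" for z
    using that R by (auto simp: closed_annulus_def disc_minus_def one_ereal_def intro:
        less_le_trans)
  show ?thesis
  proof (rule degree_zero_criterion[where r = s and a = a and c = "a 0"])
    show "(\<lambda>q. norm (a q) * x powr of_rat q) summable_on UNIV" if "x \<in> {1..s}" for x
      using a that by auto
    fix x
    have L: "leaf s x \<in> closed_annulus 1 s" using s by (intro leaf_in_closed_annulus) auto
    have "norm ((\<Sum>\<^sub>\<infinity>q. a q * monomial q (leaf s x)) - (\<Sum>q\<in>F. a q * monomial q (leaf s x))) \<le> norm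
        (a 0) / 4"
      by (rule P.norm_at_most_bound[OF F(4)]) (use s in \<open>simp add: leaf_in_line modulus_leaf\<close>)
    moreover have "(\<Sum>q\<in>F. a q * monomial q (leaf s x)) =
        a 0 + (\<Sum>q\<in>F - {0}. a q * monomial q (leaf s x))"
      using F(1,2) s by (subst sum.remove[of F 0]) (auto simp: leaf_in_line)
    moreover have "norm (\<Sum>q\<in>F - {0}. a q * monomial q (leaf s x)) \<le> (\<Sum>q\<in>F - {0}. norm (a q) * s
        powr of_rat q)"
      using s by (intro sum_norm_le) (simp add: monomial_leaf norm_mult)
    ultimately have "norm ((\<Sum>\<^sub>\<infinity>q. a q * monomial q (leaf s x)) - (a 0 + (\<Sum>q\<in>F - {0}. a q *
        monomial q (leaf s x)))) \<le> norm (a 0) / 4"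
      "norm (\<Sum>q\<in>F - {0}. a q * monomial q (leaf s x)) \<le> norm (a 0) / 4"
      using s(1) by auto
    then show "norm (f (leaf s x) - a 0) \<le> norm (a 0) / 2"
      unfolding f[OF sub[OF L]] by norm
  qed (use s f sub nz c in auto)
qed

lemma holomorphic_cocycle_series:
  assumes "holomorphic_cocycle r R f"
  obtains a where "\<And>t. r < ereal t \<Longrightarrow> ereal t < R \<Longrightarrow> (\<lambda>q. norm (a q) * t powr of_rat q) summable_on
      UNIV"
    "\<And>z. z \<in> annulus r R \<Longrightarrow> f z = (\<Sum>\<^sub>\<infinity>q. a q * monomial q z)"
proof -
  have r: "0 \<le> r" and hol: "holomorphic_series_on UNIV (annulus r R) f"
    using assms by (auto simp: holomorphic_cocycle_def holomorphic_annulus_def)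
  obtain a where a: "\<And>z. z \<in> annulus r R \<Longrightarrow> (\<lambda>q. norm (a q * monomial q z)) summable_on UNIV"
    "\<And>z. z \<in> annulus r R \<Longrightarrow> f z = (\<Sum>\<^sub>\<infinity>q. a q * monomial q z)"
    using holomorphic_series_onE[OF hol] by metis
  show thesis
  proof (rule that[OF _ a(2)])
    fix t assume t: "r < ereal t" "ereal t < R"
    then have t0: "0 < t" using r by (metis ereal_less(2) le_less_trans)
    then have "leaf t 0 \<in> annulus r R" using t by (simp add: annulus_def leaf_in_line modulus_leaf)
    with a(1) t0 show "(\<lambda>q. norm (a q) * t powr of_rat q) summable_on UNIV"
      by (rule summable_at_modulus)
  qed
qed

lemma closed_annulus_subset_annulus:
  "r < ereal s \<Longrightarrow> ereal t < R \<Longrightarrow> closed_annulus s t \<subseteq> annulus r R"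
  by (auto simp: closed_annulus_def annulus_def intro: less_le_trans le_less_trans)

lemma cocycle_annulus_norm:
  assumes "holomorphic_cocycle r R f" "r < ereal s" "s \<le> t" "ereal t < R"
  obtains M where "annulus_norm_at_most UNIV s t f M"
proof -
  have s0: "0 < s" using assms(1,2) by (auto simp: holomorphic_cocycle_def) (metis ereal_less(2)
      le_less_trans)
  obtain a where a: "\<And>t. r < ereal t \<Longrightarrow> ereal t < R \<Longrightarrow>
      (\<lambda>q. norm (a q) * t powr of_rat q) summable_on UNIV"
    "\<And>z. z \<in> annulus r R \<Longrightarrow> f z = (\<Sum>\<^sub>\<infinity>q. a q * monomial q z)"
    using holomorphic_cocycle_series[OF assms(1)] by blast
  have "ereal s \<le> ereal t" using assms(3) by simp
  then have "ereal s < R" "r < ereal t"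
    by (rule le_less_trans[OF _ assms(4)], rule less_le_trans[OF assms(2)])
  then show thesis
    using annulus_norm_at_most_series[OF s0 assms(3) a(1) a(1), of f] a(2)
      closed_annulus_subset_annulus[OF assms(2,4)] assms(2,4) that by blast
qed

text \<open>Compare degrees on the unit circle in \<open>f\<^sub>1 f = z\<^sup>q f\<^sub>2\<close>, where \<open>f\<^sub>1\<close> and \<open>f\<^sub>2\<close> have degree
  \<open>0\<close>.\<close>

lemma equivalence_determines_degree:
  assumes f: "holomorphic_cocycle r R f" and eq: "equivalent_cocycles r R f 0 \<infinity> f'"
    and f': "\<And>z. z \<in> annulus 0 \<infinity> \<Longrightarrow> f' z = monomial q z"
  shows "has_degree 1 f q"
proof -
  have rR: "0 \<le> r" "r < 1" "1 < R" and nz: "\<And>z. z \<in> annulus r R \<Longrightarrow> f z \<noteq> 0"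
    using f by (auto simp: holomorphic_cocycle_def)
  then have "max r 0 = r" "min R \<infinity> = R" by (auto simp: max_def min_def)
  with eq obtain f1 f2 where F:
    "holomorphic_disc_minus r f1" "\<And>z. z \<in> disc_minus r \<Longrightarrow> f1 z \<noteq> 0"
    "holomorphic_disc_plus R f2" "\<And>z. z \<in> disc_plus R \<Longrightarrow> f2 z \<noteq> 0"
    "\<And>z. z \<in> annulus r R \<Longrightarrow> f1 z * f z * inverse (f2 z) = f' z"
    unfolding equivalent_cocycles_def by auto
  have one: "r < ereal 1" "ereal 1 < R" using rR by (simp_all add: one_ereal_def)
  obtain M where M: "annulus_norm_at_most UNIV 1 1 f M"
    using cocycle_annulus_norm[OF f one(1) _ one(2)] by auto
  obtain p where p: "has_degree 1 f p"
    using degree_constant_on_annulus[OF _ _ M] nz closed_annulus_subset_annulus[OF one]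
    by (metis order_refl subsetD zero_less_one)
  have leaf: "leaf 1 x \<in> annulus r R" "leaf 1 x \<in> annulus 0 \<infinity>" "leaf 1 x \<in> disc_plus R" for x
    using one by (auto simp: annulus_def disc_plus_def leaf_in_line modulus_leaf)
  have "has_degree 1 (\<lambda>z. f1 z * f z) (0 + p)"
    by (rule has_degree_mult[OF disc_minus_degree[OF rR(1,2) F(1,2)] p])
  moreover have "has_degree 1 (\<lambda>z. monomial q z * f2 z) (q + 0)"
    by (rule has_degree_mult[OF has_degree_monomial disc_plus_degree[OF rR(3) F(3,4)]]) simp
  then have "has_degree 1 (\<lambda>z. f1 z * f z) (q + 0)"
  proof (rule has_degree_cong)
    show "f1 (leaf 1 x) * f (leaf 1 x) = monomial q (leaf 1 x) * f2 (leaf 1 x)" for x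
      using F(5)[OF leaf(1), of x] f'[OF leaf(2), of x] F(4)[OF leaf(3), of x] by (simp add:
          field_simps)
  qed
  ultimately have "p = q" using has_degree_unique by fastforce
  with p show ?thesis by simp
qed

section \<open>Factorization of cocycles\<close>

text \<open>If a series \<open>\<Sum> b\<^sub>q z\<^sup>q\<close> agrees on the unit circle with a function that has an expansion on a
  larger annulus, both have the same coefficients, so the series converges to the function on the
  larger annulus.\<close>

lemma coefficients_extend:
  assumes "0 < s" "s \<le> 1" "1 \<le> t" and H: "annulus_norm_at_most UNIV s t H M"
    and b: "(\<lambda>q. norm (b q)) summable_on UNIV"
    and eq: "\<And>x. H (leaf 1 x) = (\<Sum>\<^sub>\<infinity>q. b q * monomial q (leaf 1 x))"
  shows "r \<in> {s, t} \<Longrightarrow> (\<lambda>q. norm (b q) * r powr of_rat q) summable_on UNIV"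
    and "z \<in> closed_annulus s t \<Longrightarrow> H z = (\<Sum>\<^sub>\<infinity>q. b q * monomial q z)"
proof -
  interpret K: weighted_monomials UNIV "annulus_weight s t" "closed_annulus s t"
    by (rule weighted_monomials_annulus) (use assms in auto)
  obtain h where h: "K.summable_coeffs h" "\<And>z. z \<in> closed_annulus s t \<Longrightarrow> H z =
      (\<Sum>\<^sub>\<infinity>q. h q * monomial q z)"
    using H by (auto simp: K.norm_at_most_def)
  have S: "(\<lambda>q. norm (h q) * r powr of_rat q) summable_on UNIV" if "s \<le> r" "r \<le> t" for r
  proof (rule summable_on_comparison_test)
    show "(\<lambda>q. norm (h q) * annulus_weight s t q) summable_on UNIV"
      using h(1) by (simp add: K.summable_coeffs_def)
    show "norm (h q) * r powr of_rat q \<le> norm (h q) * annulus_weight s t q" for q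
      by (rule mult_left_mono[OF powr_le_max]) (use that assms(1) in auto)
  qed simp
  have "h = b"
  proof (rule coefficients_unique[of 1])
    show "(\<lambda>q. norm (h q) * 1 powr of_rat q) summable_on UNIV"
      using assms by (intro S) auto
    show "(\<Sum>\<^sub>\<infinity>q. h q * monomial q (leaf 1 x)) = (\<Sum>\<^sub>\<infinity>q. b q * monomial q (leaf 1 x))" for x
      using h(2)[of "leaf 1 x"] eq[of x] assms(2,3) by (simp add: leaf_in_closed_annulus)
  qed (use b in auto)
  then show "r \<in> {s, t} \<Longrightarrow> (\<lambda>q. norm (b q) * r powr of_rat q) summable_on UNIV"
    and "z \<in> closed_annulus s t \<Longrightarrow> H z = (\<Sum>\<^sub>\<infinity>q. b q * monomial q z)"
    using S h(2) assms(2,3) by auto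
qed

text \<open>Splitting the exponent \<open>g\<close> in \<open>f = z\<^sup>q exp g\<close> by the sign of the exponents. The minus sign
  of the negative part is included in \<^term>\<open>G1\<close>, so \<open>g = G\<^sub>2 - G\<^sub>1\<close>. Both parts converge on a whole
  closed unit disc, and so do their exponentials.\<close>

lemma circle_factorization:
  assumes f: "annulus_norm_at_most UNIV 1 1 f M"
    and nz: "\<And>z. z \<in> closed_annulus 1 1 \<Longrightarrow> f z \<noteq> 0"
  obtains q G1 G2 a1 a2 where
    "\<And>q. 0 < q \<Longrightarrow> a1 q = 0" "(\<lambda>q. norm (a1 q)) summable_on UNIV"
    "\<And>z. z \<in> topspace adelic_line \<Longrightarrow> 1 \<le> modulus z \<Longrightarrow> (\<Sum>\<^sub>\<infinity>q. a1 q * monomial q z) = exp (G1 z)"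
    "\<And>q. q < 0 \<Longrightarrow> a2 q = 0" "(\<lambda>q. norm (a2 q)) summable_on UNIV"
    "\<And>z. z \<in> topspace adelic_line \<Longrightarrow> modulus z \<le> 1 \<Longrightarrow> (\<Sum>\<^sub>\<infinity>q. a2 q * monomial q z) = exp (G2 z)"
    "\<And>z. z \<in> closed_annulus 1 1 \<Longrightarrow> exp (G1 z) * f z = exp (G2 z) * monomial q z"
proof -
  interpret C: weighted_monomials UNIV "annulus_weight 1 1" "closed_annulus 1 1"
    by (rule weighted_monomials_annulus) auto
  interpret M: weighted_monomials "{..0}" "\<lambda>_. 1" "{z \<in> topspace adelic_line. 1 \<le> modulus z}"
    by (rule weighted_monomials_unit_disc_minus)
  interpret P: weighted_monomials "{0..}" "\<lambda>_. 1" "{z \<in> topspace adelic_line. modulus z \<le> 1}"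
    by (rule weighted_monomials_unit_disc_plus)
  obtain q g N where g: "C.norm_at_most g N"
    "\<forall>z\<in>closed_annulus 1 1. f z = monomial q z * exp (g z)"
    using nonvanishing_series_exp[OF zero_less_one order_refl f nz] by blast
  obtain c where c: "C.summable_coeffs c" "\<And>z. z \<in> closed_annulus 1 1 \<Longrightarrow> g z =
      (\<Sum>\<^sub>\<infinity>q. c q * monomial q z)"
    using g(1) unfolding C.norm_at_most_def by blast
  have cS: "(\<lambda>q. norm (c q)) summable_on UNIV"
    using c(1) unfolding C.summable_coeffs_def by simp
  define c1 where "c1 q = (if q < 0 then - c q else 0)" for q
  define c2 where "c2 q = (if 0 \<le> q then c q else 0)" for q
  define G1 where "G1 z = (\<Sum>\<^sub>\<infinity>q. c1 q * monomial q z)" for z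
  define G2 where "G2 z = (\<Sum>\<^sub>\<infinity>q. c2 q * monomial q z)" for z
  have c12: "M.summable_coeffs c1" "P.summable_coeffs c2"
    unfolding M.summable_coeffs_def P.summable_coeffs_def
    by (auto simp: c1_def c2_def intro!: summable_on_comparison_test[OF cS])
  have "M.norm_at_most G1 (\<Sum>\<^sub>\<infinity>q. norm (c1 q) * 1)"
    unfolding M.norm_at_most_def using c12 G1_def by blast
  from M.norm_at_most_exp[OF this] obtain a1 where a1: "M.summable_coeffs a1"
    "\<And>z. z \<in> topspace adelic_line \<Longrightarrow> 1 \<le> modulus z \<Longrightarrow> exp (G1 z) = (\<Sum>\<^sub>\<infinity>q. a1 q * monomial q z)"
    unfolding M.norm_at_most_def by blast
  have "P.norm_at_most G2 (\<Sum>\<^sub>\<infinity>q. norm (c2 q) * 1)"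
    unfolding P.norm_at_most_def using c12 G2_def by blast
  from P.norm_at_most_exp[OF this] obtain a2 where a2: "P.summable_coeffs a2"
    "\<And>z. z \<in> topspace adelic_line \<Longrightarrow> modulus z \<le> 1 \<Longrightarrow> exp (G2 z) = (\<Sum>\<^sub>\<infinity>q. a2 q * monomial q z)"
    unfolding P.norm_at_most_def by blast
  have G: "g z = G2 z - G1 z" if z: "z \<in> closed_annulus 1 1" for z
  proof -
    have z1: "z \<in> {z \<in> topspace adelic_line. 1 \<le> modulus z}"
        "z \<in> {z \<in> topspace adelic_line. modulus z \<le> 1}"
      using z by (auto simp: closed_annulus_def one_ereal_def)
    have "((\<lambda>q. c2 q * monomial q z + - (c1 q * monomial q z)) has_sum (G2 z + - G1 z)) UNIV"
      unfolding G1_def G2_def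
      by (intro has_sum_add has_sum_uminusI M.series_has_sum P.series_has_sum c12 z1)
    moreover have "c2 q * monomial q z + - (c1 q * monomial q z) = c q * monomial q z" for q
      by (simp add: c1_def c2_def)
    ultimately have "((\<lambda>q. c q * monomial q z) has_sum (G2 z - G1 z)) UNIV"
      by simp
    then show ?thesis using c(2)[OF z] by (simp add: infsumI)
  qed
  show thesis
  proof (rule that[of a1 G1 a2 G2 q])
    show "exp (G1 z) * f z = exp (G2 z) * monomial q z" if "z \<in> closed_annulus 1 1" for z
      using bspec[OF g(2) that] G[OF that] by (simp add: exp_diff)
  qed (use a1 a2 in \<open>auto simp: M.summable_coeffs_def P.summable_coeffs_def one_ereal_def\<close>)
qed

text \<open>The factorization on the unit circle holds on the whole annulus: the relation between the
  two factors expresses each of them, on the side where its series is not yet known to converge,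
  by series that converge there.\<close>

lemma cocycle_equivalent_monomial:
  assumes f: "holomorphic_cocycle r R f"
  obtains q where "equivalent_cocycles r R f 0 \<infinity> (monomial q)"
proof -
  have rR: "0 \<le> r" "r < 1" "1 < R" and nz: "\<And>z. z \<in> annulus r R \<Longrightarrow> f z \<noteq> 0"
    using f by (auto simp: holomorphic_cocycle_def)
  have one: "r < ereal 1" "ereal 1 < R" using rR by (simp_all add: one_ereal_def)
  have nz1: "f z \<noteq> 0" if "z \<in> closed_annulus 1 1" for z
    using that nz closed_annulus_subset_annulus[OF one] by blast
  obtain M1 where M1: "annulus_norm_at_most UNIV 1 1 f M1"
    using cocycle_annulus_norm[OF f one(1) _ one(2)] by auto
  obtain q G1 G2 a1 a2 where
    a1: "\<And>q. 0 < q \<Longrightarrow> a1 q = 0" "(\<lambda>q. norm (a1 q)) summable_on UNIV"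
    "\<And>z. z \<in> topspace adelic_line \<Longrightarrow> 1 \<le> modulus z \<Longrightarrow> (\<Sum>\<^sub>\<infinity>q. a1 q * monomial q z) = exp (G1 z)" and
    a2: "\<And>q. q < 0 \<Longrightarrow> a2 q = 0" "(\<lambda>q. norm (a2 q)) summable_on UNIV"
    "\<And>z. z \<in> topspace adelic_line \<Longrightarrow> modulus z \<le> 1 \<Longrightarrow> (\<Sum>\<^sub>\<infinity>q. a2 q * monomial q z) = exp (G2 z)" and
    G: "\<And>z. z \<in> closed_annulus 1 1 \<Longrightarrow> exp (G1 z) * f z = exp (G2 z) * monomial q z"
    by (rule circle_factorization[OF M1 nz1]) blast+
  define F1 where "F1 z = (\<Sum>\<^sub>\<infinity>q. a1 q * monomial q z)" for z
  define F2 where "F2 z = (\<Sum>\<^sub>\<infinity>q. a2 q * monomial q z)" for z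
  have mono_inv: "monomial q z * monomial (- q) z = 1" if "z \<in> closed_annulus s t" "0 < s"
      for z s t q
  proof -
    have "z \<in> topspace adelic_line" using that by (simp add: closed_annulus_def)
    then show ?thesis
      using that monomial_add_polar[of _ _ q "- q"] monomial_zero[OF polar_in_adelic_line]
      by (auto simp: closed_annulus_iff)
  qed
  interpret M: weighted_monomials "{..0}" "\<lambda>_. 1" "{z \<in> topspace adelic_line. 1 \<le> modulus z}"
    by (rule weighted_monomials_unit_disc_minus)
  interpret P: weighted_monomials "{0..}" "\<lambda>_. 1" "{z \<in> topspace adelic_line. modulus z \<le> 1}"
    by (rule weighted_monomials_unit_disc_plus)
  have "M.summable_coeffs a1" "P.summable_coeffs a2"
    using a1(1,2) a2(1,2) by (auto simp: M.summable_coeffs_def P.summable_coeffs_def)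
  then obtain N1 N2 where N: "M.norm_at_most F1 N1" "P.norm_at_most F2 N2"
    unfolding M.norm_at_most_def P.norm_at_most_def F1_def F2_def by blast

  \<comment> \<open>Extend \<open>F2\<close> to modulus at least \<open>1\<close> by \<open>F1 f z\<^sup>-\<^sup>q\<close>.\<close>
  have outer: "(\<lambda>q. norm (a2 q) * t powr of_rat q) summable_on UNIV"
    "\<And>z. z \<in> closed_annulus 1 t \<Longrightarrow> F2 z = F1 z * f z * monomial (- q) z"
    if t: "1 \<le> t" "ereal t < R" for t
  proof -
    interpret K: weighted_monomials UNIV "annulus_weight 1 t" "closed_annulus 1 t"
      by (rule weighted_monomials_annulus) (use t in auto)
    have F1: "K.norm_at_most F1 N1"
    proof (rule norm_at_most_mono[OF M.weighted_monomials_axioms K.weighted_monomials_axioms _ _ _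
        N(1)])
      show "annulus_weight 1 t q \<le> 1" if "q \<in> {..0}" for q
        using that t powr_mono2'[of "of_rat q" 1 t] by simp
    qed (auto simp: closed_annulus_def one_ereal_def)
    obtain N' where "K.norm_at_most f N'"
      using cocycle_annulus_norm[OF f one(1) t] by blast
    from K.norm_at_most_mult[OF K.norm_at_most_mult[OF F1 this] K.norm_at_most_monomial[of "- q" 1]]
    obtain M where H: "K.norm_at_most (\<lambda>z. F1 z * f z * (1 * monomial (- q) z)) M" by auto
    have "F1 (leaf 1 x) * f (leaf 1 x) * (1 * monomial (- q) (leaf 1 x)) =
        (\<Sum>\<^sub>\<infinity>q. a2 q * monomial q (leaf 1 x))" for x
    proof -
      have L: "leaf 1 x \<in> closed_annulus 1 1" by (rule leaf_in_closed_annulus) auto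
      have "F1 (leaf 1 x) = exp (G1 (leaf 1 x))" "(\<Sum>\<^sub>\<infinity>q. a2 q * monomial q (leaf 1 x)) =
          exp (G2 (leaf 1 x))"
        unfolding F1_def by (rule a1(3) a2(3); use L in \<open>simp add: closed_annulus_def
            one_ereal_def\<close>)+
      then show ?thesis using G[OF L] mono_inv[OF L, of q] by simp
    qed
    from coefficients_extend[OF _ _ t(1) H a2(2) this]
    show "(\<lambda>q. norm (a2 q) * t powr of_rat q) summable_on UNIV"
      "\<And>z. z \<in> closed_annulus 1 t \<Longrightarrow> F2 z = F1 z * f z * monomial (- q) z"
      by (auto simp: F2_def)
  qed
  \<comment> \<open>Extend \<open>F1\<close> to modulus at most \<open>1\<close> by \<open>F2 z\<^sup>q / f\<close>, where \<open>1 / f\<close> is the series \<open>J\<close>.\<close>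
  have inner: "(\<lambda>q. norm (a1 q) * s powr of_rat q) summable_on UNIV"
    "\<And>z. z \<in> closed_annulus s 1 \<Longrightarrow> F1 z * f z = F2 z * monomial q z"
    if s: "s \<le> 1" "r < ereal s" for s
  proof -
    have s0: "0 < s" using rR(1) s(2) by (metis ereal_less(2) le_less_trans)
    interpret K: weighted_monomials UNIV "annulus_weight s 1" "closed_annulus s 1"
      by (rule weighted_monomials_annulus) (use s s0 in auto)
    have F2: "K.norm_at_most F2 N2"
    proof (rule norm_at_most_mono[OF P.weighted_monomials_axioms K.weighted_monomials_axioms _ _ _
        N(2)])
      show "annulus_weight s 1 q \<le> 1" if "q \<in> {0..}" for q
        using that s s0 powr_mono2[of "of_rat q" s 1] by simp
    qed (auto simp: closed_annulus_def one_ereal_def)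
    have nzs: "f z \<noteq> 0" if "z \<in> closed_annulus s 1" for z
      using that nz closed_annulus_subset_annulus[OF s(2) one(2)] by blast
    obtain N' where "K.norm_at_most f N'"
      using cocycle_annulus_norm[OF f s(2,1) one(2)] by blast
    from nonvanishing_series_exp[OF s0 s(1) this nzs] obtain p g N'' where
      g: "K.norm_at_most g N''" "\<forall>z\<in>closed_annulus s 1. f z = monomial p z * exp (g z)"
      by blast
    define J where "J z = 1 * monomial (- p) z * exp (- 1 * g z)" for z
    have fJ: "f z * J z = 1" if "z \<in> closed_annulus s 1" for z
    proof -
      have "f z * J z = (monomial p z * monomial (- p) z) * (exp (g z) * exp (- g z))"
        by (simp add: J_def bspec[OF g(2) that])
      then show ?thesis using mono_inv[OF that s0, of p] by (simp flip: exp_add)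
    qed
    have "K.norm_at_most (\<lambda>z. F2 z * (1 * monomial q z) * J z)
        (N2 * (norm (1::complex) * annulus_weight s 1 q) * (norm (1::complex) * annulus_weight s 1
            (- p) * exp (norm (- 1::complex) * N'')))"
      unfolding J_def
      by (intro K.norm_at_most_mult K.norm_at_most_exp K.norm_at_most_cmult
          K.norm_at_most_monomial F2 g(1) UNIV_I)
    then obtain M where H: "K.norm_at_most (\<lambda>z. F2 z * (1 * monomial q z) * J z) M" by blast
    have "F2 (leaf 1 x) * (1 * monomial q (leaf 1 x)) * J (leaf 1 x) =
        (\<Sum>\<^sub>\<infinity>q. a1 q * monomial q (leaf 1 x))" for x
    proof -
      have L: "leaf 1 x \<in> closed_annulus 1 1" "leaf 1 x \<in> closed_annulus s 1"
        by (rule leaf_in_closed_annulus; use s in simp)+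
      have "F2 (leaf 1 x) = exp (G2 (leaf 1 x))" "(\<Sum>\<^sub>\<infinity>q. a1 q * monomial q (leaf 1 x)) =
          exp (G1 (leaf 1 x))"
        unfolding F2_def by (rule a1(3) a2(3); use L(1) in \<open>simp add: closed_annulus_def
            one_ereal_def\<close>)+
      then show ?thesis using G[OF L(1)] fJ[OF L(2)] by (metis mult.assoc mult.right_neutral mult_1)
    qed
    from coefficients_extend[OF s0 s(1) order_refl H a1(2) this]
    have A: "(\<lambda>q. norm (a1 q) * s powr of_rat q) summable_on UNIV"
      and B: "\<And>z. z \<in> closed_annulus s 1 \<Longrightarrow> F1 z = F2 z * monomial q z * J z"
      by (auto simp: F1_def)
    show "(\<lambda>q. norm (a1 q) * s powr of_rat q) summable_on UNIV" by (rule A)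
    show "F1 z * f z = F2 z * monomial q z" if "z \<in> closed_annulus s 1" for z
      using B[OF that] fJ[OF that] by (metis mult.assoc mult.commute mult.right_neutral)
  qed
  have rel: "F1 z * f z = F2 z * monomial q z" and nz12: "F1 z \<noteq> 0" "F2 z \<noteq> 0"
    if z: "z \<in> annulus r R" for z
  proof -
    obtain t where t: "modulus z = ereal t" "r < ereal t" "ereal t < R"
      using z rR(1) by (cases "modulus z") (auto simp: annulus_def)
    have zl: "z \<in> topspace adelic_line" using z by (simp add: annulus_def)
    have t0: "0 < t" using rR(1) t(2) by (metis ereal_less(2) le_less_trans)
    have mnz: "monomial q z \<noteq> 0"
      using mono_inv[of z t t q] t0 t(1) zl by (auto simp: closed_annulus_def)
    have "(F1 z * f z = F2 z * monomial q z) \<and> F1 z \<noteq> 0 \<and> F2 z \<noteq> 0"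
    proof (cases "1 \<le> t")
      case True
      then have zt: "z \<in> closed_annulus 1 t" using t(1) zl by (simp add: closed_annulus_def)
      have "F1 z = exp (G1 z)"
        unfolding F1_def by (rule a1(3)[OF zl]) (use t(1) True in simp)
      moreover have "F2 z = F1 z * f z * monomial (- q) z" by (rule outer(2)[OF True t(3) zt])
      moreover have "monomial (- q) z \<noteq> 0" "monomial (- q) z * monomial q z = 1"
        using mono_inv[OF zt, of q] by (auto simp: mult.commute)
      ultimately show ?thesis using nz[OF z] by simp
    next
      case False
      then have zt: "z \<in> closed_annulus t 1" using t(1) zl by (simp add: closed_annulus_def)
      have "F2 z = exp (G2 z)"
        unfolding F2_def by (rule a2(3)[OF zl]) (use t(1) False in simp)
      moreover have "F1 z * f z = F2 z * monomial q z" using inner(2)[OF _ t(2) zt] False by simp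
      ultimately show ?thesis using mnz by auto
    qed
    then show "F1 z * f z = F2 z * monomial q z" "F1 z \<noteq> 0" "F2 z \<noteq> 0" by auto
  qed
  have m: "max r 0 = r" "min R \<infinity> = R" using rR(1) by (auto simp: max_def min_def)
  have "equivalent_cocycles r R f 0 \<infinity> (monomial q)"
    unfolding equivalent_cocycles_def m
  proof (rule exI[of _ F1], rule exI[of _ F2], intro conjI ballI)
    show "holomorphic_disc_minus r F1"
      unfolding F1_def
    proof (rule holomorphic_disc_minusI)
      fix t assume t: "0 < t" "r < ereal t"
      show "(\<lambda>q. norm (a1 q) * t powr of_rat q) summable_on UNIV"
      proof (cases "t \<le> 1")
        case True
        then show ?thesis using inner(1) t(2) by blast
      next
        case False
        show ?thesis
        proof (rule summable_on_comparison_test[OF a1(2)])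
          show "norm (a1 q) * t powr of_rat q \<le> norm (a1 q)" for q
            using a1(1)[of q] False powr_mono2'[of "of_rat q" 1 t]
            by (cases "0 < q") (auto intro: mult_left_le)
        qed simp
      qed
    qed (use rR(1) a1(1) in auto)
    show "holomorphic_disc_plus R F2"
      unfolding F2_def
    proof (rule holomorphic_disc_plusI)
      show "0 < R" using less_trans[of 0 1 R] rR(3) by simp
      fix t assume t: "0 < t" "ereal t < R"
      show "(\<lambda>q. norm (a2 q) * t powr of_rat q) summable_on UNIV"
      proof (cases "1 \<le> t")
        case True
        then show ?thesis using outer(1) t(2) by blast
      next
        case False
        show ?thesis
        proof (rule summable_on_comparison_test[OF a2(2)])
          show "norm (a2 q) * t powr of_rat q \<le> norm (a2 q)" for q
            using a2(1)[of q] False t(1) powr_mono2[of "of_rat q" t 1]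
            by (cases "q < 0") (auto intro: mult_left_le)
        qed simp
      qed
    qed (use a2(1) in auto)
    fix z
    show "F1 z \<noteq> 0" if z: "z \<in> disc_minus r"
    proof (cases "modulus z < R")
      case True
      then show ?thesis using z nz12(1) by (auto simp: annulus_def disc_minus_def)
    next
      case False
      then have "1 \<le> modulus z" using rR(3) by auto
      then show ?thesis using a1(3)[of z] z by (auto simp: F1_def disc_minus_def)
    qed
    show "F2 z \<noteq> 0" if z: "z \<in> disc_plus R"
    proof (cases "r < modulus z")
      case True
      then show ?thesis using z nz12(2) by (auto simp: annulus_def disc_plus_def)
    next
      case False
      then have "modulus z \<le> 1" using rR(2) by auto
      then show ?thesis using a2(3)[of z] z by (auto simp: F2_def disc_plus_def)
    qed
    show "F1 z * f z * inverse (F2 z) = monomial q z" if "z \<in> annulus r R"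
      using rel[OF that] nz12(2)[OF that] by (simp add: field_simps)
  qed
  then show thesis by (rule that)
qed

section \<open>The Picard theorem\<close>

theorem corollary9:
  fixes L :: "chart_point set topology" and p :: "chart_point set \<Rightarrow> point"
  assumes "holomorphic_line_bundle (L, p)"
  shows "\<exists>!q :: rat. holomorphically_equivalent (L, p) (adelic_O q)"
proof -
  obtain r R f where f: "holomorphic_cocycle r R f" and L: "(L, p) = line_bundle r R f"
    using assms by (auto simp: holomorphic_line_bundle_def)
  obtain q where q: "equivalent_cocycles r R f 0 \<infinity> (monomial q)"
    using cocycle_equivalent_monomial[OF f] .
  have degree: "has_degree 1 f q'" if "holomorphically_equivalent (L, p) (adelic_O q')" for q'
  proof -
    from that obtain s S g s' S' g' where
      g: "holomorphic_cocycle s S g" "(L, p) = line_bundle s S g" and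
      g': "holomorphic_cocycle s' S' g'" "adelic_O q' = line_bundle s' S' g'" and
      eq: "equivalent_cocycles s S g s' S' g'"
      unfolding holomorphically_equivalent_def by blast
    have "s = r" "S = R" and gf: "\<forall>z\<in>annulus r R. g z = f z"
      using line_bundle_determines_cocycle[OF f g(1)] L g(2) by auto
    have "s' = 0" "S' = \<infinity>" and g'q: "\<forall>z\<in>annulus 0 \<infinity>. g' z = monomial q' z"
      using line_bundle_determines_cocycle[OF holomorphic_cocycle_monomial g'(1)] g'(2)
      by (auto simp: adelic_O_def)
    have deg: "has_degree 1 g q'"
      by (rule equivalence_determines_degree[OF g(1), where f' = g']) (use eq \<open>s' = 0\<close> \<open>S' =
          \<infinity>\<close> g'q in auto)
    have "leaf 1 x \<in> annulus r R" for x
      using f by (auto simp: annulus_def leaf_in_line modulus_leaf holomorphic_cocycle_def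
          one_ereal_def)
    with gf show ?thesis
      by (intro has_degree_cong[OF deg]) simp
  qed
  show ?thesis
  proof (rule ex1I[of _ q])
    show ex: "holomorphically_equivalent (L, p) (adelic_O q)"
      unfolding holomorphically_equivalent_def adelic_O_def
      by (rule exI[of _ r], rule exI[of _ R], rule exI[of _ f], rule exI[of _ 0],
          rule exI[of _ \<infinity>], rule exI[of _ "monomial q"])
         (intro conjI f L holomorphic_cocycle_monomial refl q)
    show "q' = q" if "holomorphically_equivalent (L, p) (adelic_O q')" for q'
      by (rule has_degree_unique[OF degree[OF that] degree[OF ex]])
  qed
qed

end
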